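(* Let $p\neq q$ be primes and let $Q$ be a connected quandle of size $pq$. The following are equivalent: (i) $Q\cong \mathrm{Aff}(\mathbb{Z}_p,f)\times \mathrm{Aff}(\mathbb{Z}_q,g)$ for some $f\in\mathrm{Aut}(\mathbb{Z}_p)$, $g\in\mathrm{Aut}(\mathbb{Z}_q)$. (ii) $Q$ is subdirectly reducible. In particular, there are $(p-2)(q-2)$ isomorphism classes of such quandles.
   Context: A quandle is a set $Q$ with a binary operation $*$ such that every left translation $L_a:b\mapsto a*b$ is a bijection, $a*(b*c)=(a*b)*(a*c)$ and $a*a=a$. $Q$ is connected if the group generated by all $L_a$ is transitive on $Q$. Congruences are equivalence relations compatible with $*$ and left division; $0_Q$ is equality. $Q$ is subdirectly irreducible if the intersection of all congruences different from $0_Q$ is different from $0_Q$, and subdirectly reducible otherwise. For an abelian group $A$ and $f\in\mathrm{Aut}(A)$, $\mathrm{Aff}(A,f)$ is the quandle on $A$ with $a*b=a+f(b-a)$. *)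

theory Defs
  imports
    "HOL-Algebra.Bij"
    "HOL-Algebra.Elementary_Groups"
    "HOL-Algebra.Generated_Groups"
    "HOL-Computational_Algebra.Primes"
begin

record 'a binary_struct = "'a partial_object" +
  qop :: "'a \<Rightarrow> 'a \<Rightarrow> 'a" (infixl \<open>\<triangleright>\<index>\<close> 70)

locale quandle =
  fixes Q (structure)
  assumes closed: "\<lbrakk>a \<in> carrier Q; b \<in> carrier Q\<rbrakk> \<Longrightarrow> a \<triangleright> b \<in> carrier Q"
    and bij: "a \<in> carrier Q \<Longrightarrow> bij_betw (\<lambda>b. a \<triangleright> b) (carrier Q) (carrier Q)"
    and left_distrib:
      "\<lbrakk>a \<in> carrier Q; b \<in> carrier Q; c \<in> carrier Q\<rbrakk>
        \<Longrightarrow> a \<triangleright> (b \<triangleright> c) = (a \<triangleright> b) \<triangleright> (a \<triangleright> c)"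
    and idem: "a \<in> carrier Q \<Longrightarrow> a \<triangleright> a = a"

text \<open>Restricted to the carrier, because the elements of \<^const>\<open>BijGroup\<close> are extensional.\<close>

definition left_translation :: "('a, 'm) binary_struct_scheme \<Rightarrow> 'a \<Rightarrow> 'a \<Rightarrow> 'a" where
  "left_translation Q a = restrict (\<lambda>b. a \<triangleright>\<^bsub>Q\<^esub> b) (carrier Q)"

definition left_division :: "('a, 'm) binary_struct_scheme \<Rightarrow> 'a \<Rightarrow> 'a \<Rightarrow> 'a" where
  "left_division Q a b = the_inv_into (carrier Q) (\<lambda>c. a \<triangleright>\<^bsub>Q\<^esub> c) b"

definition left_mult_group :: "('a, 'm) binary_struct_scheme \<Rightarrow> ('a \<Rightarrow> 'a) set" where
  "left_mult_group Q = generate (BijGroup (carrier Q)) (left_translation Q ` carrier Q)"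

locale connected_quandle = quandle +
  assumes transitive:
    "\<lbrakk>x \<in> carrier Q; y \<in> carrier Q\<rbrakk> \<Longrightarrow> \<exists>h \<in> left_mult_group Q. h x = y"

definition congruence_on :: "('a, 'm) binary_struct_scheme \<Rightarrow> ('a \<times> 'a) set \<Rightarrow> bool" where
  "congruence_on Q \<theta> \<longleftrightarrow>
     equiv (carrier Q) \<theta> \<and>
     (\<forall>(a, b) \<in> \<theta>. \<forall>(c, d) \<in> \<theta>.
        (a \<triangleright>\<^bsub>Q\<^esub> c, b \<triangleright>\<^bsub>Q\<^esub> d) \<in> \<theta> \<and>
        (left_division Q a c, left_division Q b d) \<in> \<theta>)"

text \<open>
  \<^term>\<open>Id_on (carrier Q)\<close> is the equality congruence. The intersection is taken inside
  \<^term>\<open>carrier Q \<times> carrier Q\<close>, which only matters when there is no congruence other than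
  equality, that is, when \<^term>\<open>Q\<close> has at most one element.
\<close>

definition subdirectly_irreducible :: "('a, 'm) binary_struct_scheme \<Rightarrow> bool" where
  "subdirectly_irreducible Q \<longleftrightarrow>
     (carrier Q \<times> carrier Q) \<inter> \<Inter>{\<theta>. congruence_on Q \<theta> \<and> \<theta> \<noteq> Id_on (carrier Q)}
       \<noteq> Id_on (carrier Q)"

abbreviation subdirectly_reducible :: "('a, 'm) binary_struct_scheme \<Rightarrow> bool" where
  "subdirectly_reducible Q \<equiv> \<not> subdirectly_irreducible Q"

text \<open>\<^term>\<open>a + f (b - a)\<close>, in the multiplicative notation of \<^const>\<open>monoid.mult\<close>.\<close>

definition Aff :: "('a, 'm) monoid_scheme \<Rightarrow> ('a \<Rightarrow> 'a) \<Rightarrow> 'a binary_struct" where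
  "Aff A f = \<lparr>carrier = carrier A, qop = (\<lambda>a b. a \<otimes>\<^bsub>A\<^esub> f (b \<otimes>\<^bsub>A\<^esub> inv\<^bsub>A\<^esub> a))\<rparr>"

definition quandle_prod ::
    "('a, 'm) binary_struct_scheme \<Rightarrow> ('b, 'n) binary_struct_scheme \<Rightarrow> ('a \<times> 'b) binary_struct"
    (infixr \<open>\<times>\<^sub>Q\<close> 80) where
  "Q \<times>\<^sub>Q R =
     \<lparr>carrier = carrier Q \<times> carrier R,
      qop = (\<lambda>(a, b) (a', b'). (a \<triangleright>\<^bsub>Q\<^esub> a', b \<triangleright>\<^bsub>R\<^esub> b'))\<rparr>"

definition quandle_isomorphic ::
    "('a, 'm) binary_struct_scheme \<Rightarrow> ('b, 'n) binary_struct_scheme \<Rightarrow> bool"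
    (infix \<open>\<cong>\<^sub>Q\<close> 50) where
  "Q \<cong>\<^sub>Q R \<longleftrightarrow>
     (\<exists>h. bij_betw h (carrier Q) (carrier R) \<and>
          (\<forall>a \<in> carrier Q. \<forall>b \<in> carrier Q. h (a \<triangleright>\<^bsub>Q\<^esub> b) = h a \<triangleright>\<^bsub>R\<^esub> h b))"

definition isomorphism_classes :: "'a binary_struct set \<Rightarrow> 'a binary_struct set set" where
  "isomorphism_classes S = S // {(Q, R) \<in> S \<times> S. Q \<cong>\<^sub>Q R}"

text \<open>
  Up to isomorphism, every finite quandle has a set of natural numbers as its carrier, so the
  isomorphism classes can be counted among these.
\<close>

definition reducible_connected_quandles :: "nat \<Rightarrow> nat binary_struct set" where
  "reducible_connected_quandles n =
     {Q. connected_quandle Q \<and> card (carrier Q) = n \<and> subdirectly_reducible Q}"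

end

theory Submission
  imports
    "HOL-Algebra.Multiplicative_Group"
    "HOL-Algebra.Sylow"
    Defs
    "HOL-Combinatorics.Permutations"
    "HOL-Computational_Algebra.Polynomial"
    "HOL-Number_Theory.Cong"
begin

text \<open>
  The heart of the matter is that a connected quandle \<open>Q\<close> of prime size \<open>p\<close> is affine. By Cauchy's
  theorem \<open>Q\<close> has an automorphism that is a \<open>p\<close>-cycle, so that \<open>Q\<close> lives on \<open>\<int>/p\<close> with
  \<open>a * b = a + \<phi>(b - a)\<close>. If the automorphism group is not 2-transitive, then some proper nonempty
  set of nonzero residues is stable under the difference maps of \<open>\<phi>\<close>, and comparing degrees of
  polynomial functions (Mueller's proof of Burnside's theorem on groups of prime degree) shows that
  \<open>\<phi>\<close> is linear. If it is 2-transitive, then \<open>Q\<close> is latin and any two elements of a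
  subquandle \<open>B\<close> generated by two elements generate \<open>B\<close>, so \<open>Aut B\<close> is sharply 2-transitive and
  the permutations \<open>L\<^sub>a L\<^sub>b\<^sup>-\<^sup>1\<close> of \<open>B\<close> form an abelian group of some prime exponent \<open>l\<close>. A permutation
  fixing \<open>B\<close> pointwise commutes with all \<open>L\<^sub>a\<close>, \<open>a \<in> B\<close>, so a commutator computation shows that
  \<open>L\<^sub>a L\<^sub>b\<^sup>-\<^sup>1\<close> has order dividing \<open>l\<^sup>2\<close> on all of \<open>Q\<close>; as it has no fixed point, \<open>l = p\<close> and \<open>B = Q\<close>.

  A subdirectly reducible connected quandle of size \<open>pq\<close> has two congruences with trivial
  intersection and classes of sizes \<open>p\<close> and \<open>q\<close>; the quotients by these are the two affine factors.
\<close>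

section \<open>Polynomial functions modulo a prime\<close>

text \<open>The case distinction is forced by arithmetic: the power sums of orders 1 to p - 2 of the
  set of all nonzero residues vanish modulo p, so for a 2-transitive automorphism group the
  comparison of degrees has nothing to work with. Two obstacles arise in that case. That the
  fixed-point-free automorphisms together with the identity form a group is Frobenius' theorem in
  general; here it follows by counting, since for fixed b there are exactly as many of them as
  nontrivial \<open>L\<^sub>a L\<^sub>b\<^sup>-\<^sup>1\<close>, whose products telescope. And
  sharpness is at first available only on B, because the values at two points determine an
  automorphism only on what these generate. The way back to Q rests on writing such a permutation as
  a product u V of two that commute on B, with V conjugate to the inverse of u.

  For size pq the danger is two congruences with trivial intersection and classes of the same size;
  it is averted by orbits too long to fit into a class. The numbers p - 2 and q - 2 count
  multipliers: 0 is not bijective and 1 is not connected.\<close>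

definition represents :: "int \<Rightarrow> int poly \<Rightarrow> (int \<Rightarrow> int) \<Rightarrow> bool" where
  "represents p P f \<longleftrightarrow> (\<forall>x. [f x = poly P x] (mod p)) \<and> (P \<noteq> 0 \<longrightarrow> \<not> p dvd lead_coeff P)"

lemma represents_reduce:
  assumes "p > 0" "\<And>x. [f x = poly P x] (mod p)"
  obtains R where "represents p R f" "degree R \<le> degree P" "\<And>i. [coeff R i = coeff P i] (mod p)"
proof
  define R where "R = map_poly (\<lambda>c. c mod p) P"
  have c: "coeff R i = coeff P i mod p" for i by (simp add: R_def coeff_map_poly)
  show d: "degree R \<le> degree P" by (rule degree_le) (auto simp: c coeff_eq_0)
  show "[coeff R i = coeff P i] (mod p)" for i by (simp add: c cong_def)
  have "[poly R x = poly P x] (mod p)" for x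
  proof -
    have "poly R x = (\<Sum>i\<le>degree P. coeff R i * x ^ i)"
      unfolding poly_altdef using d by (intro sum.mono_neutral_left) (auto simp: coeff_eq_0)
    also have "[\<dots> = (\<Sum>i\<le>degree P. coeff P i * x ^ i)] (mod p)"
      by (intro cong_sum cong_mult cong_refl) (simp add: c cong_def)
    finally show ?thesis by (simp add: poly_altdef)
  qed
  moreover have "\<not> p dvd lead_coeff R" if "R \<noteq> 0"
  proof -
    have "lead_coeff R = lead_coeff R mod p" by (simp add: c)
    then show ?thesis using that by (metis dvd_imp_mod_0 leading_coeff_0_iff)
  qed
  ultimately show "represents p R f"
    unfolding represents_def using assms(2) by (meson cong_sym cong_trans)
qed

lemma poly_zero_mod_prime:
  fixes p :: int
  assumes "prime p" "\<And>x. p dvd poly P x" "int (degree P) < p"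
  shows "p dvd coeff P i"
proof -
  \<comment> \<open>The induction on the degree needs an arbitrary set of roots, since splitting off
    X - a costs the root \<open>a\<close>. Distinct elements of \<open>{0..<p}\<close> differ by
    units modulo p, so the other roots survive in the quotient.\<close>
  have main: "p dvd coeff P i"
    if "finite S" "\<And>x. x \<in> S \<Longrightarrow> p dvd poly P x" "degree P < card S" "S \<subseteq> {0..<p}" for S P i
    using that
  proof (induction "degree P" arbitrary: P S i)
    case 0
    then obtain x where "x \<in> S" by (metis card.empty ex_in_conv less_nat_zero_code)
    with 0 have "p dvd coeff P 0" by (metis degree_0_id poly_pCons coeff_pCons_0 mult_zero_right poly_0 add_0_right)
    then show ?case using 0 by (cases i) (auto simp: coeff_eq_0)
  next
    case (Suc n)
    then obtain a where a: "a \<in> S" by (metis card.empty ex_in_conv less_nat_zero_code)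
    define R where "R = synthetic_div P a"
    have P: "P = [:-a, 1:] * R + [:poly P a:]" by (simp only: R_def synthetic_div_correct')
    have dR: "degree R = n" using Suc.hyps(2) by (simp add: R_def degree_synthetic_div)
    have ev: "poly P x = (x - a) * poly R x + poly P a" for x
      by (subst P) (simp add: algebra_simps)
    have R: "p dvd poly R x" if "x \<in> S - {a}" for x
    proof -
      have "p dvd (x - a) * poly R x"
        using ev[of x] Suc.prems(2) that a by (metis Diff_iff add_diff_cancel_right' dvd_diff)
      moreover have "\<not> p dvd x - a"
      proof
        assume d: "p dvd x - a"
        have "x \<in> {0..<p}" "a \<in> {0..<p}" using that a Suc.prems(4) by auto
        then have "x = a" using d by (metis atLeastLessThan_iff mod_eq_dvd_iff mod_pos_pos_trivial)
        then show False using that by auto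
      qed
      ultimately show ?thesis using assms(1) by (simp add: prime_dvd_mult_iff)
    qed
    have "p dvd coeff R j" for j
      by (rule Suc.hyps(1)[of R "S - {a}"])
        (use dR Suc.hyps(2) Suc.prems a R in \<open>auto simp: card_Diff_singleton\<close>)
    moreover have "p dvd poly P a" using a Suc.prems by auto
    ultimately show ?case by (subst P) (simp add: coeff_pCons split: nat.split)
  qed
  show ?thesis
    by (rule main[of "{0..<p}"]) (use assms in auto)
qed

text \<open>Below degree p a polynomial function modulo p determines its polynomial modulo p, so the
  degree belongs to the function. This is why \<open>represents\<close> demands a leading
  coefficient prime to p: the integer polynomial then has the degree of its reduction.\<close>

lemma represents_degree_le:
  fixes p :: int
  assumes "prime p" "represents p P f" "represents p R g" "\<And>x. [f x = g x] (mod p)"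
    "int (degree P) < p" "int (degree R) < p"
  shows "degree P \<le> degree R"
proof (rule ccontr)
  assume n: "\<not> degree P \<le> degree R"
  have "p dvd coeff (P - R) (degree P)"
  proof (rule poly_zero_mod_prime)
    fix x
    have "[poly P x = poly R x] (mod p)"
      using assms(2,3,4) unfolding represents_def by (meson cong_sym cong_trans)
    then show "p dvd poly (P - R) x" by (simp add: cong_iff_dvd_diff)
    have "degree (P - R) \<le> degree P" using n by (intro degree_diff_le) auto
    then show "int (degree (P - R)) < p" using assms by linarith
  qed (use assms in auto)
  moreover have "coeff R (degree P) = 0" using n by (intro coeff_eq_0) simp
  ultimately have "p dvd lead_coeff P" by simp
  then show False using assms(2) n unfolding represents_def by auto
qed

section \<open>Lagrange interpolation modulo p\<close>

definition lagrange_basis :: "int set \<Rightarrow> int \<Rightarrow> int poly" where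
  "lagrange_basis S a = (\<Prod>b\<in>S - {a}. [:- b, 1:])"

lemma degree_lagrange_basis: "finite S \<Longrightarrow> a \<in> S \<Longrightarrow> degree (lagrange_basis S a) = card S - 1"
  unfolding lagrange_basis_def by (subst degree_prod_eq_sum_degree) auto

lemma poly_lagrange_basis_eq_0:
  "finite S \<Longrightarrow> b \<in> S \<Longrightarrow> b \<noteq> a \<Longrightarrow> poly (lagrange_basis S a) b = 0"
  unfolding lagrange_basis_def by (auto simp: poly_prod)

lemma poly_lagrange_basis_neq_0:
  assumes "prime p" "S \<subseteq> {0..<p}" "x \<in> {0..<p}" "x \<notin> S - {a}"
  shows "\<not> p dvd poly (lagrange_basis S a) x"
proof
  assume "p dvd poly (lagrange_basis S a) x"
  moreover have "finite S" using assms(2) finite_subset by blast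
  ultimately obtain b where b: "b \<in> S - {a}" "p dvd x - b"
    using assms(1) unfolding lagrange_basis_def by (auto simp: poly_prod prime_dvd_prod_iff)
  then have "b \<in> {0..<p}" using assms by auto
  with b(2) assms(3) have "x = b" by (metis atLeastLessThan_iff mod_eq_dvd_iff mod_pos_pos_trivial)
  then show False using b assms by auto
qed

lemma represents_exists:
  fixes p :: int
  assumes "prime p" "\<And>x y. [x = y] (mod p) \<Longrightarrow> [f x = f y] (mod p)"
  obtains P where "represents p P f" "int (degree P) < p"
proof -
  have p0: "p > 0" using assms(1) by (simp add: prime_gt_0_int)
  define Z where "Z = {0..<p}"
  have Z: "finite Z" "card Z = nat p" "Z \<subseteq> {0..<p}" by (auto simp: Z_def)
  \<comment> \<open>\<open>lagrange_basis\<close> is not normalised to the value 1 at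
    \<open>a\<close>; its value there is a unit modulo p, so a factor producing \<open>f a\<close>
    exists.\<close>
  have "\<exists>c. [c * poly (lagrange_basis Z a) a = f a] (mod p)" if "a \<in> Z" for a
  proof -
    have "\<not> p dvd poly (lagrange_basis Z a) a"
      using that Z assms by (intro poly_lagrange_basis_neq_0) (auto simp: Z_def)
    then have "coprime (poly (lagrange_basis Z a) a) p"
      using assms(1) by (metis coprime_commute prime_imp_coprime)
    then obtain d where "[poly (lagrange_basis Z a) a * d = 1] (mod p)"
      using cong_solve_coprime_int by blast
    then have "[f a * (poly (lagrange_basis Z a) a * d) = f a * 1] (mod p)"
      by (rule cong_scalar_left)
    then show ?thesis by (intro exI[of _ "d * f a"]) (simp add: ac_simps)
  qed
  then obtain c where c: "\<And>a. a \<in> Z \<Longrightarrow> [c a * poly (lagrange_basis Z a) a = f a] (mod p)"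
    by metis
  define P where "P = (\<Sum>a\<in>Z. smult (c a) (lagrange_basis Z a))"
  have dP: "degree P \<le> nat p - 1"
    unfolding P_def by (rule degree_sum_le) (use Z degree_lagrange_basis in auto)
  have "[f x = poly P x] (mod p)" for x
  proof -
    define y where "y = x mod p"
    have y: "y \<in> Z" "[x = y] (mod p)" using p0 by (auto simp: y_def Z_def cong_def)
    have "poly P y = (\<Sum>a\<in>Z. c a * poly (lagrange_basis Z a) y)"
      by (simp add: P_def poly_sum)
    also have "\<dots> = c y * poly (lagrange_basis Z y) y"
      using y Z by (subst sum.remove[of _ y]) (auto simp: poly_lagrange_basis_eq_0 intro!: sum.neutral)
    finally have "[poly P y = f y] (mod p)" using c y by auto
    moreover have "[poly P x = poly P y] (mod p)" using y(2) by (auto simp: poly_altdef intro!: cong_sum cong_mult cong_pow)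
    ultimately show ?thesis using assms(2)[OF y(2)] by (meson cong_sym cong_trans)
  qed
  then obtain R where "represents p R f" "degree R \<le> degree P"
    using represents_reduce p0 by blast
  then show ?thesis using that[of R] dP p0 by linarith
qed

section \<open>The operator summing differences over a set of shifts\<close>

definition shift_sum :: "int set \<Rightarrow> (int \<Rightarrow> int) \<Rightarrow> int \<Rightarrow> int" where
  "shift_sum U f y = (\<Sum>u\<in>U. f (y + u) - f y)"

text \<open>In the binomial expansion of \<open>(y + u) ^ j - y ^ j\<close> the shifts enter only
  through the power sums of \<open>U\<close>: the coefficient of \<open>y ^ i\<close> carries the
  one of order \<open>j - i\<close>.\<close>

lemma shift_sum_power:
  "shift_sum U (\<lambda>x. x ^ j) y = (\<Sum>i<j. int (j choose i) * (\<Sum>u\<in>U. u ^ (j - i)) * y ^ i)"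
proof -
  have "(y + u) ^ j - y ^ j = (\<Sum>i<j. int (j choose i) * u ^ (j - i) * y ^ i)" for u
  proof -
    have "(y + u) ^ j = (\<Sum>i\<le>j. int (j choose i) * y ^ i * u ^ (j - i))"
      by (simp add: binomial_ring)
    then show ?thesis by (simp add: lessThan_Suc_atMost[symmetric] ac_simps)
  qed
  then show ?thesis
    unfolding shift_sum_def
    by (simp add: sum_distrib_left sum_distrib_right sum.swap[of _ U])
qed

text \<open>Since the power sums of orders 1 to \<open>m - 1\<close> vanish, a power
  \<open>x ^ j\<close> contributes only degrees up to \<open>j - m\<close>. The coefficient of
  degree \<open>degree P - m\<close> is the leading coefficient times a binomial coefficient times
  the power sum of order \<open>m\<close>, three units modulo p. For \<open>degree P < m\<close> the
  truncated difference is 0, and so is the degree of the image.\<close>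

lemma represents_shift_sum:
  fixes p :: int
  assumes p: "prime p" and P: "represents p P f" "int (degree P) < p"
    and m: "m \<ge> 1" "\<not> p dvd (\<Sum>u\<in>U. u ^ m)"
    and less: "\<And>i. \<lbrakk>1 \<le> i; i < m\<rbrakk> \<Longrightarrow> p dvd (\<Sum>u\<in>U. u ^ i)"
  obtains R where "represents p R (shift_sum U f)" "degree R = degree P - m"
proof -
  define n where "n = degree P"
  define s where "s i = (\<Sum>u\<in>U. u ^ i)" for i
  define a where "a j i = coeff P j * (int (j choose i) * s (j - i))" for j i
  define T where "T = (\<Sum>j\<le>n. \<Sum>i | i < j \<and> i + m \<le> j. monom (a j i) i)"
  have "[shift_sum U f y = poly T y] (mod p)" for y
  proof -
    have "[shift_sum U f y = (\<Sum>u\<in>U. poly P (y + u) - poly P y)] (mod p)"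
      unfolding shift_sum_def using P(1) by (intro cong_sum cong_diff) (auto simp: represents_def)
    also have "(\<Sum>u\<in>U. poly P (y + u) - poly P y) = (\<Sum>j\<le>n. coeff P j * shift_sum U (\<lambda>x. x ^ j) y)"
      by (simp add: poly_altdef n_def shift_sum_def sum_distrib_left right_diff_distrib
          sum_subtractf[symmetric] sum.swap[of _ U])
    also have "\<dots> = (\<Sum>j\<le>n. \<Sum>i<j. a j i * y ^ i)"
      by (simp add: shift_sum_power sum_distrib_left a_def s_def ac_simps)
    also have "[\<dots> = (\<Sum>j\<le>n. \<Sum>i<j. if i + m \<le> j then a j i * y ^ i else 0)] (mod p)"
    proof (intro cong_sum)
      fix j i :: nat assume "i \<in> {..<j}"
      then have "p dvd a j i" if "\<not> i + m \<le> j"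
        using less[of "j - i"] that by (auto simp: a_def s_def)
      then show "[a j i * y ^ i = (if i + m \<le> j then a j i * y ^ i else 0)] (mod p)"
        by (auto simp: cong_0_iff)
    qed
    also have "(\<Sum>j\<le>n. \<Sum>i<j. if i + m \<le> j then a j i * y ^ i else 0) = poly T y"
      by (auto simp: T_def poly_sum poly_monom sum.If_cases intro!: sum.cong)
    finally show ?thesis .
  qed
  then obtain R where R: "represents p R (shift_sum U f)" "degree R \<le> degree T"
      "\<And>i. [coeff R i = coeff T i] (mod p)"
    using represents_reduce p by (metis prime_gt_0_int)
  have cT: "coeff T l = (\<Sum>j\<le>n. if l < j \<and> l + m \<le> j then a j l else 0)" for l :: nat
    unfolding T_def coeff_sum coeff_monom
  proof (intro sum.cong refl)
    fix j
    have "finite {i. i < j \<and> i + m \<le> j}" by simp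
    then show "(\<Sum>i | i < j \<and> i + m \<le> j. if i = l then a j i else 0)
        = (if l < j \<and> l + m \<le> j then a j l else 0)"
      by (simp add: sum.delta)
  qed
  have dT: "degree T \<le> n - m"
    by (rule degree_le) (auto simp: cT intro!: sum.neutral)
  have "degree R = n - m"
  proof (cases "m \<le> n")
    case True
    have "coeff T (n - m) = a n (n - m)"
      unfolding cT using True m(1) by (subst sum.remove[of _ n]) (auto intro!: sum.neutral)
    moreover have "\<not> p dvd a n (n - m)"
    proof -
      have "P \<noteq> 0" using True m(1) n_def by auto
      then have "\<not> p dvd coeff P n" using P(1) by (auto simp: represents_def n_def)
      \<comment> \<open>As \<open>n < p\<close>, the prime does not divide \<open>fact n\<close>,
        hence no binomial coefficient dividing it.\<close>
      moreover have "\<not> p dvd int (n choose (n - m))"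
      proof -
        have pn: "prime (nat p)" using p by (subst (asm) prime_int_nat_transfer) simp
        have "\<not> nat p dvd fact n"
          using pn P(2) by (subst prime_dvd_fact_iff) (auto simp: n_def)
        moreover have "(n choose (n - m)) dvd fact n"
          by (metis binomial_fact_lemma diff_le_self dvd_triv_right)
        ultimately have "\<not> nat p dvd (n choose (n - m))" by (meson dvd_trans)
        then show ?thesis using p by (metis int_dvd_int_iff nat_0_le prime_ge_0_int)
      qed
      ultimately show ?thesis
        using p m(2) True by (auto simp: a_def s_def prime_dvd_mult_iff)
    qed
    ultimately have "\<not> p dvd coeff R (n - m)" using R(3)[of "n - m"] by (simp add: cong_dvd_iff)
    then have "n - m \<le> degree R" by (metis dvd_0_right le_degree)
    then show ?thesis using R(2) dT by linarith
  qed (use R(2) dT in auto)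
  then show ?thesis using that R(1) n_def by blast
qed

lemma cong_shift_sum:
  "(\<And>x. [f x = h x] (mod p)) \<Longrightarrow> [shift_sum U f x = shift_sum U h x] (mod p)"
  unfolding shift_sum_def by (intro cong_sum cong_diff)

lemma shift_sum_periodic:
  assumes "\<And>x y. [x = y] (mod p) \<Longrightarrow> [f x = f y] (mod p)" "[x = y] (mod p)"
  shows "[shift_sum U f x = shift_sum U f y] (mod p)"
  unfolding shift_sum_def by (intro cong_sum cong_diff assms(1) cong_add assms(2) cong_refl)

lemma represents_shift_sum_iterate:
  fixes p :: int
  assumes p: "prime p" and P: "represents p P f" "int (degree P) < p"
    and m: "m \<ge> 1" "\<not> p dvd (\<Sum>u\<in>U. u ^ m)"
    and less: "\<And>i. \<lbrakk>1 \<le> i; i < m\<rbrakk> \<Longrightarrow> p dvd (\<Sum>u\<in>U. u ^ i)"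
  obtains R where "represents p R ((shift_sum U ^^ k) f)" "degree R = degree P - k * m"
proof -
  have "\<exists>R. represents p R ((shift_sum U ^^ k) f) \<and> degree R = degree P - k * m"
  proof (induction k)
    case 0
    then show ?case using P by auto
  next
    case (Suc k)
    then obtain R where R: "represents p R ((shift_sum U ^^ k) f)" "degree R = degree P - k * m"
      by blast
    then have "int (degree R) < p" using P(2) by simp
    then obtain R' where "represents p R' (shift_sum U ((shift_sum U ^^ k) f))" "degree R' = degree R - m"
      using represents_shift_sum[OF p R(1) _ m less] by blast
    then show ?case using R(2) by auto
  qed
  then show ?thesis using that by blast
qed

text \<open>If all these power sums vanished, summing a polynomial of degree at most p - 2 over
  \<open>U\<close> would give \<open>card U\<close> times its constant term. The Lagrange polynomial
  of a nonzero residue \<open>a\<close> outside \<open>U\<close> has degree p - 2 and vanishes on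
  \<open>U\<close> but not at 0, while \<open>card U\<close> lies strictly between 0 and p.\<close>

lemma exists_nonvanishing_moment:
  fixes p :: int
  assumes p: "prime p" and U: "U \<subseteq> {1..<p}" "U \<noteq> {}" "U \<noteq> {1..<p}"
  obtains m where "m \<ge> 1" "int m \<le> p - 2" "\<not> p dvd (\<Sum>u\<in>U. u ^ m)"
    "\<And>i. \<lbrakk>1 \<le> i; i < m\<rbrakk> \<Longrightarrow> p dvd (\<Sum>u\<in>U. u ^ i)"
proof -
  have fU: "finite U" using U(1) finite_subset by blast
  have "\<exists>m\<ge>1. int m \<le> p - 2 \<and> \<not> p dvd (\<Sum>u\<in>U. u ^ m)"
  proof (rule ccontr)
    assume "\<not> ?thesis"
    then have van: "\<And>i. \<lbrakk>i \<ge> 1; int i \<le> p - 2\<rbrakk> \<Longrightarrow> p dvd (\<Sum>u\<in>U. u ^ i)" by blast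
    obtain a where a: "a \<in> {1..<p}" "a \<notin> U" using U by blast
    define Z where "Z = {1..<p}"
    define L where "L = lagrange_basis Z a"
    have dL: "degree L = nat p - 2"
      using a unfolding L_def Z_def by (subst degree_lagrange_basis) auto
    have "(\<Sum>u\<in>U. poly L u) = 0"
    proof (intro sum.neutral ballI)
      fix u assume "u \<in> U"
      then show "poly L u = 0" unfolding L_def using U a
        by (intro poly_lagrange_basis_eq_0) (auto simp: Z_def)
    qed
    moreover have "[(\<Sum>u\<in>U. poly L u) = int (card U) * poly L 0] (mod p)"
    proof -
      have "(\<Sum>u\<in>U. poly L u) = (\<Sum>i\<le>degree L. coeff L i * (\<Sum>u\<in>U. u ^ i))"
        by (simp add: poly_altdef sum_distrib_left sum.swap[of _ U])
      also have "[\<dots> = (\<Sum>i\<le>degree L. if i = 0 then coeff L 0 * int (card U) else 0)] (mod p)"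
      proof (intro cong_sum)
        fix i assume "i \<in> {..degree L}"
        then have "i = 0 \<or> p dvd (\<Sum>u\<in>U. u ^ i)" using van[of i] dL a(1) by (cases "i = 0") auto
        then show "[coeff L i * (\<Sum>u\<in>U. u ^ i) = (if i = 0 then coeff L 0 * int (card U) else 0)] (mod p)"
          by (auto simp: cong_0_iff)
      qed
      finally show ?thesis by (simp add: poly_0_coeff_0 mult.commute)
    qed
    ultimately have "p dvd int (card U) * poly L 0" by (metis cong_0_iff cong_sym)
    moreover have "\<not> p dvd poly L 0"
      unfolding L_def using p a by (intro poly_lagrange_basis_neq_0) (auto simp: Z_def)
    moreover have "\<not> p dvd int (card U)"
    proof -
      have "card U < card {1..<p}" using U fU by (intro psubset_card_mono) auto
      moreover have "card U > 0" using U fU by (simp add: card_gt_0_iff)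
      ultimately show ?thesis using a by (auto dest: zdvd_imp_le)
    qed
    ultimately show False using p by (simp add: prime_dvd_mult_iff)
  qed
  then obtain m where m: "m \<ge> 1 \<and> int m \<le> p - 2 \<and> \<not> p dvd (\<Sum>u\<in>U. u ^ m)"
    "\<And>i. i < m \<Longrightarrow> \<not> (i \<ge> 1 \<and> int i \<le> p - 2 \<and> \<not> p dvd (\<Sum>u\<in>U. u ^ i))"
    using exists_least_iff[of "\<lambda>m. m \<ge> 1 \<and> int m \<le> p - 2 \<and> \<not> p dvd (\<Sum>u\<in>U. u ^ m)"] by blast
  show ?thesis
    by (rule that[of m]) (use m(1) in simp, use m(1) in simp, use m(1) in simp, use m in force)
qed

text \<open>The operator \<^term>\<open>shift_sum U\<close> commutes with composition with \<open>g\<close> and lowers degrees by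
  exactly \<open>m\<close>, the index of the first nonvanishing power sum of \<open>U\<close>. Iterating it \<open>k\<close> times leaves
  degrees at most \<open>e\<close>, where \<open>k\<close> is chosen such that \<open>2 * e < p\<close>. If \<open>g\<close> had degree \<open>d > 1\<close>, some
  multiple of \<open>d\<close> would lie strictly between \<open>e\<close> and \<open>p\<close> and be the degree of the composition of a
  polynomial in the image of the iterated operator with \<open>g\<close>.\<close>

theorem affine_of_difference_invariant:
  fixes p :: int and g :: "int \<Rightarrow> int"
  assumes p: "prime p"
    and per: "\<And>x y. [x = y] (mod p) \<Longrightarrow> [g x = g y] (mod p)"
    and inj: "\<And>x y. [g x = g y] (mod p) \<Longrightarrow> [x = y] (mod p)"
    and U: "U \<subseteq> {1..<p}" "U \<noteq> {}" "U \<noteq> {1..<p}"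
    and inv: "\<And>y u. u \<in> U \<Longrightarrow> (g (y + u) - g y) mod p \<in> U"
  obtains c where "\<And>x. [g x = g 0 + c * x] (mod p)"
proof -
  have fU: "finite U" using U(1) finite_subset by blast
  have per_sum: "[(shift_sum U ^^ k) f x = (shift_sum U ^^ k) f y] (mod p)"
    if "\<And>x y. [x = y] (mod p) \<Longrightarrow> [f x = f y] (mod p)" "[x = y] (mod p)" for f x y k
    using that(2)
  proof (induction k arbitrary: x y)
    case 0
    then show ?case using that(1) by simp
  next
    case (Suc k)
    then show ?case by (simp del: funpow.simps add: funpow.simps(2)) (rule shift_sum_periodic)
  qed
  \<comment> \<open>Sending \<open>u\<close> to \<open>g (y + u) - g y\<close> modulo p is an
    injection of the finite set \<open>U\<close> into itself, so the sum at \<open>g y\<close> can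
    be reindexed along it.\<close>
  have comm1: "[shift_sum U f (g y) = shift_sum U (f \<circ> g) y] (mod p)"
    if f: "\<And>x y. [x = y] (mod p) \<Longrightarrow> [f x = f y] (mod p)" for f y
  proof -
    define h where "h u = (g (y + u) - g y) mod p" for u
    have "inj_on h U"
    proof
      fix u v assume uv: "u \<in> U" "v \<in> U" "h u = h v"
      then have "[g (y + u) = g (y + v)] (mod p)"
        by (simp add: h_def cong_def mod_eq_dvd_iff)
      then have "[u = v] (mod p)" using inj cong_add_lcancel by blast
      moreover have "u \<in> {1..<p}" "v \<in> {1..<p}" using uv U by auto
      ultimately show "u = v" by (simp add: cong_def)
    qed
    moreover have "h ` U \<subseteq> U" using inv by (auto simp: h_def)
    ultimately have "bij_betw h U U" using fU by (simp add: bij_betw_def endo_inj_surj)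
    then have "shift_sum U f (g y) = (\<Sum>u\<in>U. f (g y + h u) - f (g y))"
      unfolding shift_sum_def by (rule sum.reindex_bij_betw[symmetric])
    also have "[\<dots> = shift_sum U (f \<circ> g) y] (mod p)"
      unfolding shift_sum_def comp_def
    proof (intro cong_sum cong_diff f cong_refl)
      fix u
      show "[g y + h u = g (y + u)] (mod p)" by (simp add: h_def cong_def mod_simps)
    qed
    finally show ?thesis .
  qed
  have comm: "[(shift_sum U ^^ k) f (g y) = (shift_sum U ^^ k) (f \<circ> g) y] (mod p)"
    if f: "\<And>x y. [x = y] (mod p) \<Longrightarrow> [f x = f y] (mod p)" for f k y
  proof (induction k arbitrary: y)
    case 0
    then show ?case by simp
  next
    case (Suc k)
    have "[shift_sum U ((shift_sum U ^^ k) f) (g y) = shift_sum U ((shift_sum U ^^ k) f \<circ> g) y] (mod p)"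
      by (rule comm1) (rule per_sum[OF f])
    also have "[shift_sum U ((shift_sum U ^^ k) f \<circ> g) y = shift_sum U ((shift_sum U ^^ k) (f \<circ> g)) y] (mod p)"
      by (rule cong_shift_sum) (use Suc in \<open>simp add: comp_def\<close>)
    finally have "[shift_sum U ((shift_sum U ^^ k) f) (g y) = shift_sum U ((shift_sum U ^^ k) (f \<circ> g)) y] (mod p)" .
    moreover have "(shift_sum U ^^ Suc k) h = shift_sum U ((shift_sum U ^^ k) h)" for h by simp
    ultimately show ?case by (simp only:)
  qed
  obtain m where m: "m \<ge> 1" "int m \<le> p - 2" "\<not> p dvd (\<Sum>u\<in>U. u ^ m)"
    "\<And>i. \<lbrakk>1 \<le> i; i < m\<rbrakk> \<Longrightarrow> p dvd (\<Sum>u\<in>U. u ^ i)"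
    using exists_nonvanishing_moment[OF p U] by metis
  \<comment> \<open>The choice gives \<open>k * m + e = p - 1\<close> with
    \<open>1 \<le> e \<le> m \<le> k * m\<close>, whence \<open>2 * e < p\<close>. Keeping
    \<open>e\<close> positive leaves room for \<open>i = 1\<close> in \<open>bound\<close>, which
    yields \<open>d \<le> e\<close>.\<close>
  define N where "N = nat p - 2"
  define k where "k = N div m"
  define e where "e = N mod m + 1"
  have mN: "m \<le> N" using m by (simp add: N_def)
  have Ne: "int (k * m + e) = p - 1"
    using m by (simp add: k_def e_def N_def del: of_nat_add of_nat_mult)
  have "e \<le> m" using m(1) by (simp add: e_def Suc_leI)
  moreover have "0 < k" using mN m(1) by (simp add: k_def div_greater_zero_iff)
  then have "m \<le> k * m" by simp
  ultimately have e2: "int (2 * e) < p" using Ne by linarith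
  obtain G where G: "represents p G g" "int (degree G) < p"
    using per by (rule represents_exists[OF p])
  define d where "d = degree G"
  have bound: "i * d \<le> e" if i: "i \<le> e" "int (i * d) < p" "d \<ge> 2" for i
  proof -
    \<comment> \<open>The degree \<open>k * m + i\<close> is at most p - 1, and the iterate lowers
      it to exactly \<open>i\<close>; composing with \<open>g\<close> then gives degree
      \<open>i * d\<close>. By commutation this is the iterate of \<open>f \<circ> g\<close>, and of
      a degree below p at most \<open>e\<close> remains.\<close>
    define f where "f = (\<lambda>x::int. x ^ (k * m + i))"
    have f: "\<And>x y. [x = y] (mod p) \<Longrightarrow> [f x = f y] (mod p)" by (simp add: f_def cong_pow)
    have dm: "degree (monom (1 :: int) j) = j" for j by (rule degree_monom_eq) simp
    have "represents p (monom 1 (k * m + i)) f"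
      using p not_prime_unit[of p] by (auto simp: represents_def f_def poly_monom dm)
    moreover have "int (k * m + i) < p" using Ne i(1) by linarith
    ultimately obtain H where H: "represents p H ((shift_sum U ^^ k) f)" "degree H = i"
      using represents_shift_sum_iterate[OF p _ _ m(1,3,4), of "monom 1 (k * m + i)" f k]
      by (auto simp: dm)
    have 1: "represents p (pcompose H G) ((shift_sum U ^^ k) f \<circ> g)"
      unfolding represents_def
    proof (intro conjI allI impI)
      fix x
      have "[(shift_sum U ^^ k) f (g x) = (shift_sum U ^^ k) f (poly G x)] (mod p)"
        using G(1) by (intro per_sum f) (auto simp: represents_def)
      also have "[(shift_sum U ^^ k) f (poly G x) = poly (pcompose H G) x] (mod p)"
        using H(1) by (simp add: represents_def poly_pcompose)
      finally show "[((shift_sum U ^^ k) f \<circ> g) x = poly (pcompose H G) x] (mod p)" by simp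
    next
      assume "pcompose H G \<noteq> 0"
      then have "H \<noteq> 0" by auto
      moreover have "G \<noteq> 0" using \<open>d \<ge> 2\<close> d_def by auto
      ultimately show "\<not> p dvd lead_coeff (pcompose H G)"
        using H(1) G(1) p \<open>d \<ge> 2\<close>
        by (subst lead_coeff_comp)
          (auto simp: represents_def d_def prime_dvd_mult_iff dest: prime_dvd_power)
    qed
    have "\<And>x y. [x = y] (mod p) \<Longrightarrow> [(f \<circ> g) x = (f \<circ> g) y] (mod p)" using f per by simp
    then obtain F where F: "represents p F (f \<circ> g)" "int (degree F) < p"
      by (rule represents_exists[OF p])
    obtain R where R: "represents p R ((shift_sum U ^^ k) (f \<circ> g))" "degree R = degree F - k * m"
      using represents_shift_sum_iterate[OF p F m(1,3,4)] by blast
    have "degree (pcompose H G) \<le> degree R"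
    proof (rule represents_degree_le[OF p 1 R(1)])
      show "[((shift_sum U ^^ k) f \<circ> g) x = (shift_sum U ^^ k) (f \<circ> g) x] (mod p)" for x
        using comm[OF f] by simp
    qed (use F R i H d_def in \<open>auto simp: degree_pcompose\<close>)
    then have "i * d \<le> degree F - k * m" by (simp add: degree_pcompose H(2) R(2) d_def)
    then show ?thesis using F(2) Ne by linarith
  qed
  have "d \<le> 1"
  proof (rule ccontr)
    assume "\<not> d \<le> 1"
    then have d2: "d \<ge> 2" by simp
    have "1 * d \<le> e" by (rule bound) (use G d2 in \<open>auto simp: d_def e_def\<close>)
    \<comment> \<open>\<open>(i + 1) * d\<close> is the first multiple of \<open>d\<close> beyond
      \<open>e\<close>; as \<open>i * d\<close> and \<open>d\<close> are both at most
      \<open>e\<close>, it stays within \<open>2 * e\<close>.\<close>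
    define i where "i = e div d"
    have i: "i \<ge> 1" "i * d \<le> e" "e < (i + 1) * d"
      using \<open>1 * d \<le> e\<close> d2 by (auto simp: i_def div_greater_zero_iff Suc_le_eq dividend_less_div_times add.commute)
    have "i * 2 \<le> i * d" using d2 by simp
    then have "i + 1 \<le> e" using i by linarith
    moreover have "(i + 1) * d \<le> 2 * e" using i(2) \<open>1 * d \<le> e\<close> by simp
    then have "int ((i + 1) * d) < p" using e2 by linarith
    ultimately have "(i + 1) * d \<le> e" using bound d2 by blast
    then show False using i by simp
  qed
  define a b where "a = coeff G 0" and "b = coeff G 1"
  have "G = [:a, b:]"
  proof (rule poly_eqI)
    show "coeff G i = coeff [:a, b:] i" for i
      using \<open>d \<le> 1\<close> by (cases i; cases "i - 1") (auto simp: a_def b_def d_def coeff_eq_0)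
  qed
  then have ab: "[g x = a + b * x] (mod p)" for x using G(1) unfolding represents_def \<open>G = _\<close> by (auto simp: ac_simps)
  have "[g x = g 0 + b * x] (mod p)" for x
  proof -
    have "[g 0 + b * x = a + b * x] (mod p)" using ab[of 0] by (auto intro: cong_add)
    then show ?thesis using ab[of x] by (meson cong_sym cong_trans)
  qed
  then show ?thesis using that by blast
qed

section \<open>Automorphisms of quandles\<close>

abbreviation pinv :: "('a \<Rightarrow> 'a) \<Rightarrow> 'a \<Rightarrow> 'a" where
  "pinv \<equiv> inv_into UNIV"

text \<open>Automorphisms are extended by the identity outside the carrier, so that they are bijections of
  the whole type.\<close>

definition quandle_auts :: "('a, 'm) binary_struct_scheme \<Rightarrow> ('a \<Rightarrow> 'a) set" where
  "quandle_auts Q = {g. g permutes carrier Q \<and>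
     (\<forall>a\<in>carrier Q. \<forall>b\<in>carrier Q. g (a \<triangleright>\<^bsub>Q\<^esub> b) = g a \<triangleright>\<^bsub>Q\<^esub> g b)}"

text \<open>The variant of \<open>left_translation\<close> that is the identity off the carrier
  instead of undefined, so that translations lie in \<open>quandle_auts\<close>.\<close>

definition left_perm :: "('a, 'm) binary_struct_scheme \<Rightarrow> 'a \<Rightarrow> 'a \<Rightarrow> 'a" where
  "left_perm Q a x = (if x \<in> carrier Q then a \<triangleright>\<^bsub>Q\<^esub> x else x)"

lemma aut_permutes: "g \<in> quandle_auts Q \<Longrightarrow> g permutes carrier Q"
  by (simp add: quandle_auts_def)

lemma aut_closed [simp]: "g \<in> quandle_auts Q \<Longrightarrow> g x \<in> carrier Q \<longleftrightarrow> x \<in> carrier Q"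
  by (simp add: aut_permutes permutes_in_image)

lemma aut_inj: "g \<in> quandle_auts Q \<Longrightarrow> g x = g y \<longleftrightarrow> x = y"
  using aut_permutes permutes_inj by (metis injD)

lemma aut_inv_f [simp]: "g \<in> quandle_auts Q \<Longrightarrow> pinv g (g x) = x"
  using aut_permutes permutes_inverses(2) by metis

lemma aut_f_inv [simp]: "g \<in> quandle_auts Q \<Longrightarrow> g (pinv g x) = x"
  using aut_permutes permutes_inverses(1) by metis

lemma aut_hom:
  "\<lbrakk>g \<in> quandle_auts Q; a \<in> carrier Q; b \<in> carrier Q\<rbrakk> \<Longrightarrow> g (a \<triangleright>\<^bsub>Q\<^esub> b) = g a \<triangleright>\<^bsub>Q\<^esub> g b"
  by (simp add: quandle_auts_def)

lemma aut_outside: "g \<in> quandle_auts Q \<Longrightarrow> x \<notin> carrier Q \<Longrightarrow> g x = x"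
  using aut_permutes by (metis permutes_not_in)

lemma aut_eqI:
  "\<lbrakk>g \<in> quandle_auts Q; h \<in> quandle_auts Q; \<And>x. x \<in> carrier Q \<Longrightarrow> g x = h x\<rbrakk> \<Longrightarrow> g = h"
  by (metis ext aut_outside)

lemma aut_id [simp]: "id \<in> quandle_auts Q"
  by (simp add: quandle_auts_def permutes_id)

lemma aut_comp [intro]: "\<lbrakk>g \<in> quandle_auts Q; h \<in> quandle_auts Q\<rbrakk> \<Longrightarrow> g \<circ> h \<in> quandle_auts Q"
  by (auto simp: quandle_auts_def permutes_compose permutes_in_image)

lemma aut_funpow: "g \<in> quandle_auts Q \<Longrightarrow> g ^^ n \<in> quandle_auts Q"
  by (induction n) auto

lemma finite_auts: "finite (carrier Q) \<Longrightarrow> finite (quandle_auts Q)"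
  by (rule finite_subset[OF _ finite_permutations]) (auto simp: quandle_auts_def)

lemma aut_finite_order:
  assumes "finite (carrier Q)" "g \<in> quandle_auts Q"
  obtains n where "n > 0" "g ^^ n = id"
proof -
  have "range (\<lambda>n. g ^^ n) \<subseteq> quandle_auts Q" using assms(2) by (auto intro: aut_funpow)
  then have "finite (range (\<lambda>n. g ^^ n))" using finite_auts[OF assms(1)] finite_subset by blast
  then have "\<not> inj (\<lambda>n. g ^^ n)" using finite_imageD infinite_UNIV_nat by blast
  then obtain i j where ij: "i < j" "g ^^ i = g ^^ j" by (metis injI linorder_neqE_nat)
  have "(g ^^ (j - i)) x = x" for x
  proof -
    have "(g ^^ i) ((g ^^ (j - i)) x) = (g ^^ (i + (j - i))) x" by (simp only: funpow_add comp_apply)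
    also have "\<dots> = (g ^^ i) x" using ij by simp
    finally show ?thesis using aut_inj[OF aut_funpow[OF assms(2)]] by metis
  qed
  then show ?thesis using that[of "j - i"] ij(1) by (simp add: fun_eq_iff)
qed

context quandle
begin

lemma left_perm_apply [simp]: "x \<in> carrier Q \<Longrightarrow> left_perm Q a x = a \<triangleright> x"
  by (simp add: left_perm_def)

lemma left_cancel: "\<lbrakk>a \<in> carrier Q; b \<in> carrier Q; c \<in> carrier Q; a \<triangleright> b = a \<triangleright> c\<rbrakk> \<Longrightarrow> b = c"
  using bij by (meson bij_betw_imp_inj_on inj_onD)

lemma left_perm_permutes: "a \<in> carrier Q \<Longrightarrow> left_perm Q a permutes carrier Q"
proof (rule bij_imp_permutes)
  assume "a \<in> carrier Q"
  then show "bij_betw (left_perm Q a) (carrier Q) (carrier Q)"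
    using bij by (subst bij_betw_cong[of _ _ "\<lambda>b. a \<triangleright> b"]) simp_all
qed (simp add: left_perm_def)

lemma left_perm_aut: "a \<in> carrier Q \<Longrightarrow> left_perm Q a \<in> quandle_auts Q"
  by (simp add: quandle_auts_def left_perm_permutes closed left_distrib[symmetric])

lemma aut_inv [intro]:
  assumes "g \<in> quandle_auts Q" shows "pinv g \<in> quandle_auts Q"
proof -
  have p: "pinv g permutes carrier Q" using assms by (simp add: aut_permutes permutes_inv)
  moreover have "pinv g (a \<triangleright> b) = pinv g a \<triangleright> pinv g b" if "a \<in> carrier Q" "b \<in> carrier Q" for a b
  proof -
    have i: "pinv g a \<in> carrier Q" "pinv g b \<in> carrier Q"
      using that p by (simp_all add: permutes_in_image)
    have "g (pinv g a \<triangleright> pinv g b) = a \<triangleright> b" using assms i by (simp add: aut_hom)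
    then show ?thesis using assms by (metis aut_inv_f)
  qed
  ultimately show ?thesis by (simp add: quandle_auts_def)
qed

lemma aut_left_perm:
  assumes "g \<in> quandle_auts Q" "a \<in> carrier Q"
  shows "g (left_perm Q a x) = left_perm Q (g a) (g x)"
  using assms by (cases "x \<in> carrier Q") (auto simp: aut_hom left_perm_def aut_outside)

text \<open>Orbit-stabiliser: the automorphisms sending \<open>x\<close> to a given \<open>y\<close>
  form a coset of the stabiliser of \<open>x\<close>.\<close>

lemma card_auts:
  assumes fin: "finite (carrier Q)" and x: "x \<in> carrier Q"
    and trans: "\<And>y. y \<in> carrier Q \<Longrightarrow> \<exists>g\<in>quandle_auts Q. g x = y"
  shows "card (quandle_auts Q) = card (carrier Q) * card {g \<in> quandle_auts Q. g x = x}"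
proof -
  have fA: "finite (quandle_auts Q)" using fin by (rule finite_auts)
  have "card {g \<in> quandle_auts Q. g x = y} = card {g \<in> quandle_auts Q. g x = x}"
    if y: "y \<in> carrier Q" for y
  proof -
    obtain h where h: "h \<in> quandle_auts Q" "h x = y" using trans[OF y] by blast
    have "bij_betw (\<lambda>g. h \<circ> g) {g \<in> quandle_auts Q. g x = x} {g \<in> quandle_auts Q. g x = y}"
      by (rule bij_betw_byWitness[where f' = "\<lambda>g. pinv h \<circ> g"]) (use h in \<open>auto simp: fun_eq_iff\<close>)
    then show ?thesis by (rule bij_betw_same_card[symmetric])
  qed
  moreover have "quandle_auts Q = (\<Union>y\<in>carrier Q. {g \<in> quandle_auts Q. g x = y})" using x by auto
  then have "card (quandle_auts Q) = (\<Sum>y\<in>carrier Q. card {g \<in> quandle_auts Q. g x = y})"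
    using fin fA by (subst card_UN_disjoint[symmetric]) auto
  ultimately show ?thesis by simp
qed

end

section \<open>Orbits and fixed points of maps of prime power order\<close>

lemma inj_on_prime_orbit:
  assumes l: "prime l" and x: "(g ^^ l) x = x" "g x \<noteq> x"
  shows "inj_on (\<lambda>i. (g ^^ i) x) {..<l}"
proof (rule linorder_inj_onI', goal_cases)
  case (1 i j)
  show ?case
  proof
    assume eq: "(g ^^ i) x = (g ^^ j) x"
    \<comment> \<open>\<open>g\<close> may fail to be injective, so instead of cancelling
      \<open>g ^^ i\<close> one moves on until \<open>x\<close> is reached again. Then
      \<open>j - i\<close> is a period of \<open>x\<close>, and Bezout with the period
      \<open>l\<close> makes 1 a period.\<close>
    have "(g ^^ (l - i + j)) x = (g ^^ (l - i)) ((g ^^ i) x)"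
      using eq by (simp add: funpow_add)
    also have "\<dots> = x" using 1 x by (simp flip: funpow_add[THEN fun_cong, simplified])
    finally have a: "(g ^^ (l - i + j)) x = x" .
    define c where "c = j - i"
    have c: "0 < c" "c < l" using 1 by (auto simp: c_def)
    have "l - i + j = c + l" using 1 by (auto simp: c_def)
    then have c1: "(g ^^ c) x = x" using a x by (simp add: funpow_add)
    have "coprime c l" using c l by (metis coprime_commute nat_dvd_not_less prime_imp_coprime)
    then obtain a b where ab: "c * a = l * b + 1"
      using coprime_bezout_strong[of c l] prime_gt_1_nat[OF l] by (metis nat_neq_iff)
    have "(g ^^ (c * a)) x = x" using c1 by (induction a) (auto simp: funpow_add)
    moreover have "(g ^^ (l * b)) x = x" using x by (induction b) (auto simp: funpow_add)
    ultimately have "g x = x" using ab by (simp add: funpow_swap1)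
    then show False using x by blast
  qed
qed

text \<open>All orbits have exactly \<open>l\<close> elements; the induction removes one at a
  time.\<close>

lemma prime_dvd_card_if_no_fixpoint:
  assumes "finite S" "prime l" "g ` S \<subseteq> S" "\<And>x. x \<in> S \<Longrightarrow> (g ^^ l) x = x"
    "\<And>x. x \<in> S \<Longrightarrow> g x \<noteq> x"
  shows "l dvd card S"
  using assms
proof (induction "card S" arbitrary: S rule: less_induct)
  case less
  show ?case
  proof (cases "S = {}")
    case False
    then obtain x where x: "x \<in> S" by blast
    define W where "W = (\<lambda>i. (g ^^ i) x) ` {..<l}"
    have l0: "l > 1" using less.prems(2) by (rule prime_gt_1_nat)
    have inS: "(g ^^ i) x \<in> S" for i using x less.prems(3) by (induction i) auto
    have inj: "inj_on (\<lambda>i. (g ^^ i) x) {..<l}"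
      using less.prems x by (intro inj_on_prime_orbit) auto
    have W: "W \<subseteq> S" "card W = l" using inS inj by (auto simp: W_def card_image)
    have "g ` (S - W) \<subseteq> S - W"
    proof
      fix z assume "z \<in> g ` (S - W)"
      then obtain y where y: "y \<in> S" "y \<notin> W" "z = g y" by auto
      have "z \<notin> W"
      proof
        assume "z \<in> W"
        then obtain i where i: "i < l" "g y = (g ^^ i) x" by (auto simp: W_def y)
        have "y = (g ^^ (l - 1)) (g y)"
          using less.prems(4)[OF y(1)] l0 by (metis One_nat_def Suc_diff_1 funpow_simps_right(2) comp_apply less_trans zero_less_one)
        also have "\<dots> = (g ^^ (l - 1 + i)) x" by (simp only: i funpow_add comp_apply)
        also have "\<dots> = (g ^^ ((l - 1 + i) mod l)) x"
          by (rule funpow_mod_eq[symmetric]) (use x less.prems(4) in auto)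
        finally have "y \<in> W" using l0 by (auto simp: W_def)
        then show False using y by blast
      qed
      then show "z \<in> S - W" using y less.prems(3) by auto
    qed
    moreover have c: "card (S - W) = card S - l" "card S \<ge> l"
      using W less.prems(1) card_mono by (auto simp: card_Diff_subset finite_subset) 
    ultimately have "l dvd card (S - W)"
      using less.prems l0 by (intro less.hyps) auto
    then show ?thesis using c by (metis dvd_diffD dvd_refl)
  qed simp
qed

text \<open>Two rounds of counting modulo \<open>l\<close>. Off \<open>F\<close> the map
  \<open>g ^^ l\<close> has no fixed point and its \<open>l\<close>-th power is trivial; on
  \<open>F\<close> the same would hold for \<open>g\<close> if it had no fixed point. Then
  \<open>l\<close> would divide both parts of \<open>S\<close>.\<close>

lemma fixpoint_of_prime_power_order:
  assumes "finite S" "prime l" "g ` S \<subseteq> S" "\<And>x. x \<in> S \<Longrightarrow> (g ^^ (l ^ 2)) x = x" "\<not> l dvd card S"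
  shows "\<exists>x\<in>S. g x = x"
proof -
  define F where "F = {x \<in> S. (g ^^ l) x = x}"
  have iter: "(g ^^ i) x \<in> S" if "x \<in> S" for i x using that assms(3) by (induction i) auto
  have com: "(g ^^ l) (g x) = g ((g ^^ l) x)" for x by (simp add: funpow_swap1)
  have inj: "x = y" if "x \<in> S" "y \<in> S" "(g ^^ i) x = (g ^^ i) y" "i \<le> l ^ 2" for x y i
  proof -
    have "(g ^^ (l ^ 2)) x = (g ^^ (l ^ 2 - i)) ((g ^^ i) x)" for x
      using that(4) by (simp flip: funpow_add[THEN fun_cong, simplified])
    then show ?thesis using that assms(4) by metis
  qed
  have "l dvd card (S - F)"
  proof (rule prime_dvd_card_if_no_fixpoint)
    show "(g ^^ l) ` (S - F) \<subseteq> S - F"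
    proof
      fix z assume "z \<in> (g ^^ l) ` (S - F)"
      then obtain x where x: "x \<in> S" "x \<notin> F" "z = (g ^^ l) x" by auto
      have "(g ^^ l) x \<noteq> x" using x by (auto simp: F_def)
      then have "(g ^^ l) z \<noteq> z"
        using inj[of "(g ^^ l) x" x l] x iter by (auto simp: power2_eq_square)
      then show "z \<in> S - F" using x iter by (auto simp: F_def)
    qed
    show "((g ^^ l) ^^ l) x = x" if "x \<in> S - F" for x
      using assms(4) that by (simp add: funpow_mult power2_eq_square)
  qed (use assms in \<open>auto simp: F_def\<close>)
  show ?thesis
  proof (rule ccontr)
    assume n: "\<not> ?thesis"
    have "l dvd card F"
    proof (rule prime_dvd_card_if_no_fixpoint)
      show "g ` F \<subseteq> F" using assms(3) by (auto simp: F_def com)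
    qed (use assms n in \<open>auto simp: F_def\<close>)
    moreover have "card S = card F + card (S - F)"
      using assms(1) by (metis (no_types, lifting) F_def card_Diff_subset card_mono finite_subset le_add_diff_inverse mem_Collect_eq subsetI)
    ultimately show False using \<open>l dvd card (S - F)\<close> assms(5) by simp
  qed
qed

section \<open>Latin quandles with sharply 2-transitive automorphism group\<close>

text \<open>In the sharply 2-transitive case this is the Frobenius kernel, the regular normal
  subgroup.\<close>

definition semiregular_auts :: "('a, 'm) binary_struct_scheme \<Rightarrow> ('a \<Rightarrow> 'a) set" where
  "semiregular_auts Q = {t \<in> quandle_auts Q. t = id \<or> (\<forall>x\<in>carrier Q. t x \<noteq> x)}"

locale latin_quandle = quandle +
  assumes finite_carrier: "finite (carrier Q)"
    and right_cancel:
      "\<lbrakk>a \<in> carrier Q; b \<in> carrier Q; x \<in> carrier Q; a \<triangleright> x = b \<triangleright> x\<rbrakk> \<Longrightarrow> a = b"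
begin

lemma right_division_exists:
  assumes "x \<in> carrier Q" "y \<in> carrier Q"
  obtains a where "a \<in> carrier Q" "a \<triangleright> x = y"
proof -
  have "(\<lambda>a. a \<triangleright> x) ` carrier Q = carrier Q"
  proof (intro endo_inj_surj finite_carrier)
    show "inj_on (\<lambda>a. a \<triangleright> x) (carrier Q)"
      using assms(1) by (intro inj_onI) (rule right_cancel)
  qed (use assms(1) closed in blast)
  then show ?thesis using assms(2) that by (metis imageE)
qed

definition displacement :: "'a \<Rightarrow> 'a \<Rightarrow> 'a \<Rightarrow> 'a" where
  "displacement a b = left_perm Q a \<circ> pinv (left_perm Q b)"

text \<open>A fixed point \<open>b \<triangleright> w\<close> means
  \<open>a \<triangleright> w = b \<triangleright> w\<close>, and right cancellation forces
  \<open>a = b\<close>.\<close>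

lemma displacement_semiregular:
  assumes "a \<in> carrier Q" "b \<in> carrier Q"
  shows "displacement a b \<in> semiregular_auts Q"
proof -
  have aut: "displacement a b \<in> quandle_auts Q"
    using assms by (auto simp: displacement_def intro: left_perm_aut)
  have "displacement a b = id" if x: "x \<in> carrier Q" "displacement a b x = x" for x
  proof -
    define w where "w = pinv (left_perm Q b) x"
    have w: "w \<in> carrier Q" "left_perm Q b w = x"
      using x left_perm_aut[OF assms(2)] aut_inv[OF left_perm_aut[OF assms(2)]] by (auto simp: w_def)
    then have "a \<triangleright> w = b \<triangleright> w" using x by (simp add: displacement_def w_def[symmetric])
    then have "a = b" using assms w right_cancel by blast
    then show ?thesis using left_perm_aut[OF assms(2)] by (auto simp: displacement_def fun_eq_iff)
  qed
  with aut show ?thesis by (auto simp: semiregular_auts_def)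
qed

end

locale sharply_transitive_quandle = latin_quandle +
  assumes rigid:
      "\<lbrakk>g \<in> quandle_auts Q; x \<in> carrier Q; y \<in> carrier Q; x \<noteq> y; g x = x; g y = y\<rbrakk> \<Longrightarrow> g = id"
    and two_transitive:
      "\<lbrakk>x \<in> carrier Q; x' \<in> carrier Q; y \<in> carrier Q; y' \<in> carrier Q; x \<noteq> x'; y \<noteq> y'\<rbrakk>
        \<Longrightarrow> \<exists>g\<in>quandle_auts Q. g x = y \<and> g x' = y'"
begin

text \<open>The count in a Frobenius group: distinct point stabilizers meet trivially.\<close>

lemma card_fixpoint_free:
  assumes "carrier Q \<noteq> {}"
  shows "card {g \<in> quandle_auts Q. \<forall>x\<in>carrier Q. g x \<noteq> x} + 1 = card (carrier Q)"
proof -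
  let ?A = "quandle_auts Q" and ?X = "carrier Q"
  define S where "S x = {g \<in> ?A. g x = x}" for x
  define F where "F = {g \<in> ?A. \<forall>x\<in>?X. g x \<noteq> x}"
  have fA: "finite ?A" using finite_carrier by (rule finite_auts)
  have c: "card ?A = card ?X * card (S x)" if "x \<in> ?X" for x
    unfolding S_def
  proof (rule card_auts[OF finite_carrier that])
    fix y assume "y \<in> ?X"
    then obtain a where "a \<in> ?X" "a \<triangleright> x = y" using right_division_exists \<open>x \<in> ?X\<close> by blast
    then show "\<exists>g\<in>?A. g x = y" using left_perm_aut that by (intro bexI[of _ "left_perm Q a"]) auto
  qed
  obtain x0 where x0: "x0 \<in> ?X" using assms by blast
  define s where "s = card (S x0)"
  have k0: "card ?X > 0" using x0 finite_carrier card_gt_0_iff by blast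
  have s: "card (S x) = s" if "x \<in> ?X" for x
    using c[OF that] c[OF x0] k0 by (simp add: s_def)
  have fS: "finite (S x)" for x using fA by (simp add: S_def)
  have idS: "id \<in> S x" for x by (simp add: S_def)
  then have s1: "s \<ge> 1" using fS[of x0] by (metis card_gt_0_iff empty_iff s_def One_nat_def Suc_leI)
  define U where "U = (\<Union>x\<in>?X. S x - {id})"
  have "card U = (\<Sum>x\<in>?X. card (S x - {id}))"
    unfolding U_def
  proof (rule card_UN_disjoint[OF finite_carrier])
    show "\<forall>i\<in>?X. \<forall>j\<in>?X. i \<noteq> j \<longrightarrow> (S i - {id}) \<inter> (S j - {id}) = {}"
      using rigid by (auto simp: S_def)
  qed (use fS in auto)
  also have "\<dots> = card ?X * (s - 1)" using s idS fS by (simp add: card_Diff_singleton)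
  finally have U: "card U = card ?X * (s - 1)" .
  have "?A = insert id (F \<union> U)" by (auto simp: F_def U_def S_def)
  moreover have "id \<notin> F \<union> U" "F \<inter> U = {}" using x0 by (auto simp: F_def U_def S_def)
  moreover have "finite F" "finite U" using fA by (auto simp: F_def U_def S_def finite_carrier)
  ultimately have "card ?A = Suc (card F + card U)"
    by (simp add: card_Un_disjoint)
  then have "card ?X * s = Suc (card F + card ?X * (s - 1))" using c[OF x0] U s_def by simp
  moreover have "card ?X * s = card ?X * (s - 1) + card ?X" using s1 by (simp add: algebra_simps)
  ultimately show ?thesis by (simp add: F_def)
qed

text \<open>For fixed \<open>b\<close> the displacements with \<open>a \<noteq> b\<close> are
  fixed-point-free and pairwise distinct, one fewer than there are points. By
  \<open>card_fixpoint_free\<close> this exhausts the fixed-point-free automorphisms.\<close>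

lemma semiregular_is_displacement:
  assumes t: "t \<in> semiregular_auts Q" and b: "b \<in> carrier Q"
  obtains a where "a \<in> carrier Q" "t = displacement a b"
proof -
  let ?F = "{g \<in> quandle_auts Q. \<forall>x\<in>carrier Q. g x \<noteq> x}"
  let ?d = "\<lambda>a. displacement a b"
  have dLb: "displacement a b (b \<triangleright> x) = a \<triangleright> x" if "a \<in> carrier Q" "x \<in> carrier Q" for a x
    using that b left_perm_aut[OF b]
    by (metis displacement_def comp_apply left_perm_apply aut_inv_f)
  have inj: "inj_on ?d (carrier Q)"
    by (rule inj_onI) (metis dLb b right_cancel)
  have "?d ` (carrier Q - {b}) = ?F"
  proof (rule card_seteq)
    show "finite ?F" using finite_auts[OF finite_carrier] by simp
    show "?d ` (carrier Q - {b}) \<subseteq> ?F"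
    proof
      fix g assume "g \<in> ?d ` (carrier Q - {b})"
      then obtain a where a: "a \<in> carrier Q" "a \<noteq> b" "g = ?d a" by auto
      have "?d a \<noteq> id" using dLb[OF a(1) b] a b right_cancel idem by force
      then show "g \<in> ?F" using displacement_semiregular[OF a(1) b] a by (auto simp: semiregular_auts_def)
    qed
    have "card (?d ` (carrier Q - {b})) = card (carrier Q) - 1"
      using b by (subst card_image[OF inj_on_subset[OF inj]]) (auto simp: card_Diff_singleton)
    then show "card ?F \<le> card (?d ` (carrier Q - {b}))"
      using card_fixpoint_free b by force
  qed
  moreover have "?d b = id" using left_perm_aut[OF b] by (auto simp: displacement_def fun_eq_iff)
  ultimately show ?thesis using t that b by (auto simp: semiregular_auts_def)
qed

text \<open>The base point of a displacement can be prescribed, so the factors can be written with a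
  common middle index, and \<open>displacement a b \<circ> displacement b c\<close>
  telescopes.\<close>

lemma semiregular_comp:
  assumes "s \<in> semiregular_auts Q" "t \<in> semiregular_auts Q"
  shows "s \<circ> t \<in> semiregular_auts Q"
proof (cases "carrier Q = {}")
  case True
  then show ?thesis using assms by (auto simp: semiregular_auts_def)
next
  case False
  then obtain c where c: "c \<in> carrier Q" by blast
  obtain b where b: "b \<in> carrier Q" "t = displacement b c"
    using semiregular_is_displacement[OF assms(2) c] by blast
  obtain a where a: "a \<in> carrier Q" "s = displacement a b"
    using semiregular_is_displacement[OF assms(1) b(1)] by blast
  have "s \<circ> t = displacement a c"
    using left_perm_aut[OF b(1)] by (simp add: a b displacement_def fun_eq_iff)
  then show ?thesis using displacement_semiregular a c by simp
qed

lemma semiregular_aut: "t \<in> semiregular_auts Q \<Longrightarrow> t \<in> quandle_auts Q"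
  by (simp add: semiregular_auts_def)

lemma semiregular_inv:
  assumes "t \<in> semiregular_auts Q" shows "pinv t \<in> semiregular_auts Q"
proof -
  have t: "t \<in> quandle_auts Q" using assms by (rule semiregular_aut)
  have "pinv t = id" if "x \<in> carrier Q" "pinv t x = x" for x
  proof -
    have "t x = x" using aut_f_inv[OF t, of x] that by simp
    then show ?thesis using assms that by (auto simp: semiregular_auts_def)
  qed
  then show ?thesis using aut_inv[OF t] by (auto simp: semiregular_auts_def)
qed

lemma semiregular_conj:
  assumes "t \<in> semiregular_auts Q" "g \<in> quandle_auts Q"
  shows "g \<circ> t \<circ> pinv g \<in> semiregular_auts Q"
proof -
  have t: "t \<in> quandle_auts Q" using assms(1) by (rule semiregular_aut)
  have ig: "pinv g \<in> quandle_auts Q" using assms(2) by blast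
  have "g \<circ> t \<circ> pinv g = id" if "x \<in> carrier Q" "g (t (pinv g x)) = x" for x
  proof -
    have "t (pinv g x) = pinv g x" using that aut_inv_f[OF assms(2)] by metis
    then have "t = id" using assms that ig by (auto simp: semiregular_auts_def)
    then show ?thesis using assms(2) by (simp add: fun_eq_iff)
  qed
  moreover have "g \<circ> t \<circ> pinv g \<in> quandle_auts Q" using t ig assms(2) by blast
  ultimately show ?thesis by (auto simp: semiregular_auts_def)
qed

lemma semiregular_eqI:
  assumes "s \<in> semiregular_auts Q" "t \<in> semiregular_auts Q" "x \<in> carrier Q" "s x = t x"
  shows "s = t"
proof -
  have "pinv t \<circ> s \<in> semiregular_auts Q" using assms semiregular_comp semiregular_inv by blast
  moreover have "(pinv t \<circ> s) x = x" using assms(4) semiregular_aut[OF assms(2)] by simp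
  ultimately have "pinv t \<circ> s = id" using assms(3) by (auto simp: semiregular_auts_def)
  then have "pinv t (s y) = y" for y by (simp add: fun_eq_iff)
  then show ?thesis using semiregular_aut[OF assms(2)] by (metis aut_f_inv ext)
qed

text \<open>2-transitivity supplies \<open>g\<close> fixing \<open>x\<close> with
  \<open>g (t x) = s x\<close>. The conjugate of \<open>t\<close> then agrees with \<open>s\<close>
  at \<open>x\<close>, and one value determines a semiregular automorphism.\<close>

lemma semiregular_conjugate:
  assumes s: "s \<in> semiregular_auts Q" "s \<noteq> id" and t: "t \<in> semiregular_auts Q" "t \<noteq> id"
    and x: "x \<in> carrier Q"
  obtains g where "g \<in> quandle_auts Q" "g x = x" "g \<circ> t \<circ> pinv g = s"
proof -
  have sx: "s x \<noteq> x" "t x \<noteq> x" "s x \<in> carrier Q" "t x \<in> carrier Q"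
    using s t x by (auto simp: semiregular_auts_def)
  then obtain g where g: "g \<in> quandle_auts Q" "g x = x" "g (t x) = s x"
    using two_transitive[of x "t x" x "s x"] x by metis
  have "pinv g x = x" using g aut_inv_f by metis
  then have "g \<circ> t \<circ> pinv g = s"
    using semiregular_eqI[OF semiregular_conj[OF t(1) g(1)] s(1) x] g by simp
  then show ?thesis using that g by blast
qed

text \<open>Some \<open>c\<close> fixing \<open>x\<close> satisfies \<open>c t c\<^sup>-\<^sup>1 = s t s\<^sup>-\<^sup>1\<close>. Then \<open>c\<^sup>-\<^sup>1 s\<close> commutes with \<open>t\<close>, so it moves its
  fixed points to fixed points and must be semiregular, whence \<open>c = 1\<close>.\<close>

lemma semiregular_commute:
  assumes s: "s \<in> semiregular_auts Q" and t: "t \<in> semiregular_auts Q"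
  shows "s (t x) = t (s x)"
proof (cases "t = id \<or> x \<notin> carrier Q")
  case True
  then show ?thesis using s t by (auto simp: semiregular_auts_def aut_outside)
next
  case False
  then have x: "x \<in> carrier Q" and tn: "t \<noteq> id" by auto
  have sa: "s \<in> quandle_auts Q" and ta: "t \<in> quandle_auts Q" using s t by (auto simp: semiregular_aut)
  define t' where "t' = s \<circ> t \<circ> pinv s"
  have t': "t' \<in> semiregular_auts Q" unfolding t'_def by (rule semiregular_conj[OF t sa])
  have "t' \<noteq> id"
  proof
    assume "t' = id"
    then have "t' (s y) = s y" for y by simp
    then have "t y = y" for y using sa aut_inj[OF sa] by (simp add: t'_def)
    then show False using tn by auto
  qed
  then obtain c where c: "c \<in> quandle_auts Q" "c x = x" "c \<circ> t \<circ> pinv c = t'"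
    using semiregular_conjugate[OF t' _ t tn x] by blast
  have ct: "c (t y) = t' (c y)" for y using c by (auto simp: c(3)[symmetric])
  have st: "s (t y) = t' (s y)" for y using sa by (simp add: t'_def)
  define r where "r = pinv c \<circ> s"
  have ra: "r \<in> quandle_auts Q" using c(1) sa by (auto simp: r_def)
  have cr: "c (r y) = s y" for y using c(1) by (simp add: r_def)
  have rt: "r (t y) = t (r y)" for y
    using c(1) by (metis aut_inj cr ct st)
  have "r \<in> semiregular_auts Q"
  proof (rule ccontr)
    assume "r \<notin> semiregular_auts Q"
    then obtain y where y: "y \<in> carrier Q" "r y = y" "r \<noteq> id"
      using ra by (auto simp: semiregular_auts_def)
    have "t y \<noteq> y" "t y \<in> carrier Q" using t tn y by (auto simp: semiregular_auts_def)
    moreover have "r (t y) = t y" using rt y by simp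
    ultimately show False using rigid[OF ra y(1), of "t y"] y by metis
  qed
  then have "s \<circ> pinv r \<in> semiregular_auts Q" using s semiregular_comp semiregular_inv by blast
  moreover have "s \<circ> pinv r = c" using cr ra by (metis aut_f_inv comp_apply ext)
  ultimately have "c = id" using c(2) x by (auto simp: semiregular_auts_def)
  then show ?thesis using ct st by (simp add: id_def)
qed

text \<open>All nontrivial semiregular automorphisms are conjugate, hence of one order, and a
  suitable power \<open>u\<close> of one of them has prime order \<open>l\<close>. As
  \<open>u\<close> moves every point, \<open>l\<close> divides the number of points.\<close>

lemma semiregular_exponent:
  assumes two: "x \<in> carrier Q" "y \<in> carrier Q" "x \<noteq> y"
  obtains l where "prime l" "l dvd card (carrier Q)"
    "\<And>t. t \<in> semiregular_auts Q \<Longrightarrow> t ^^ l = id"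
proof -
  have pow: "t ^^ n \<in> semiregular_auts Q" if "t \<in> semiregular_auts Q" for t n
  proof (induction n)
    case 0
    then show ?case by (simp add: semiregular_auts_def id_def[symmetric])
  next
    case (Suc n)
    then show ?case using semiregular_comp[OF that] by (simp only: funpow.simps)
  qed
  obtain a where a: "a \<in> carrier Q" "a \<triangleright> x = y" using right_division_exists two by blast
  define t where "t = displacement a x"
  have t: "t \<in> semiregular_auts Q" using displacement_semiregular a two t_def by simp
  have "t x = y"
    using left_perm_aut[OF two(1)] aut_inv_f[of "left_perm Q x" Q x] two a
    by (simp add: t_def displacement_def idem)
  then have "t \<noteq> id" using two by auto
  obtain n where n: "n > 0" "t ^^ n = id"
    using aut_finite_order finite_carrier t semiregular_aut by metis
  define m where "m = (LEAST n. n > 0 \<and> t ^^ n = id)"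
  have m: "m > 0" "t ^^ m = id" using LeastI[of "\<lambda>n. n > 0 \<and> t ^^ n = id" n] n by (auto simp: m_def)
  have least: "t ^^ i \<noteq> id" if "0 < i" "i < m" for i
    using not_less_Least[of i "\<lambda>n. n > 0 \<and> t ^^ n = id"] that by (auto simp: m_def)
  have "m \<noteq> 1" using m \<open>t \<noteq> id\<close> by auto
  then obtain l where l: "prime l" "l dvd m" using prime_factor_nat by blast
  define u where "u = t ^^ (m div l)"
  have l1: "l > 1" using l(1) by (rule prime_gt_1_nat)
  have u: "u \<in> semiregular_auts Q" "u \<noteq> id"
    using pow[OF t] least[of "m div l"] m l l1 by (auto simp: u_def dvd_imp_le)
  have ul: "u ^^ l = id" using m(2) l(2) by (simp add: u_def funpow_mult)
  have "s ^^ l = id" if s: "s \<in> semiregular_auts Q" for s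
  proof (cases "s = id")
    case False
    then obtain g where g: "g \<in> quandle_auts Q" "g \<circ> u \<circ> pinv g = s"
      using semiregular_conjugate[OF s _ u two(1)] by blast
    have "s ^^ n = g \<circ> (u ^^ n) \<circ> pinv g" for n
    proof (induction n)
      case (Suc n)
      have "s \<circ> s ^^ n = (g \<circ> u \<circ> pinv g) \<circ> (g \<circ> u ^^ n \<circ> pinv g)" by (simp only: Suc g(2))
      then show ?case using g(1) by (simp add: fun_eq_iff)
    qed (use g(1) in \<open>simp add: fun_eq_iff\<close>)
    then show ?thesis using ul g by (simp add: fun_eq_iff)
  qed (simp add: id_def[symmetric])
  moreover have "l dvd card (carrier Q)"
    by (rule prime_dvd_card_if_no_fixpoint[OF finite_carrier l(1), of u])
      (use u ul in \<open>auto simp: semiregular_auts_def\<close>)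
  ultimately show ?thesis using that l by blast
qed

end

section \<open>From a two-generated subquandle back to the whole quandle\<close>

lemma funpow_commute:
  assumes "\<And>x. f (g x) = g (f x)" shows "(f ^^ n) (g x) = g ((f ^^ n) x)"
  by (induction n) (simp_all add: assms)

text \<open>In a group, if \<open>n = [V, u]\<close> commutes with \<open>u\<close> and \<open>V\<close>, then \<open>(u V)\<^sup>l\<close> is a power of \<open>n\<close> times
  \<open>u\<^sup>l V\<^sup>l\<close>; and \<open>n\<^sup>l = 1\<close> as soon as \<open>u\<^sup>l\<close> commutes with \<open>V\<close>.\<close>

lemma twisted_product_power:
  assumes tw: "\<And>x. V (u x) = n (u (V x))"
    and nu: "\<And>x. n (u x) = u (n x)" and nV: "\<And>x. n (V x) = V (n x)"
    and cen: "\<And>x. (u ^^ l) (V x) = V ((u ^^ l) x)"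
    and inv: "\<And>x. (u ^^ l) ((V ^^ l) x) = x"
    and surj: "surj (\<lambda>x. V ((u ^^ l) x))"
  shows "((u \<circ> V) ^^ (l ^ 2)) x = x"
proof -
  have nu': "(n ^^ j) (u x) = u ((n ^^ j) x)" for j x by (rule funpow_commute) (rule nu)
  have nV': "(n ^^ j) (V x) = V ((n ^^ j) x)" for j x by (rule funpow_commute) (rule nV)
  have nuj: "(n ^^ i) ((u ^^ j) x) = (u ^^ j) ((n ^^ i) x)" for i j x
    by (rule funpow_commute, rule sym, rule funpow_commute, rule sym, rule nu)
  have Vu: "V ((u ^^ j) x) = (n ^^ j) ((u ^^ j) (V x))" for j x
    by (induction j) (simp_all add: tw nu')
  \<comment> \<open>\<open>Vu\<close> at \<open>j = l\<close>, together with \<open>cen\<close>,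
    shows that \<open>n ^^ l\<close> fixes every value of \<open>V \<circ> u ^^ l\<close>, and that
    map is onto.\<close>
  have nl: "(n ^^ l) x = x" for x
  proof -
    obtain y where y: "x = V ((u ^^ l) y)" using surj by (metis surjD)
    then show ?thesis using Vu[of l y] cen by metis
  qed
  have Vmu: "(V ^^ m) (u x) = (n ^^ m) (u ((V ^^ m) x))" for m x
    by (induction m) (simp_all add: tw nV'[symmetric] funpow_swap1)
  \<comment> \<open>The exponent is the triangular number \<open>m choose 2\<close>; its value is
    immaterial, since every power of \<open>n\<close> becomes trivial after a further
    \<open>l\<close>-th power.\<close>
  have "\<exists>f. \<forall>x. ((u \<circ> V) ^^ m) x = (n ^^ f) ((u ^^ m) ((V ^^ m) x))" for m
  proof (induction m)
    case 0
    show ?case by (rule exI[of _ 0]) simp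
  next
    case (Suc m)
    then obtain f where f: "\<And>x. ((u \<circ> V) ^^ m) x = (n ^^ f) ((u ^^ m) ((V ^^ m) x))" by blast
    have "((u \<circ> V) ^^ Suc m) x = (n ^^ (f + m)) ((u ^^ Suc m) ((V ^^ Suc m) x))" for x
    proof -
      have "((u \<circ> V) ^^ Suc m) x = ((u \<circ> V) ^^ m) (u (V x))" by (simp add: funpow_swap1)
      also have "\<dots> = (n ^^ f) ((u ^^ m) ((n ^^ m) (u ((V ^^ m) (V x)))))" by (simp add: f Vmu)
      also have "\<dots> = (n ^^ f) ((n ^^ m) ((u ^^ m) (u ((V ^^ m) (V x)))))" by (simp add: nuj)
      finally show ?thesis by (simp add: funpow_add funpow_swap1)
    qed
    then show ?case by blast
  qed
  then obtain f where f: "\<And>x. ((u \<circ> V) ^^ l) x = (n ^^ f) x" using inv by metis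
  have "((u \<circ> V) ^^ (l ^ 2)) x = (((u \<circ> V) ^^ l) ^^ l) x" by (simp add: funpow_mult power2_eq_square)
  also have "((u \<circ> V) ^^ l) = n ^^ f" using f by (rule ext)
  also have "(n ^^ f) ^^ l = (n ^^ l) ^^ f" by (simp add: funpow_mult mult.commute)
  also have "n ^^ l = id" using nl by (simp add: fun_eq_iff)
  also have "(id ^^ f) x = x" by simp
  finally show ?thesis .
qed

context latin_quandle
begin

definition subquandle_set :: "'a set \<Rightarrow> bool" where
  "subquandle_set S \<longleftrightarrow> S \<subseteq> carrier Q \<and> (\<forall>a\<in>S. \<forall>b\<in>S. a \<triangleright> b \<in> S)"

lemma subquandle_vimage:
  assumes "subquandle_set S" "g \<in> quandle_auts Q"
  shows "subquandle_set {z \<in> carrier Q. g z \<in> S}"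
  using assms by (auto simp: subquandle_set_def closed aut_hom)

text \<open>Finiteness makes closure under the operation enough: an injective left translation of
  \<open>B\<close> into itself is onto.\<close>

lemma latin_quandle_sub:
  assumes B: "subquandle_set B" shows "latin_quandle (Q\<lparr>carrier := B\<rparr>)"
proof -
  have sub: "B \<subseteq> carrier Q" and cl: "\<And>a b. \<lbrakk>a \<in> B; b \<in> B\<rbrakk> \<Longrightarrow> a \<triangleright> b \<in> B"
    using B by (auto simp: subquandle_set_def)
  have fB: "finite B" using sub finite_carrier finite_subset by blast
  show ?thesis
  proof (unfold_locales, simp_all add: cl fB)
    fix a assume a: "a \<in> B"
    have "inj_on ((\<triangleright>) a) B"
      using a sub by (intro inj_onI) (metis left_cancel subsetD)
    then show "bij_betw ((\<triangleright>) a) B B"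
      using a cl fB by (simp add: bij_betw_def endo_inj_surj image_subset_iff)
  next
    fix a b c assume "a \<in> B" "b \<in> B" "c \<in> B"
    then show "a \<triangleright> (b \<triangleright> c) = (a \<triangleright> b) \<triangleright> (a \<triangleright> c)" using sub left_distrib by blast
  next
    fix a assume "a \<in> B"
    then show "a \<triangleright> a = a" using sub idem by blast
  next
    fix a b x assume "a \<in> B" "b \<in> B" "x \<in> B" "a \<triangleright> x = b \<triangleright> x"
    then show "a = b" using sub right_cancel by blast
  qed
qed

text \<open>The missing property is rigidity. It holds on \<open>B\<close> because the fixed points
  of an automorphism form a subquandle, so the task is to show \<open>B = carrier Q\<close>. The
  prime \<open>l\<close> attached to \<open>B\<close> divides \<open>card B\<close>, and a
  fixed-point-free automorphism of \<open>Q\<close> of \<open>l\<close>-power order identifies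
  \<open>l\<close> with the prime size of \<open>Q\<close>.\<close>

lemma prime_two_transitive_rigid:
  assumes two_transitive:
      "\<And>x x' y y'. \<lbrakk>x \<in> carrier Q; x' \<in> carrier Q; y \<in> carrier Q; y' \<in> carrier Q; x \<noteq> x'; y \<noteq> y'\<rbrakk>
        \<Longrightarrow> \<exists>g\<in>quandle_auts Q. g x = y \<and> g x' = y'"
    and prime: "prime (card (carrier Q))"
  shows "sharply_transitive_quandle Q"
proof -
  let ?X = "carrier Q"
  have "card ?X \<ge> 2" using prime prime_ge_2_nat by blast
  then obtain x0 x1 where x01: "x0 \<in> ?X" "x1 \<in> ?X" "x0 \<noteq> x1"
    by (metis obtain_subset_with_card_n card_2_iff insert_subset)
  define B where "B = \<Inter>{S. subquandle_set S \<and> x0 \<in> S \<and> x1 \<in> S}"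
  have "subquandle_set ?X" by (simp add: subquandle_set_def closed)
  then have Bsub: "subquandle_set B"
    using x01 unfolding B_def subquandle_set_def by blast
  have Bmin: "B \<subseteq> S" if "subquandle_set S" "x0 \<in> S" "x1 \<in> S" for S using that B_def by blast
  have xB: "x0 \<in> B" "x1 \<in> B" by (auto simp: B_def)
  have BX: "B \<subseteq> ?X" and Bcl: "\<And>a b. \<lbrakk>a \<in> B; b \<in> B\<rbrakk> \<Longrightarrow> a \<triangleright> b \<in> B"
    using Bsub by (auto simp: subquandle_set_def)
  have fB: "finite B" using BX finite_carrier finite_subset by blast
  \<comment> \<open>An automorphism of \<open>Q\<close> taking the generators \<open>x0\<close>,
    \<open>x1\<close> to \<open>x\<close>, \<open>y\<close> maps \<open>B\<close> injectively into
    \<open>S \<inter> B\<close>; by finiteness \<open>S\<close> contains all of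
    \<open>B\<close>.\<close>
  have gen: "B \<subseteq> S" if S: "subquandle_set S" and xy: "x \<in> B" "y \<in> B" "x \<in> S" "y \<in> S" "x \<noteq> y" for S x y
  proof -
    obtain h where h: "h \<in> quandle_auts Q" "h x0 = x" "h x1 = y"
      using two_transitive[of x0 x1 x y] x01 xy BX by blast
    have S': "subquandle_set (S \<inter> B)" using S Bsub by (auto simp: subquandle_set_def)
    have "B \<subseteq> {z \<in> ?X. h z \<in> S \<inter> B}"
      by (rule Bmin[OF subquandle_vimage[OF S' h(1)]]) (use h xy x01 in auto)
    then have "h ` B \<subseteq> S \<inter> B" by auto
    moreover have "inj_on h B" using aut_inj[OF h(1)] by (auto simp: inj_on_def)
    ultimately have "card B \<le> card (S \<inter> B)" using fB by (metis card_image card_mono finite_Int)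
    then show ?thesis using fB by (metis Int_lower2 card_seteq inf.absorb_iff2)
  qed
  define BA where "BA = {g \<in> quandle_auts Q. g ` B = B}"
  have BA_I: "g \<in> BA" if g: "g \<in> quandle_auts Q" "a \<in> B" "b \<in> B" "a \<noteq> b" "g a \<in> B" "g b \<in> B" for g a b
  proof -
    have "B \<subseteq> {z \<in> ?X. g z \<in> B}"
      by (rule gen[OF subquandle_vimage[OF Bsub g(1)], of a b]) (use g BX in auto)
    then have "g ` B \<subseteq> B" by auto
    moreover have "inj_on g B" using aut_inj[OF g(1)] by (auto simp: inj_on_def)
    ultimately show ?thesis using fB g(1) by (simp add: BA_def endo_inj_surj)
  qed
  have BA_comp: "g \<circ> h \<in> BA" if "g \<in> BA" "h \<in> BA" for g h
    using that image_comp[of g h B] by (auto simp: BA_def simp del: image_comp)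
  have BA_inv: "pinv g \<in> BA" if "g \<in> BA" for g
  proof -
    have g: "g \<in> quandle_auts Q" "g ` B = B" using that by (auto simp: BA_def)
    have "pinv g ` (g ` B) = B" by (simp add: image_image aut_inv_f[OF g(1)])
    then show ?thesis using g aut_inv[OF g(1)] by (simp add: BA_def)
  qed
  have BA_L: "left_perm Q a \<in> BA" if "a \<in> B" for a
    by (rule BA_I[of _ x0 x1]) (use that xB x01 BX Bcl left_perm_aut in auto)
  define res where "res g z = (if z \<in> B then g z else z)" for g :: "'a \<Rightarrow> 'a" and z
  let ?QB = "Q\<lparr>carrier := B\<rparr>"
  have res_aut: "res g \<in> quandle_auts ?QB" if "g \<in> BA" for g
  proof -
    have g: "g \<in> quandle_auts Q" "g ` B = B" using that by (auto simp: BA_def)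
    have "bij_betw (res g) B B"
      using g aut_inj[OF g(1)] by (subst bij_betw_cong[of _ _ g]) (auto simp: res_def bij_betw_def inj_on_def)
    then have "res g permutes B" by (rule bij_imp_permutes) (simp add: res_def)
    then show ?thesis using g BX by (auto simp: quandle_auts_def res_def Bcl aut_hom[OF g(1)] subset_iff)
  qed
  interpret B: latin_quandle ?QB by (rule latin_quandle_sub[OF Bsub])
  interpret B: sharply_transitive_quandle ?QB
  proof
    fix g x y assume g: "g \<in> quandle_auts ?QB" and xy: "x \<in> carrier ?QB" "y \<in> carrier ?QB" "x \<noteq> y" "g x = x" "g y = y"
    have "subquandle_set {z \<in> B. g z = z}"
      using BX Bcl aut_hom[OF g] by (auto simp: subquandle_set_def)
    then have "B \<subseteq> {z \<in> B. g z = z}" by (rule gen[of _ x y]) (use xy in auto)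
    then show "g = id" by (intro aut_eqI[OF g aut_id]) auto
  next
    fix x x' y y' assume *: "x \<in> carrier ?QB" "x' \<in> carrier ?QB" "y \<in> carrier ?QB" "y' \<in> carrier ?QB" "x \<noteq> x'" "y \<noteq> y'"
    then obtain g where g: "g \<in> quandle_auts Q" "g x = y" "g x' = y'"
      using two_transitive[of x x' y y'] BX by auto
    have "g \<in> BA" by (rule BA_I[of _ x x']) (use g * in auto)
    then show "\<exists>g\<in>quandle_auts ?QB. g x = y \<and> g x' = y'"
      using res_aut g * by (intro bexI[of _ "res g"]) (auto simp: res_def)
  qed
  obtain l where l: "prime l" "l dvd card B" "\<And>t. t \<in> semiregular_auts ?QB \<Longrightarrow> t ^^ l = id"
    using B.semiregular_exponent[of x0 x1] xB x01 by auto
  have res_semi: "res t \<in> semiregular_auts ?QB" if "t \<in> BA" "t \<in> semiregular_auts Q" for t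
    using res_aut[OF that(1)] that(2) BX by (auto simp: semiregular_auts_def res_def fun_eq_iff)
  let ?L = "left_perm Q"
  have disp_BA: "displacement a b \<in> BA" if "a \<in> B" "b \<in> B" for a b
    using that BA_L BA_comp BA_inv by (simp add: displacement_def)
  have disp_semi: "res (displacement a b) \<in> semiregular_auts ?QB" if "a \<in> B" "b \<in> B" for a b
    by (intro res_semi disp_BA displacement_semiregular subsetD[OF BX] that)
  \<comment> \<open>\<open>n\<close> fixes \<open>a\<close>, so conjugation by \<open>n\<close>
    leaves \<open>?L a\<close> unchanged.\<close>
  have fix_comm: "n (?L a z) = ?L a (n z)" "n (pinv (?L a) z) = pinv (?L a) (n z)"
    if "n \<in> quandle_auts Q" "\<And>z. z \<in> B \<Longrightarrow> n z = z" "a \<in> B" for n a z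
  proof -
    have La: "?L a \<in> quandle_auts Q" using that BX left_perm_aut by blast
    show 1: "n (?L a z) = ?L a (n z)" for z using aut_left_perm[OF that(1)] that BX by (metis subsetD)
    show "n (pinv (?L a) z) = pinv (?L a) (n z)"
      using 1[of "pinv (?L a) z"] La by (metis aut_f_inv aut_inv_f)
  qed
  \<comment> \<open>Chosen so that \<open>u\<close> sends \<open>x0\<close> to \<open>x1\<close>. As
    \<open>v\<close> is the conjugate of \<open>u\<close> by \<open>?L x0\<close>, the product
    \<open>u \<circ> V\<close> is the commutator of \<open>u\<close> and \<open>?L x0\<close>, which
    equals \<open>displacement x1 x0\<close>. At the same time \<open>u\<close> and \<open>v\<close>
    are displacements of elements of \<open>B\<close> and commute on \<open>B\<close>.\<close>
  obtain b where b: "b \<in> B" "b \<triangleright> x0 = x1"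
    using B.right_division_exists[of x0 x1] xB by auto
  define u where "u = displacement b x0"
  define v where "v = displacement (x0 \<triangleright> b) x0"
  define V where "V = pinv v"
  have x0b: "x0 \<triangleright> b \<in> B" using Bcl xB b by blast
  have L0: "?L x0 \<in> quandle_auts Q" using left_perm_aut x01 by blast
  have uBA: "u \<in> BA" and vBA: "v \<in> BA" using disp_BA b xB x0b by (auto simp: u_def v_def)
  then have VBA: "V \<in> BA" using BA_inv V_def by blast
  have uA: "u \<in> quandle_auts Q" and vA: "v \<in> quandle_auts Q" and VA: "V \<in> quandle_auts Q"
    using uBA vBA VBA by (auto simp: BA_def)
  have v_conj: "v z = ?L x0 (u (pinv (?L x0) z))" for z
  proof -
    have "?L x0 (?L b w) = ?L (x0 \<triangleright> b) (?L x0 w)" for w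
      using aut_left_perm[OF L0, of b w] b BX by auto
    then show ?thesis using L0 by (simp add: u_def v_def displacement_def)
  qed
  have B_fix_pow: "(u ^^ l) z = z" if "z \<in> B" for z
  proof -
    have "res u ^^ l = id" using l(3) disp_semi b xB u_def by blast
    moreover have "(res u ^^ i) z = (u ^^ i) z \<and> (u ^^ i) z \<in> B" for i
      using that uBA by (induction i) (auto simp: res_def BA_def)
    ultimately show ?thesis by (metis id_apply)
  qed
  have pow_comm: "(u ^^ l) (?L a z) = ?L a ((u ^^ l) z)"
    "(u ^^ l) (pinv (?L a) z) = pinv (?L a) ((u ^^ l) z)" if "a \<in> B" for a z
    using fix_comm[OF aut_funpow[OF uA]] B_fix_pow that by auto
  have uv: "u (v z) = v (u z)" if "z \<in> B" for z
  proof -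
    have "res u (res v z) = res v (res u z)"
      by (rule B.semiregular_commute) (use disp_semi b xB x0b in \<open>auto simp: u_def v_def\<close>)
    then show ?thesis using that uBA vBA by (auto simp: res_def BA_def split: if_splits)
  qed
  \<comment> \<open>The commutator of \<open>V\<close> and \<open>u\<close>. It is trivial on
    \<open>B\<close>, where \<open>u\<close> and \<open>v\<close> commute, and therefore commutes
    with everything built from translations by elements of \<open>B\<close>, in particular with
    \<open>u\<close> and \<open>V\<close>.\<close>
  define n where "n = V \<circ> u \<circ> v \<circ> pinv u"
  have nA: "n \<in> quandle_auts Q" unfolding n_def using uA vA VA aut_inv by blast
  have n_fix: "n z = z" if "z \<in> B" for z
  proof -
    have iz: "pinv u z \<in> B" using BA_inv[OF uBA] that by (auto simp: BA_def)
    show ?thesis using uv[OF iz] uA vA by (simp add: n_def V_def)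
  qed
  have n_comm: "n (displacement a a' z) = displacement a a' (n z)" if "a \<in> B" "a' \<in> B" for a a' z
    using fix_comm[OF nA n_fix] that by (simp add: displacement_def)
  have pow_comm': "(u ^^ l) (displacement a a' z) = displacement a a' ((u ^^ l) z)"
    if "a \<in> B" "a' \<in> B" for a a' z
    using pow_comm that by (simp add: displacement_def)
  have invc: "f (V z) = V (f z)" if "\<And>z. f (v z) = v (f z)" for f z
    using that[of "V z"] vA by (metis V_def aut_f_inv aut_inv_f)
  have v_pow: "(v ^^ i) z = ?L x0 ((u ^^ i) (pinv (?L x0) z))" for i z
    by (induction i arbitrary: z) (use L0 in \<open>simp_all add: v_conj\<close>)
  \<comment> \<open>\<open>u ^^ l\<close> is trivial on \<open>B\<close>, so it commutes with
    \<open>?L x0\<close> and equals its conjugate \<open>v ^^ l\<close>. Hence \<open>V ^^ l\<close>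
    inverts \<open>u ^^ l\<close>.\<close>
  then have vl: "(v ^^ l) z = (u ^^ l) z" for z
    using pow_comm[of x0 "pinv (?L x0) z"] xB L0 by simp
  have Vi: "(v ^^ i) ((V ^^ i) z) = z" for i z
  proof (induction i arbitrary: z)
    case (Suc i)
    have "(v ^^ Suc i) ((V ^^ Suc i) z) = (v ^^ i) (v (V ((V ^^ i) z)))" by (simp add: funpow_swap1)
    then show ?case using Suc vA by (simp add: V_def)
  qed simp
  have "((u \<circ> V) ^^ (l ^ 2)) z = z" for z
  proof (rule twisted_product_power[where n = n])
    show "V (u y) = n (u (V y))" for y
    proof -
      have "n (u (V y)) = V (u (v (pinv u (u (V y)))))" by (simp add: n_def)
      also have "\<dots> = V (u (v (V y)))" using uA by simp
      finally show ?thesis using vA by (simp add: V_def)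
    qed
    show "n (u y) = u (n y)" for y using n_comm b xB by (simp add: u_def)
    show "n (V y) = V (n y)" for y by (rule invc) (use n_comm x0b xB in \<open>simp add: v_def\<close>)
    show "(u ^^ l) (V y) = V ((u ^^ l) y)" for y
      by (rule invc) (use pow_comm' x0b xB in \<open>simp add: v_def\<close>)
    show "(u ^^ l) ((V ^^ l) y) = y" for y using Vi vl by metis
    have "V \<circ> u ^^ l \<in> quandle_auts Q" using VA aut_funpow[OF uA] by blast
    then show "surj (\<lambda>y. V ((u ^^ l) y))"
      using aut_permutes permutes_surj by (metis comp_apply ext)
  qed
  moreover have y1: "u \<circ> V = displacement x1 x0"
  proof
    fix z
    have "pinv (?L x0) x0 = x0" using L0 x01 by (metis aut_inv_f idem left_perm_apply)
    then have ux0: "u x0 = x1" using b x01 by (simp add: u_def displacement_def)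
    have "V z = ?L x0 (pinv u (pinv (?L x0) z))"
    proof -
      have "v (?L x0 (pinv u (pinv (?L x0) z))) = z" using L0 uA by (simp add: v_conj)
      then show ?thesis using vA by (metis V_def aut_inv_f)
    qed
    then have "(u \<circ> V) z = u (?L x0 (pinv u (pinv (?L x0) z)))" by simp
    also have "\<dots> = ?L x1 (pinv (?L x0) z)" using aut_left_perm[OF uA x01(1)] uA ux0 by simp
    finally show "(u \<circ> V) z = displacement x1 x0 z" by (simp add: displacement_def)
  qed
  ultimately have pow: "(displacement x1 x0 ^^ (l ^ 2)) z = z" for z by simp
  have d: "displacement x1 x0 \<in> semiregular_auts Q" using displacement_semiregular x01 by blast
  have "displacement x1 x0 x0 \<noteq> x0"
  proof -
    have "pinv (?L x0) x0 = x0" using L0 x01 by (metis aut_inv_f idem left_perm_apply)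
    then have "displacement x1 x0 x0 = x1 \<triangleright> x0" using x01 by (simp add: displacement_def)
    then show ?thesis using x01 idem right_cancel by metis
  qed
  then have nofix: "displacement x1 x0 z \<noteq> z" if "z \<in> ?X" for z
    using d that by (auto simp: semiregular_auts_def)
  have "l dvd card ?X"
  proof (rule ccontr)
    assume "\<not> l dvd card ?X"
    then have "\<exists>z\<in>?X. displacement x1 x0 z = z"
      using d by (intro fixpoint_of_prime_power_order[OF finite_carrier l(1)])
        (auto simp: pow semiregular_auts_def)
    then show False using nofix by blast
  qed
  then have "l = card ?X" using prime l(1) primes_dvd_imp_eq by blast
  then have "card ?X \<le> card B" using l(2) xB fB by (metis card_gt_0_iff dvd_imp_le empty_iff)
  then have "B = ?X" using BX finite_carrier by (metis card_seteq)
  then have "Q\<lparr>carrier := B\<rparr> = Q" by simp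
  then show ?thesis using B.sharply_transitive_quandle_axioms by simp
qed

end

section \<open>Connected quandles of prime size\<close>

text \<open>\<open>left_mult_group\<close> also contains inverses of translations. Finiteness takes
  care of them: a translation mapping \<open>S\<close> into itself permutes \<open>S\<close>, and so
  does its inverse.\<close>

lemma (in connected_quandle) invariant_set_full:
  assumes fin: "finite (carrier Q)" and S: "S \<subseteq> carrier Q" "S \<noteq> {}"
    and inv: "\<And>a s. \<lbrakk>a \<in> carrier Q; s \<in> S\<rbrakk> \<Longrightarrow> a \<triangleright> s \<in> S"
  shows "S = carrier Q"
proof -
  let ?X = "carrier Q" and ?G = "BijGroup (carrier Q)"
  have fS: "finite S" using S(1) fin finite_subset by blast
  have tr: "left_translation Q a \<in> Bij ?X" if "a \<in> ?X" for a
    using that bij by (simp add: Bij_def left_translation_def)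
  have trS: "left_translation Q a ` S = S" if "a \<in> ?X" for a
  proof (rule endo_inj_surj[OF fS])
    show "left_translation Q a ` S \<subseteq> S" using that S inv by (auto simp: left_translation_def)
    show "inj_on (left_translation Q a) S"
      using tr[OF that] S(1) by (auto simp: Bij_def bij_betw_def intro: inj_on_subset)
  qed
  have "h \<in> Bij ?X \<and> h ` S = S" if "h \<in> generate ?G (left_translation Q ` ?X)" for h
    using that
  proof induction
    case one
    have "(\<lambda>x\<in>?X. x) ` S = S" using S(1) by (force simp: image_iff)
    moreover have "\<one>\<^bsub>?G\<^esub> = (\<lambda>x\<in>?X. x)" by (simp add: BijGroup_def)
    ultimately show ?case using id_Bij[of ?X] by metis
  next
    case (incl h)
    then show ?case using tr trS by blast
  next
    case (inv h)
    then have h: "h \<in> Bij ?X" "h ` S = S" using tr trS by blast+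
    have "inj_on h ?X" using h by (simp add: Bij_def bij_betw_def)
    then have "(\<lambda>x\<in>?X. inv_into ?X h x) (h s) = s" if "s \<in> S" for s
    proof -
      have "h s \<in> ?X" "s \<in> ?X" using that S(1) h(2) by blast+
      then show ?thesis using \<open>inj_on h ?X\<close> by (simp add: inv_into_f_f)
    qed
    then have "(\<lambda>s. (\<lambda>x\<in>?X. inv_into ?X h x) (h s)) ` S = S" by (simp only: image_cong image_ident)
    then have "(\<lambda>x\<in>?X. inv_into ?X h x) ` (h ` S) = S" by (simp only: image_image)
    moreover have "inv\<^bsub>?G\<^esub> h = (\<lambda>x\<in>?X. inv_into ?X h x)" by (rule inv_BijGroup[OF h(1)])
    ultimately show ?case using restrict_inv_into_Bij[OF h(1)] unfolding h(2) by metis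
  next
    case (eng h1 h2)
    have "compose ?X h1 h2 ` S = (\<lambda>x. h1 (h2 x)) ` S"
      by (rule image_cong) (use S(1) in \<open>auto simp: compose_def\<close>)
    also have "\<dots> = S" using eng by (metis image_image)
    finally have "compose ?X h1 h2 ` S = S" .
    then show ?case using eng by (simp add: BijGroup_def compose_Bij)
  qed
  then have img: "h ` S = S" if "h \<in> left_mult_group Q" for h
    using that by (simp add: left_mult_group_def)
  obtain s where s: "s \<in> S" using S by blast
  show ?thesis
  proof
    show "?X \<subseteq> S"
    proof
      fix y assume "y \<in> ?X"
      then obtain h where "h \<in> left_mult_group Q" "h s = y" using transitive s S by blast
      then show "y \<in> S" using img s by blast
    qed
  qed (rule S(1))
qed

text \<open>Connectedness in the form in which it is applied: it avoids generated groups, passes to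
  quotients by taking preimages, and works as an induction principle over the carrier.\<close>

locale finite_connected_quandle = quandle +
  assumes finite_carrier: "finite (carrier Q)"
    and invariant_full: "\<lbrakk>S \<subseteq> carrier Q; S \<noteq> {}; \<And>a s. \<lbrakk>a \<in> carrier Q; s \<in> S\<rbrakk> \<Longrightarrow> a \<triangleright> s \<in> S\<rbrakk>
      \<Longrightarrow> S = carrier Q"
begin

lemma auts_transitive:
  assumes "x \<in> carrier Q" "y \<in> carrier Q"
  obtains g where "g \<in> quandle_auts Q" "g x = y"
proof -
  have "(\<lambda>g. g x) ` quandle_auts Q = carrier Q"
  proof (rule invariant_full)
    fix a s assume a: "a \<in> carrier Q" and "s \<in> (\<lambda>g. g x) ` quandle_auts Q"
    then obtain g where g: "g \<in> quandle_auts Q" "s = g x" by blast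
    then have "left_perm Q a \<circ> g \<in> quandle_auts Q" "(left_perm Q a \<circ> g) x = a \<triangleright> s"
      using a left_perm_aut assms by auto
    then show "a \<triangleright> s \<in> (\<lambda>g. g x) ` quandle_auts Q" by (metis imageI)
  next
    show "(\<lambda>g. g x) ` quandle_auts Q \<noteq> {}" using aut_id by blast
  qed (use assms in auto)
  then have "y \<in> (\<lambda>g. g x) ` quandle_auts Q" using assms(2) by simp
  then show ?thesis by (elim imageE) (rule that, auto)
qed

lemma nontrivial_action:
  assumes "card (carrier Q) \<ge> 2" "y \<in> carrier Q"
  obtains a where "a \<in> carrier Q" "a \<triangleright> y \<noteq> y"
proof (rule ccontr)
  assume "\<not> thesis"
  then have "\<And>a. a \<in> carrier Q \<Longrightarrow> a \<triangleright> y = y" using that by blast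
  then have "{y} = carrier Q" using assms(2) by (intro invariant_full) simp_all
  then show False using assms(1) card_1_singleton_iff[of "carrier Q"] by auto
qed

text \<open>Cauchy's theorem by way of Sylow: p divides the order of the automorphism group by
  orbit-stabiliser, and any nontrivial element of a subgroup of order p will do.\<close>

lemma exists_prime_order_aut:
  assumes p: "prime p" "card (carrier Q) = p"
  obtains c where "c \<in> quandle_auts Q" "c ^^ p = id" "c \<noteq> id"
proof -
  define G :: "('a \<Rightarrow> 'a) monoid" where "G = \<lparr>carrier = quandle_auts Q, monoid.mult = (\<circ>), one = id\<rparr>"
  interpret G: group G
  proof (rule groupI)
    fix g assume "g \<in> carrier G"
    then have "pinv g \<in> quandle_auts Q" "pinv g \<circ> g = id"
      using aut_inv by (auto simp: G_def fun_eq_iff)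
    then show "\<exists>y\<in>carrier G. y \<otimes>\<^bsub>G\<^esub> g = \<one>\<^bsub>G\<^esub>" by (auto simp: G_def)
  qed (auto simp: G_def comp_assoc)
  have pow: "g [^]\<^bsub>G\<^esub> n = g ^^ n" for g and n :: nat
    by (induction n) (simp_all add: G_def funpow_Suc_right del: funpow.simps(2))
  obtain x where x: "x \<in> carrier Q" using p prime_gt_0_nat by (metis card.empty ex_in_conv less_irrefl)
  have "\<exists>g\<in>quandle_auts Q. g x = y" if "y \<in> carrier Q" for y
    using auts_transitive[OF x that] by blast
  then have "Coset.order G = p ^ 1 * card {g \<in> quandle_auts Q. g x = x}"
    unfolding Coset.order_def
    using card_auts[OF finite_carrier x] p(2) by (simp add: G_def)
  moreover have fG: "finite (carrier G)" by (simp add: G_def finite_auts finite_carrier)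
  ultimately obtain H where H: "subgroup H G" "card H = p ^ 1"
    using sylow_thm[OF p(1) G.is_group _ fG] by blast
  then obtain c where c: "c \<in> H" "c \<noteq> \<one>\<^bsub>G\<^esub>"
    using p(1) prime_gt_1_nat[OF p(1)]
    by (metis card_le_Suc0_iff_eq card.infinite One_nat_def not_le power_one_right less_irrefl not_one_less_zero)
  interpret H: group "G\<lparr>carrier := H\<rparr>" using H(1) by (rule G.subgroup_imp_group)
  have "c [^]\<^bsub>G\<lparr>carrier := H\<rparr>\<^esub> Coset.order (G\<lparr>carrier := H\<rparr>) = \<one>\<^bsub>G\<^esub>"
    using H.pow_order_eq_1[of c] c by simp
  then have "c ^^ p = id"
    using H(2) by (simp add: Coset.order_def pow G.nat_pow_consistent[symmetric]) (simp add: G_def)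
  then show ?thesis using that c H(1) subgroup.subset[OF H(1)] by (auto simp: G_def)
qed

theorem affine_of_prime_card:
  assumes p: "prime p" and card: "card (carrier Q) = p"
  obtains h :: "'a \<Rightarrow> int" and c where "bij_betw h (carrier Q) {0..<int p}"
    "\<And>a b. \<lbrakk>a \<in> carrier Q; b \<in> carrier Q\<rbrakk> \<Longrightarrow> h (a \<triangleright> b) = (h a + c * (h b - h a)) mod int p"
    "2 \<le> c" "c < int p"
proof -
  note affineI = that
  let ?X = "carrier Q"
  have p2: "p \<ge> 2" using p by (rule prime_ge_2_nat)
  have ip: "prime (int p)" using p by simp
  obtain c where c: "c \<in> quandle_auts Q" "c ^^ p = id" "c \<noteq> id"
    using exists_prime_order_aut[OF p card] by blast
  obtain x0 where cx0: "c x0 \<noteq> x0" using c(3) by (metis ext id_apply)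
  then have x0: "x0 \<in> ?X" using c(1) aut_outside by metis
  \<comment> \<open>Powers of the p-cycle with integer exponents, read modulo p. Through them
    \<open>e\<close> labels the points by residues, with \<open>x0\<close> as 0.\<close>
  define t where "t i = c ^^ nat (i mod int p)" for i :: int
  define e where "e i = t i x0" for i
  have tA: "t i \<in> quandle_auts Q" for i unfolding t_def by (rule aut_funpow[OF c(1)])
  have tt: "t i (t j x) = t (i + j) x" for i j x
  proof -
    have "(c ^^ (m mod p)) y = (c ^^ m) y" for m y
      by (rule funpow_mod_eq) (simp add: c(2))
    then have "(c ^^ nat (i mod int p)) ((c ^^ nat (j mod int p)) x)
        = (c ^^ ((nat (i mod int p) + nat (j mod int p)) mod p)) x"
      by (simp add: funpow_add)
    also have "(nat (i mod int p) + nat (j mod int p)) mod p = nat ((i + j) mod int p)"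
      using p2 by (simp add: nat_mod_distrib[symmetric] nat_add_distrib[symmetric] nat_mod_as_int mod_simps)
    finally show ?thesis by (simp add: t_def)
  qed
  have te: "t i (e j) = e (i + j)" for i j by (simp add: e_def tt)
  have e0: "e 0 = x0" by (simp add: e_def t_def)
  have eX: "e i \<in> ?X" for i using x0 tA by (simp add: e_def)
  have e_cong: "e i = e j \<longleftrightarrow> [i = j] (mod int p)" for i j
  proof -
    have "inj_on (\<lambda>i. (c ^^ i) x0) {..<p}"
      using p cx0 c(2) by (intro inj_on_prime_orbit) auto
    then have "e i = e j \<longleftrightarrow> nat (i mod int p) = nat (j mod int p)"
      using p2 by (auto simp: e_def t_def nat_less_iff dest: inj_onD)
    then show ?thesis using p2 by (simp add: cong_def eq_nat_nat_iff)
  qed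
  have bij_e: "bij_betw e {0..<int p} ?X"
  proof -
    have "inj_on e {0..<int p}" by (rule inj_onI) (simp add: e_cong cong_def)
    moreover from this have "card (e ` {0..<int p}) = card ?X" by (simp add: card_image card)
    moreover have "e ` {0..<int p} \<subseteq> ?X" using eX by blast
    ultimately show ?thesis
      using card_subset_eq[OF finite_carrier] by (simp add: bij_betw_def)
  qed
  define d where "d x = the_inv_into {0..<int p} e x" for x
  have ed: "e (d x) = x" if "x \<in> ?X" for x
    using f_the_inv_into_f_bij_betw[OF bij_e] that by (simp add: d_def)
  have d_bij: "bij_betw d ?X {0..<int p}"
    unfolding d_def using bij_betw_the_inv_into[OF bij_e] .
  have de: "d (e i) = i mod int p" for i
  proof -
    have "e (d (e i)) = e i" using ed eX by blast
    moreover have "d (e i) \<in> {0..<int p}" using d_bij eX by (auto simp: bij_betw_def)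
    ultimately show ?thesis by (simp add: e_cong cong_def)
  qed
  define L where "L = left_perm Q x0"
  have LA: "L \<in> quandle_auts Q" unfolding L_def using left_perm_aut x0 .
  \<comment> \<open>Left translation by \<open>x0\<close> in these coordinates. It determines the
    whole operation, because each \<open>t i\<close> is an automorphism.\<close>
  define \<phi> where "\<phi> u = d (L (e u))" for u
  have e\<phi>: "e (\<phi> u) = L (e u)" for u
    unfolding \<phi>_def using ed eX LA by simp
  have op_e: "e a \<triangleright> e b = e (a + \<phi> (b - a))" for a b
  proof -
    have "e a \<triangleright> e b = t a (e 0) \<triangleright> t a (e (b - a))" by (simp add: te)
    also have "\<dots> = t a (x0 \<triangleright> e (b - a))" using aut_hom[OF tA] eX x0 e0 by simp
    also have "x0 \<triangleright> e (b - a) = e (\<phi> (b - a))" using e\<phi> eX by (simp add: L_def)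
    finally show ?thesis by (simp add: te)
  qed
  have \<phi>0: "[\<phi> 0 = 0] (mod int p)"
    using e_cong[of "\<phi> 0" 0] x0 idem by (simp add: e\<phi> e0 L_def)
  have \<phi>_cong: "[\<phi> u = \<phi> v] (mod int p) \<longleftrightarrow> [u = v] (mod int p)" for u v
    using e_cong[of "\<phi> u" "\<phi> v"] e_cong[of u v] aut_inj[OF LA] by (simp add: e\<phi>)
  \<comment> \<open>Both cases end here, with a linear \<open>\<phi>\<close>. The multiplier is
    nonzero because translations are injective, and not 1 because otherwise
    \<open>a \<triangleright> x0 = x0\<close> for all \<open>a\<close>, against
    connectedness.\<close>
  have finish: thesis if lam: "\<And>u. [\<phi> u = lam * u] (mod int p)" for lam
  proof (rule affineI[OF d_bij])
    show "d (a \<triangleright> b) = (d a + (lam mod int p) * (d b - d a)) mod int p" if "a \<in> ?X" "b \<in> ?X" for a b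
    proof -
      have "a \<triangleright> b = e (d a + \<phi> (d b - d a))" using op_e[of "d a" "d b"] ed that by simp
      also have "\<dots> = e (d a + lam * (d b - d a))"
        by (simp add: e_cong cong_add_lcancel lam)
      finally show ?thesis by (simp add: de) (metis mod_add_right_eq mod_mult_left_eq)
    qed
    have "lam mod int p \<noteq> 0"
    proof
      assume "lam mod int p = 0"
      then have "[lam * 1 = lam * 0] (mod int p)" by (simp add: cong_def)
      then have "[\<phi> 1 = \<phi> 0] (mod int p)" using lam by (meson cong_sym cong_trans)
      then have "[1 = 0] (mod int p)" by (simp only: \<phi>_cong)
      then show False using p2 by (simp add: cong_def)
    qed
    moreover have "lam mod int p \<noteq> 1"
    proof
      assume "lam mod int p = 1"
      then have l1: "[lam * u = u] (mod int p)" for u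
        by (metis cong_def mod_mult_left_eq mult_1)
      obtain a where a: "a \<in> ?X" "a \<triangleright> x0 \<noteq> x0" using nontrivial_action[OF _ x0] p2 card by auto
      have "a \<triangleright> x0 = e (d a + \<phi> (0 - d a))" using op_e[of "d a" 0] ed a e0 by simp
      also have "[d a + \<phi> (0 - d a) = d a + (0 - d a)] (mod int p)"
        using lam l1 by (intro cong_add cong_refl) (meson cong_trans)
      then have "e (d a + \<phi> (0 - d a)) = e (d a + (0 - d a))" by (simp add: e_cong)
      finally show False using a e0 by simp
    qed
    moreover have "0 \<le> lam mod int p" "lam mod int p < int p" using p2 by auto
    ultimately show "2 \<le> lam mod int p" "lam mod int p < int p" by linarith+
  qed
  \<comment> \<open>The orbit of \<open>e 1\<close> under the stabiliser of \<open>x0\<close>; it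
    contains all nonzero residues exactly when the automorphism group is 2-transitive.\<close>
  define U where "U = {u \<in> {1..<int p}. \<exists>g\<in>quandle_auts Q. g x0 = x0 \<and> g (e 1) = e u}"
  show thesis
  proof (cases "U = {1..<int p}")
    case False
    have Us: "U \<subseteq> {1..<int p}" by (auto simp: U_def)
    have U1: "1 \<in> U" unfolding U_def using p2 by (auto intro!: bexI[of _ id])
    have inv: "(\<phi> (y + u) - \<phi> y) mod int p \<in> U" if u: "u \<in> U" for y u
    proof -
      obtain g where g: "g \<in> quandle_auts Q" "g x0 = x0" "g (e 1) = e u"
        using u by (auto simp: U_def)
      \<comment> \<open>After \<open>g\<close>, the point \<open>x0\<close> travels to
        \<open>e y\<close>, then to \<open>e (\<phi> y)\<close> and back to \<open>x0\<close>, while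
        \<open>e u\<close> travels to \<open>e (\<phi> (y + u) - \<phi> y)\<close>.\<close>
      define g' where "g' = t (- \<phi> y) \<circ> L \<circ> t y \<circ> g"
      have "g' \<in> quandle_auts Q" unfolding g'_def using tA LA g(1) by blast
      moreover have g'0: "g' x0 = x0"
        using g(2) by (simp add: g'_def e0[symmetric] te e\<phi>[symmetric])
      moreover have "g' (e 1) = e (\<phi> (y + u) - \<phi> y)"
        using g(3) by (simp add: g'_def te e\<phi>[symmetric])
      moreover have "e (\<phi> (y + u) - \<phi> y) = e ((\<phi> (y + u) - \<phi> y) mod int p)"
        by (simp add: e_cong)
      moreover have "(\<phi> (y + u) - \<phi> y) mod int p \<noteq> 0"
      proof
        assume "(\<phi> (y + u) - \<phi> y) mod int p = 0"
        then have "[\<phi> (y + u) = \<phi> y] (mod int p)" by (simp add: cong_iff_dvd_diff mod_eq_0_iff_dvd)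
        then have "[y + u = y + 0] (mod int p)" by (simp add: \<phi>_cong)
        then have "[u = 0] (mod int p)" using cong_add_lcancel by blast
        then show False using u by (auto simp: U_def cong_def)
      qed
      moreover have "(\<phi> (y + u) - \<phi> y) mod int p \<ge> 0" "(\<phi> (y + u) - \<phi> y) mod int p < int p"
        using p2 by auto
      ultimately show ?thesis by (auto simp: U_def)
    qed
    obtain lam where lam: "\<And>x. [\<phi> x = \<phi> 0 + lam * x] (mod int p)"
      by (rule affine_of_difference_invariant[OF ip _ _ Us _ False, of \<phi>])
        (use U1 inv in \<open>auto simp: \<phi>_cong\<close>)
    have "[\<phi> x = lam * x] (mod int p)" for x
      using cong_add[OF \<phi>0 cong_refl[of "lam * x"]] lam[of x] by (auto intro: cong_trans)
    then show thesis by (rule finish)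
  next
    case True
    have stab: "\<exists>g\<in>quandle_auts Q. g x0 = x0 \<and> g z = z'"
      if z: "z \<in> ?X" "z' \<in> ?X" "z \<noteq> x0" "z' \<noteq> x0" for z z'
    proof -
      have "\<exists>g\<in>quandle_auts Q. g x0 = x0 \<and> g (e 1) = w" if w: "w \<in> ?X" "w \<noteq> x0" for w
      proof -
        have "d w \<in> {0..<int p}" using d_bij w by (auto simp: bij_betw_def)
        moreover have "d w \<noteq> 0" using ed[OF w(1)] e0 w(2) by metis
        ultimately have "d w \<in> U" unfolding True by simp
        then show ?thesis using ed[OF w(1)] by (auto simp: U_def)
      qed
      then obtain g g' where g: "g \<in> quandle_auts Q" "g x0 = x0" "g (e 1) = z"
        and g': "g' \<in> quandle_auts Q" "g' x0 = x0" "g' (e 1) = z'" using z by metis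
      have "pinv g x0 = x0" "pinv g z = e 1" using g by (metis aut_inv_f)+
      then show ?thesis using g g' aut_inv by (intro bexI[of _ "g' \<circ> pinv g"]) auto
    qed
    have two: "\<exists>g\<in>quandle_auts Q. g x = y \<and> g x' = y'"
      if xy: "x \<in> ?X" "x' \<in> ?X" "y \<in> ?X" "y' \<in> ?X" "x \<noteq> x'" "y \<noteq> y'" for x x' y y'
    proof -
      obtain f where f: "f \<in> quandle_auts Q" "f x = x0" using auts_transitive xy x0 by metis
      obtain h where h: "h \<in> quandle_auts Q" "h y = x0" using auts_transitive xy x0 by metis
      have "f x' \<noteq> x0" "h y' \<noteq> x0" using aut_inj[OF f(1), of x' x] aut_inj[OF h(1), of y' y] f(2) h(2) xy by auto
      then obtain g where g: "g \<in> quandle_auts Q" "g x0 = x0" "g (f x') = h y'"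
        using stab[of "f x'" "h y'"] aut_closed[OF f(1)] aut_closed[OF h(1)] xy by blast
      have "pinv h x0 = y" "pinv h (h y') = y'" using h by (metis aut_inv_f)+
      then show ?thesis using f g h aut_inv by (intro bexI[of _ "pinv h \<circ> g \<circ> f"]) auto
    qed
    \<comment> \<open>Some \<open>a\<close> moves \<open>y\<close>. Any \<open>z \<noteq> y\<close>
      is the image of \<open>a \<triangleright> y\<close> under an automorphism \<open>g\<close>
      fixing \<open>y\<close>, so \<open>z = g a \<triangleright> y\<close>. A surjective right
      translation of a finite set is injective, which is the latin property.\<close>
    have surj: "(\<lambda>a. a \<triangleright> y) ` ?X = ?X" if y: "y \<in> ?X" for y
    proof -
      obtain a where a: "a \<in> ?X" "a \<triangleright> y \<noteq> y" using nontrivial_action[OF _ y] p2 card by auto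
      have "z \<in> (\<lambda>a. a \<triangleright> y) ` ?X" if z: "z \<in> ?X" for z
      proof (cases "z = y")
        case True
        then show ?thesis using y idem by (metis imageI)
      next
        case False
        then obtain g where g: "g \<in> quandle_auts Q" "g y = y" "g (a \<triangleright> y) = z"
          using two[of y "a \<triangleright> y" y z] a y z closed by metis
        then have "g a \<triangleright> y = z" using aut_hom[OF g(1) a(1) y] by simp
        then show ?thesis using g(1) a(1) by (intro image_eqI[of _ _ "g a"]) auto
      qed
      then show ?thesis using y closed by auto
    qed
    interpret latin_quandle Q
    proof
      show "finite ?X" by (rule finite_carrier)
      show "a = b" if "a \<in> ?X" "b \<in> ?X" "x \<in> ?X" "a \<triangleright> x = b \<triangleright> x" for a b x
        using that finite_surj_inj[OF finite_carrier, of "\<lambda>a. a \<triangleright> x"] surj[of x]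
        by (auto dest: inj_onD)
    qed
    interpret sharply_transitive_quandle Q
      using prime_two_transitive_rigid two p card by blast
    \<comment> \<open>Being fixed-point-free, \<open>t 1\<close> and its conjugate \<open>f\<close>
      by \<open>L\<close> lie in the commutative group of semiregular automorphisms. So
      \<open>f\<close> is again a translation of the residues, by \<open>lam\<close>, and the
      increments of \<open>\<phi>\<close> are constant.\<close>
    have "t 1 y \<noteq> y" if "y \<in> ?X" for y
    proof
      assume "t 1 y = y"
      then have "e (1 + d y) = e (d y)" using ed[OF that] te by metis
      then have "[1 + d y = 0 + d y] (mod int p)" by (simp add: e_cong)
      then have "[1 = 0] (mod int p)" using cong_add_rcancel by blast
      then show False using p2 by (simp add: cong_def)
    qed
    then have ts: "t 1 \<in> semiregular_auts Q" using tA by (auto simp: semiregular_auts_def)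
    define f where "f = L \<circ> t 1 \<circ> pinv L"
    have fs: "f \<in> semiregular_auts Q" unfolding f_def by (rule semiregular_conj[OF ts LA])
    define lam where "lam = \<phi> 1"
    have fL: "f (L z) = L (t 1 z)" for z using LA by (simp add: f_def)
    have Lx0: "L x0 = x0" using x0 idem by (simp add: L_def)
    \<comment> \<open>Nonnegative \<open>i\<close> cover the application, since
      \<open>\<phi>\<close> takes values in \<open>{0..<int p}\<close>.\<close>
    have fe: "f (e i) = e (i + lam)" if "i \<ge> 0" for i
      using that
    proof (induction i rule: int_ge_induct)
      case base
      have "f x0 = L (t 1 x0)" using fL[of x0] Lx0 by simp
      then show ?case by (simp add: e0 lam_def e\<phi>) (simp add: e0[symmetric] te)
    next
      case (step i)
      have "f (t 1 (e i)) = t 1 (f (e i))" by (rule semiregular_commute[OF fs ts])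
      then show ?case using step by (simp add: te ac_simps)
    qed
    have \<phi>_Suc: "[\<phi> (u + 1) = \<phi> u + lam] (mod int p)" for u
    proof -
      have "e (\<phi> (u + 1)) = f (L (e u))" by (simp add: fL e\<phi> te ac_simps)
      also have "\<dots> = f (e (\<phi> u))" by (simp add: e\<phi>)
      also have "\<dots> = e (\<phi> u + lam)"
        using d_bij eX LA by (intro fe) (auto simp: \<phi>_def bij_betw_def)
      finally show ?thesis by (simp add: e_cong)
    qed
    have lin: "[\<phi> u = lam * u] (mod int p)" if "u \<ge> 0" for u
      using that
    proof (induction u rule: int_ge_induct)
      case base
      then show ?case using \<phi>0 by simp
    next
      case (step u)
      have "[\<phi> u + lam = lam * u + lam] (mod int p)" using step by (intro cong_add) auto
      then show ?case using \<phi>_Suc[of u] by (auto simp: algebra_simps intro: cong_trans)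
    qed
    have "[\<phi> u = lam * u] (mod int p)" for u
    proof -
      have "[\<phi> u = \<phi> (u mod int p)] (mod int p)" by (simp add: \<phi>_cong)
      also have "[\<phi> (u mod int p) = lam * (u mod int p)] (mod int p)" using p2 by (intro lin) simp
      also have "[lam * (u mod int p) = lam * u] (mod int p)" by (simp add: cong_def mod_simps)
      finally show ?thesis .
    qed
    then show thesis by (rule finish)
  qed
qed

end

section \<open>Congruences of finite connected quandles\<close>

lemma congruence_on_equiv: "congruence_on Q \<theta> \<Longrightarrow> equiv (carrier Q) \<theta>"
  by (simp add: congruence_on_def)

lemma congruence_on_op:
  "\<lbrakk>congruence_on Q \<theta>; (a, b) \<in> \<theta>; (c, d) \<in> \<theta>\<rbrakk> \<Longrightarrow> (a \<triangleright>\<^bsub>Q\<^esub> c, b \<triangleright>\<^bsub>Q\<^esub> d) \<in> \<theta>"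
  by (fastforce simp: congruence_on_def)

lemma congruence_on_division:
  "\<lbrakk>congruence_on Q \<theta>; (a, b) \<in> \<theta>; (c, d) \<in> \<theta>\<rbrakk> \<Longrightarrow> (left_division Q a c, left_division Q b d) \<in> \<theta>"
  by (fastforce simp: congruence_on_def)

lemma congruence_on_carrier: "congruence_on Q \<theta> \<Longrightarrow> (a, b) \<in> \<theta> \<Longrightarrow> a \<in> carrier Q \<and> b \<in> carrier Q"
  unfolding congruence_on_def equiv_def refl_on_def by blast

lemma congruence_on_Int:
  assumes "congruence_on Q \<alpha>" "congruence_on Q \<beta>" shows "congruence_on Q (\<alpha> \<inter> \<beta>)"
proof -
  have "equiv (carrier Q) (\<alpha> \<inter> \<beta>)"
    using assms[THEN congruence_on_equiv]
    by (auto simp: equiv_def refl_on_def intro: sym_Int trans_Int)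
  then show ?thesis
    using assms congruence_on_op congruence_on_division
    unfolding congruence_on_def[of Q "\<alpha> \<inter> \<beta>"] by fast
qed

text \<open>The target is a bare function \<open>f\<close>, so that any coordinate map can be
  plugged in; its left cancellation on the image of \<open>h\<close> is what makes the kernel
  respect left division.\<close>

lemma (in quandle) congruence_on_kernel:
  assumes hom: "\<And>a b. \<lbrakk>a \<in> carrier Q; b \<in> carrier Q\<rbrakk> \<Longrightarrow> h (a \<triangleright> b) = f (h a) (h b)"
    and inj: "\<And>a b c. \<lbrakk>a \<in> carrier Q; b \<in> carrier Q; c \<in> carrier Q; f (h a) (h b) = f (h a) (h c)\<rbrakk>
      \<Longrightarrow> h b = h c"
  shows "congruence_on Q {(x, y) \<in> carrier Q \<times> carrier Q. h x = h y}"
proof -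
  have div: "left_division Q a c \<in> carrier Q \<and> a \<triangleright> left_division Q a c = c"
    if "a \<in> carrier Q" "c \<in> carrier Q" for a c
    unfolding left_division_def
    using bij[OF that(1)] that f_the_inv_into_f_bij_betw[OF bij[OF that(1)]]
      bij_betw_the_inv_into[OF bij[OF that(1)]]
    by (metis bij_betwE)
  have "h (left_division Q a c) = h (left_division Q b d)"
    if "a \<in> carrier Q" "b \<in> carrier Q" "h a = h b" "c \<in> carrier Q" "d \<in> carrier Q" "h c = h d" for a b c d
    using inj[OF that(1), of "left_division Q a c" "left_division Q b d"]
      hom[of a "left_division Q a c"] hom[of b "left_division Q b d"] div that by metis
  then show ?thesis
    unfolding congruence_on_def
    by (auto simp: equiv_def refl_on_def sym_def trans_def closed hom div)
qed

lemma (in quandle) subdirectly_reducible_of_separating_congruences: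
  assumes "congruence_on Q \<alpha>" "congruence_on Q \<beta>" "\<alpha> \<noteq> Id_on (carrier Q)" "\<beta> \<noteq> Id_on (carrier Q)"
    "\<alpha> \<inter> \<beta> \<subseteq> Id"
  shows "subdirectly_reducible Q"
proof -
  have "Id_on (carrier Q) \<subseteq> \<theta>" if "congruence_on Q \<theta>" for \<theta>
    using congruence_on_equiv[OF that] by (auto simp: equiv_def refl_on_def)
  then have "Id_on (carrier Q) \<subseteq> (carrier Q \<times> carrier Q) \<inter>
      \<Inter>{\<theta>. congruence_on Q \<theta> \<and> \<theta> \<noteq> Id_on (carrier Q)}"
    by blast
  moreover have "\<Inter>{\<theta>. congruence_on Q \<theta> \<and> \<theta> \<noteq> Id_on (carrier Q)} \<subseteq> \<alpha> \<inter> \<beta>"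
    using assms by blast
  moreover have "(carrier Q \<times> carrier Q) \<inter> (\<alpha> \<inter> \<beta>) \<subseteq> Id_on (carrier Q)"
    using assms(5) by auto
  ultimately show ?thesis unfolding subdirectly_irreducible_def by blast
qed

lemma (in connected_quandle) finite_connected:
  "finite (carrier Q) \<Longrightarrow> finite_connected_quandle Q"
  using invariant_set_full by unfold_locales auto

context finite_connected_quandle
begin

lemma congruence_cancel:
  assumes \<theta>: "congruence_on Q \<theta>" and "a \<in> carrier Q" "c \<in> carrier Q" "d \<in> carrier Q"
    "(a \<triangleright> c, a \<triangleright> d) \<in> \<theta>"
  shows "(c, d) \<in> \<theta>"
proof -
  have "(a, a) \<in> \<theta>" using congruence_on_equiv[OF \<theta>] assms(2) by (simp add: equiv_def refl_on_def)
  moreover have "left_division Q a (a \<triangleright> x) = x" if "x \<in> carrier Q" for x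
    unfolding left_division_def using bij[OF assms(2)] that
    by (intro the_inv_into_f_f) (auto simp: bij_betw_def)
  ultimately show ?thesis using congruence_on_division[OF \<theta>, of a a] assms by metis
qed

text \<open>Left translation by \<open>a\<close> maps the class of \<open>s\<close> bijectively onto
  the class of \<open>a \<triangleright> s\<close>, so the points whose class has a given size form
  a stable set.\<close>

lemma card_congruence_class:
  assumes \<theta>: "congruence_on Q \<theta>" and "x \<in> carrier Q" "y \<in> carrier Q"
  shows "card (\<theta> `` {y}) = card (\<theta> `` {x})"
proof -
  define S where "S = {y \<in> carrier Q. card (\<theta> `` {y}) = card (\<theta> `` {x})}"
  have "S = carrier Q"
  proof (rule invariant_full)
    fix a s assume a: "a \<in> carrier Q" and s: "s \<in> S"
    have sX: "s \<in> carrier Q" using s by (simp add: S_def)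
    have aa: "(a, a) \<in> \<theta>" using congruence_on_equiv[OF \<theta>] a by (simp add: equiv_def refl_on_def)
    have "bij_betw (\<lambda>z. a \<triangleright> z) (\<theta> `` {s}) (\<theta> `` {a \<triangleright> s})"
      unfolding bij_betw_def
    proof (intro conjI equalityI subsetI)
      show "inj_on (\<lambda>z. a \<triangleright> z) (\<theta> `` {s})"
        using left_cancel[OF a] congruence_on_carrier[OF \<theta>] by (intro inj_onI) blast
      fix w assume "w \<in> (\<lambda>z. a \<triangleright> z) ` (\<theta> `` {s})"
      then show "w \<in> \<theta> `` {a \<triangleright> s}" using congruence_on_op[OF \<theta> aa] by auto
    next
      fix w assume w: "w \<in> \<theta> `` {a \<triangleright> s}"
      then have "w \<in> (\<lambda>z. a \<triangleright> z) ` carrier Q"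
        using congruence_on_carrier[OF \<theta>] bij[OF a] by (auto simp: bij_betw_def)
      then obtain z where "z \<in> carrier Q" "w = a \<triangleright> z" by blast
      then show "w \<in> (\<lambda>z. a \<triangleright> z) ` (\<theta> `` {s})"
        using congruence_cancel[OF \<theta> a sX, of z] w by blast
    qed
    then have "card (\<theta> `` {a \<triangleright> s}) = card (\<theta> `` {s})" by (rule bij_betw_same_card[symmetric])
    then show "a \<triangleright> s \<in> S" using s a closed by (simp add: S_def)
  qed (use assms S_def in auto)
  then show ?thesis using assms(3) by (auto simp: S_def)
qed

text \<open>The quotient is realised on chosen representatives, which keeps it in the type of
  \<open>Q\<close>. A stable set of the quotient pulls back to a stable set of \<open>Q\<close>, so
  connectedness is inherited. As all classes have one size, there are p of them and the prime case
  applies.\<close>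

lemma affine_quotient:
  assumes \<theta>: "congruence_on Q \<theta>" and x0: "x0 \<in> carrier Q"
    and p: "prime p" "card (carrier Q) = p * card (\<theta> `` {x0})"
  obtains h :: "'a \<Rightarrow> int" and c where
    "\<And>x. x \<in> carrier Q \<Longrightarrow> h x \<in> {0..<int p}"
    "\<And>x y. \<lbrakk>x \<in> carrier Q; y \<in> carrier Q\<rbrakk> \<Longrightarrow> h x = h y \<longleftrightarrow> (x, y) \<in> \<theta>"
    "\<And>a b. \<lbrakk>a \<in> carrier Q; b \<in> carrier Q\<rbrakk> \<Longrightarrow> h (a \<triangleright> b) = (h a + c * (h b - h a)) mod int p"
    "2 \<le> c" "c < int p"
proof -
  let ?X = "carrier Q"
  note eq = congruence_on_equiv[OF \<theta>]
  have refl: "(x, x) \<in> \<theta>" if "x \<in> ?X" for x using eq that by (simp add: equiv_def refl_on_def)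
  have sym: "(y, x) \<in> \<theta>" if "(x, y) \<in> \<theta>" for x y using eq that by (auto simp: equiv_def sym_def)
  have trans: "(x, z) \<in> \<theta>" if "(x, y) \<in> \<theta>" "(y, z) \<in> \<theta>" for x y z
    using eq that unfolding equiv_def trans_def by blast
  define r where "r x = (SOME z. z \<in> \<theta> `` {x})" for x
  have r: "(x, r x) \<in> \<theta>" if "x \<in> ?X" for x
    using someI[of "\<lambda>z. z \<in> \<theta> `` {x}" x] refl[OF that] by (simp add: r_def)
  have rX: "r x \<in> ?X" if "x \<in> ?X" for x using r[OF that] congruence_on_carrier[OF \<theta>] by blast
  have r_eq: "r x = r y \<longleftrightarrow> (x, y) \<in> \<theta>" if "x \<in> ?X" "y \<in> ?X" for x y
  proof
    assume "r x = r y"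
    then show "(x, y) \<in> \<theta>" using r that sym trans by metis
  next
    assume "(x, y) \<in> \<theta>"
    then have "\<theta> `` {x} = \<theta> `` {y}" using eq equiv_class_eq by metis
    then show "r x = r y" by (simp add: r_def)
  qed
  have rr: "r (r x) = r x" if "x \<in> ?X" for x using r_eq r rX sym that by blast
  have r_op: "r (r a \<triangleright> r b) = r (a \<triangleright> b)" if ab: "a \<in> ?X" "b \<in> ?X" for a b
  proof -
    have "(r a, a) \<in> \<theta>" "(r b, b) \<in> \<theta>" using r sym ab by simp_all
    then have "(r a \<triangleright> r b, a \<triangleright> b) \<in> \<theta>" by (rule congruence_on_op[OF \<theta>])
    then show ?thesis using r_eq[of "r a \<triangleright> r b" "a \<triangleright> b"] rX closed ab by simp
  qed
  define R where "R = \<lparr>carrier = r ` ?X, qop = (\<lambda>a b. r (a \<triangleright> b))\<rparr>"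
  have cR: "carrier R = r ` ?X" by (simp add: R_def)
  have fR: "finite (r ` ?X)" using finite_carrier by simp
  have opR: "r a \<triangleright>\<^bsub>R\<^esub> r b = r (a \<triangleright> b)" if "a \<in> ?X" "b \<in> ?X" for a b
    using r_op that by (simp add: R_def)
  interpret R: finite_connected_quandle R
  proof
    fix a b assume "a \<in> carrier R" "b \<in> carrier R"
    then show "a \<triangleright>\<^bsub>R\<^esub> b \<in> carrier R" by (auto simp: cR opR closed)
  next
    fix a assume "a \<in> carrier R"
    then obtain a' where a: "a' \<in> ?X" "a = r a'" by (auto simp: cR)
    have "inj_on (\<lambda>b. a \<triangleright>\<^bsub>R\<^esub> b) (r ` ?X)"
    proof (rule inj_onI)
      fix b c assume "b \<in> r ` ?X" "c \<in> r ` ?X" and e: "a \<triangleright>\<^bsub>R\<^esub> b = a \<triangleright>\<^bsub>R\<^esub> c"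
      then obtain b' c' where bc: "b' \<in> ?X" "c' \<in> ?X" "b = r b'" "c = r c'" by auto
      have "(a' \<triangleright> b', a' \<triangleright> c') \<in> \<theta>" using e a bc by (simp add: opR r_eq closed)
      then show "b = c" using congruence_cancel[OF \<theta> a(1)] bc r_eq by simp
    qed
    moreover have "(\<lambda>b. a \<triangleright>\<^bsub>R\<^esub> b) ` (r ` ?X) \<subseteq> r ` ?X" using a by (auto simp: opR closed)
    ultimately show "bij_betw (\<lambda>b. a \<triangleright>\<^bsub>R\<^esub> b) (carrier R) (carrier R)"
      by (simp add: cR bij_betw_def endo_inj_surj[OF fR])
  next
    fix a b c assume "a \<in> carrier R" "b \<in> carrier R" "c \<in> carrier R"
    then obtain a' b' c' where "a' \<in> ?X" "b' \<in> ?X" "c' \<in> ?X" "a = r a'" "b = r b'" "c = r c'"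
      by (auto simp: cR)
    then show "a \<triangleright>\<^bsub>R\<^esub> (b \<triangleright>\<^bsub>R\<^esub> c) = (a \<triangleright>\<^bsub>R\<^esub> b) \<triangleright>\<^bsub>R\<^esub> (a \<triangleright>\<^bsub>R\<^esub> c)"
      by (simp add: opR closed left_distrib[symmetric])
  next
    fix a assume "a \<in> carrier R"
    then show "a \<triangleright>\<^bsub>R\<^esub> a = a" by (auto simp: cR opR idem)
  next
    show "finite (carrier R)" using fR by (simp add: cR)
  next
    fix S assume S: "S \<subseteq> carrier R" "S \<noteq> {}"
      and inv: "\<And>a s. \<lbrakk>a \<in> carrier R; s \<in> S\<rbrakk> \<Longrightarrow> a \<triangleright>\<^bsub>R\<^esub> s \<in> S"
    have "{x \<in> ?X. r x \<in> S} = ?X"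
    proof (rule invariant_full)
      show "{x \<in> ?X. r x \<in> S} \<noteq> {}" using S by (auto simp: cR)
      fix a s assume a: "a \<in> ?X" and s: "s \<in> {x \<in> ?X. r x \<in> S}"
      then have "r a \<triangleright>\<^bsub>R\<^esub> r s \<in> S" using inv[of "r a" "r s"] by (simp add: cR)
      then show "a \<triangleright> s \<in> {x \<in> ?X. r x \<in> S}" using a s by (simp add: opR closed)
    qed auto
    then show "S = carrier R" using S by (auto simp: cR)
  qed
  have "card ?X = card (r ` ?X) * card (\<theta> `` {x0})"
  proof -
    have "?X = (\<Union>z\<in>r ` ?X. \<theta> `` {z})"
      using r sym congruence_on_carrier[OF \<theta>] by blast
    also have "card \<dots> = (\<Sum>z\<in>r ` ?X. card (\<theta> `` {z}))"
    proof (rule card_UN_disjoint[OF fR])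
      show "\<forall>i\<in>r ` ?X. finite (\<theta> `` {i})"
        using congruence_on_carrier[OF \<theta>] finite_carrier by (meson Image_singleton_iff finite_subset subsetI)
      show "\<forall>i\<in>r ` ?X. \<forall>j\<in>r ` ?X. i \<noteq> j \<longrightarrow> \<theta> `` {i} \<inter> \<theta> `` {j} = {}"
      proof (intro ballI impI)
        fix i j assume ij: "i \<in> r ` ?X" "j \<in> r ` ?X" "i \<noteq> j"
        then obtain x y where "x \<in> ?X" "y \<in> ?X" "i = r x" "j = r y" by blast
        then have "(i, j) \<notin> \<theta>" using ij(3) r_eq rr rX by metis
        then show "\<theta> `` {i} \<inter> \<theta> `` {j} = {}" using sym trans by blast
      qed
    qed
    also have "\<dots> = (\<Sum>z\<in>r ` ?X. card (\<theta> `` {x0}))"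
      using card_congruence_class[OF \<theta> x0] rX by (intro sum.cong) auto
    finally show ?thesis by simp
  qed
  moreover have "card (\<theta> `` {x0}) > 0"
  proof -
    have "finite (\<theta> `` {x0})"
      using congruence_on_carrier[OF \<theta>] finite_carrier by (meson Image_singleton_iff finite_subset subsetI)
    then show ?thesis using refl[OF x0] by (auto simp: card_gt_0_iff)
  qed
  ultimately have "card (carrier R) = p" using p(2) by (simp add: cR)
  then obtain h c where h: "bij_betw h (carrier R) {0..<int p}"
    "\<And>a b. \<lbrakk>a \<in> carrier R; b \<in> carrier R\<rbrakk> \<Longrightarrow> h (a \<triangleright>\<^bsub>R\<^esub> b) = (h a + c * (h b - h a)) mod int p"
    "2 \<le> c" "c < int p"
    using R.affine_of_prime_card[OF p(1)] by blast
  show thesis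
  proof (rule that[of "h \<circ> r" c])
    show "(h \<circ> r) x \<in> {0..<int p}" if "x \<in> ?X" for x
      using h(1) that by (auto simp: cR bij_betw_def)
    show "(h \<circ> r) x = (h \<circ> r) y \<longleftrightarrow> (x, y) \<in> \<theta>" if "x \<in> ?X" "y \<in> ?X" for x y
      using h(1) that r_eq[OF that] by (auto simp: cR bij_betw_def inj_on_def)
    show "(h \<circ> r) (a \<triangleright> b) = ((h \<circ> r) a + c * ((h \<circ> r) b - (h \<circ> r) a)) mod int p"
      if "a \<in> ?X" "b \<in> ?X" for a b
      using h(2)[of "r a" "r b"] that by (simp add: cR opR)
  qed (use h in auto)
qed

end

section \<open>Class sizes and the congruences of a reducible quandle\<close>

context finite_connected_quandle
begin

text \<open>A class of \<open>\<beta>\<close> is partitioned into classes of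
  \<open>\<alpha>\<close>, all of one size.\<close>

lemma card_congruence_class_dvd:
  assumes \<alpha>: "congruence_on Q \<alpha>" and \<beta>: "congruence_on Q \<beta>" and sub: "\<alpha> \<subseteq> \<beta>" and x: "x \<in> carrier Q"
  shows "card (\<alpha> `` {x}) dvd card (\<beta> `` {x})"
proof -
  let ?A = "\<beta> `` {x}"
  have AX: "?A \<subseteq> carrier Q" using congruence_on_carrier[OF \<beta>] by blast
  have A: "equiv ?A (\<alpha> \<inter> ?A \<times> ?A)"
    using congruence_on_equiv[OF \<alpha>] AX
    unfolding equiv_def refl_on_def sym_def trans_def by blast
  show ?thesis
  proof (rule equiv_imp_dvd_card[OF _ A])
    show "finite ?A" using AX finite_carrier finite_subset by blast
    fix X assume "X \<in> ?A // (\<alpha> \<inter> ?A \<times> ?A)"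
    then obtain y where y: "y \<in> ?A" "X = (\<alpha> \<inter> ?A \<times> ?A) `` {y}" by (elim quotientE)
    have "\<alpha> `` {y} \<subseteq> ?A"
      using y(1) sub congruence_on_equiv[OF \<beta>] unfolding equiv_def trans_def by blast
    then have "X = \<alpha> `` {y}" using y by blast
    then show "card (\<alpha> `` {x}) dvd card X"
      using card_congruence_class[OF \<alpha> x, of y] y(1) AX by auto
  qed
qed

lemma full_congruence: "congruence_on Q (carrier Q \<times> carrier Q)"
  using congruence_on_kernel[of "\<lambda>_. ()" "\<lambda>_ _. ()"] by simp

lemma card_congruence_class_dvd_card:
  assumes "congruence_on Q \<alpha>" "x \<in> carrier Q"
  shows "card (\<alpha> `` {x}) dvd card (carrier Q)"
proof -
  have "\<alpha> \<subseteq> carrier Q \<times> carrier Q" using congruence_on_carrier[OF assms(1)] by auto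
  then have "card (\<alpha> `` {x}) dvd card ((carrier Q \<times> carrier Q) `` {x})"
    using card_congruence_class_dvd[OF assms(1) full_congruence _ assms(2)] by blast
  moreover have "(carrier Q \<times> carrier Q) `` {x} = carrier Q" using assms(2) by auto
  ultimately show ?thesis by simp
qed

lemma congruence_eq_of_card_class:
  assumes \<alpha>: "congruence_on Q \<alpha>" and \<beta>: "congruence_on Q \<beta>" and sub: "\<alpha> \<subseteq> \<beta>"
    and x: "x \<in> carrier Q" and c: "card (\<alpha> `` {x}) = card (\<beta> `` {x})"
  shows "\<alpha> = \<beta>"
proof
  show "\<beta> \<subseteq> \<alpha>"
  proof (rule subrelI)
    fix y z assume yz: "(y, z) \<in> \<beta>"
    then have y: "y \<in> carrier Q" using congruence_on_carrier[OF \<beta>] by blast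
    have "\<alpha> `` {y} = \<beta> `` {y}"
    proof (rule card_subset_eq)
      show "finite (\<beta> `` {y})"
        using congruence_on_carrier[OF \<beta>] finite_carrier by (meson Image_singleton_iff finite_subset subsetI)
      show "card (\<alpha> `` {y}) = card (\<beta> `` {y})"
        using card_congruence_class[OF \<alpha> x y] card_congruence_class[OF \<beta> x y] c by simp
    qed (use sub in blast)
    then show "(y, z) \<in> \<alpha>" using yz by blast
  qed
qed (rule sub)

lemma Id_congruence: "congruence_on Q (Id_on (carrier Q))"
proof -
  have "congruence_on Q {(x, y) \<in> carrier Q \<times> carrier Q. id x = id y}"
    using left_cancel by (intro congruence_on_kernel[where f = "(\<triangleright>)"]) auto
  moreover have "{(x, y) \<in> carrier Q \<times> carrier Q. id x = id y} = Id_on (carrier Q)" by auto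
  ultimately show ?thesis by simp
qed

lemma congruence_eq_Id:
  assumes \<alpha>: "congruence_on Q \<alpha>" and x: "x \<in> carrier Q" and c: "card (\<alpha> `` {x}) = 1"
  shows "\<alpha> = Id_on (carrier Q)"
proof -
  have "Id_on (carrier Q) \<subseteq> \<alpha>"
    using congruence_on_equiv[OF \<alpha>] by (auto simp: equiv_def refl_on_def)
  moreover have "Id_on (carrier Q) `` {x} = {x}" using x by auto
  ultimately show ?thesis using congruence_eq_of_card_class[OF Id_congruence \<alpha> _ x] c by simp
qed

text \<open>If \<open>x\<close> and \<open>y\<close> are congruent modulo \<open>\<alpha>\<close>, then \<open>L\<^sub>x L\<^sub>y\<^sup>-\<^sup>1\<close> acts trivially on \<open>Q/\<alpha>\<close> and
  as a translation of order dividing \<open>r\<close> on \<open>Q/\<beta>\<close>. Its orbits have length 1 or \<open>r\<close> and lie in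
  classes of \<open>\<alpha>\<close>, which have fewer than \<open>r\<close> elements.\<close>

lemma no_two_transversal_congruences:
  assumes r: "prime r" and s: "s < r" and card: "card (carrier Q) = r * s"
    and \<alpha>: "congruence_on Q \<alpha>" and \<beta>: "congruence_on Q \<beta>"
    and x0: "x0 \<in> carrier Q" and ca: "card (\<alpha> `` {x0}) = s" and cb: "card (\<beta> `` {x0}) = s"
    and int: "\<alpha> \<inter> \<beta> \<subseteq> Id" and xy: "(x, y) \<in> \<alpha>"
  shows "x = y"
proof -
  let ?X = "carrier Q"
  have cA: "card ?X = r * card (\<alpha> `` {x0})" and cB: "card ?X = r * card (\<beta> `` {x0})"
    by (simp_all only: card ca cb)
  obtain h1 c1 where h1: "\<And>x. x \<in> ?X \<Longrightarrow> h1 x \<in> {0..<int r}"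
    "\<And>x y. \<lbrakk>x \<in> ?X; y \<in> ?X\<rbrakk> \<Longrightarrow> h1 x = h1 y \<longleftrightarrow> (x, y) \<in> \<alpha>"
    "\<And>a b. \<lbrakk>a \<in> ?X; b \<in> ?X\<rbrakk> \<Longrightarrow> h1 (a \<triangleright> b) = (h1 a + c1 * (h1 b - h1 a)) mod int r"
    "2 \<le> c1" "c1 < int r"
    by (rule affine_quotient[OF \<alpha> x0 r cA]) (rule that; simp)
  obtain h2 c2 where h2: "\<And>x. x \<in> ?X \<Longrightarrow> h2 x \<in> {0..<int r}"
    "\<And>x y. \<lbrakk>x \<in> ?X; y \<in> ?X\<rbrakk> \<Longrightarrow> h2 x = h2 y \<longleftrightarrow> (x, y) \<in> \<beta>"
    "\<And>a b. \<lbrakk>a \<in> ?X; b \<in> ?X\<rbrakk> \<Longrightarrow> h2 (a \<triangleright> b) = (h2 a + c2 * (h2 b - h2 a)) mod int r"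
    "2 \<le> c2" "c2 < int r"
    by (rule affine_quotient[OF \<beta> x0 r cB]) (rule that; simp)
  have x: "x \<in> ?X" and y: "y \<in> ?X" using congruence_on_carrier[OF \<alpha> xy] by auto
  define t where "t = left_perm Q x \<circ> pinv (left_perm Q y)"
  have Ly: "left_perm Q y \<in> quandle_auts Q" by (rule left_perm_aut[OF y])
  have tA: "t \<in> quandle_auts Q" unfolding t_def using left_perm_aut[OF x] aut_inv[OF Ly] by blast
  have tX: "(t ^^ n) z \<in> ?X" if "z \<in> ?X" for n z using that aut_funpow[OF tA] by simp
  \<comment> \<open>The change of the second coordinate when the left factor \<open>y\<close> is
    replaced by \<open>x\<close>; it does not depend on the right factor.\<close>
  define \<delta> where "\<delta> = (1 - c2) * (h2 x - h2 y)"
  have step: "h1 (t z) = h1 z \<and> [h2 (t z) = h2 z + \<delta>] (mod int r)" if z: "z \<in> ?X" for z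
  proof -
    define w where "w = pinv (left_perm Q y) z"
    have w: "w \<in> ?X" using aut_inv[OF Ly] z by (simp add: w_def)
    have zw: "z = y \<triangleright> w" using aut_f_inv[OF Ly, of z] w by (simp add: w_def)
    have tz: "t z = x \<triangleright> w" using w by (simp add: t_def w_def)
    have "h1 x = h1 y" using h1(2) x y xy by blast
    then have "h1 (x \<triangleright> w) = h1 (y \<triangleright> w)" using h1(3) x y w by simp
    moreover have "[h2 (x \<triangleright> w) = h2 (y \<triangleright> w) + \<delta>] (mod int r)"
    proof -
      have "[h2 (x \<triangleright> w) = h2 x + c2 * (h2 w - h2 x)] (mod int r)"
        using h2(3)[OF x w] by (simp add: cong_def)
      also have "h2 x + c2 * (h2 w - h2 x) = h2 y + c2 * (h2 w - h2 y) + \<delta>"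
        by (simp add: \<delta>_def algebra_simps)
      also have "[\<dots> = h2 (y \<triangleright> w) + \<delta>] (mod int r)"
        using h2(3)[OF y w] by (intro cong_add) (simp_all add: cong_def)
      finally show ?thesis .
    qed
    ultimately show ?thesis using tz zw by metis
  qed
  have pow: "h1 ((t ^^ n) z) = h1 z \<and> [h2 ((t ^^ n) z) = h2 z + int n * \<delta>] (mod int r)" if z: "z \<in> ?X" for n z
  proof (induction n)
    case (Suc n)
    have "[h2 (t ((t ^^ n) z)) = h2 ((t ^^ n) z) + \<delta>] (mod int r)" using step tX[OF z] by blast
    moreover have "[h2 ((t ^^ n) z) + \<delta> = h2 z + int n * \<delta> + \<delta>] (mod int r)"
      using Suc by (intro cong_add) auto
    ultimately have "[h2 (t ((t ^^ n) z)) = h2 z + int n * \<delta> + \<delta>] (mod int r)" by (rule cong_trans)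
    then show ?case using step[OF tX[OF z]] Suc by (simp add: algebra_simps)
  qed simp
  have eqI: "u = v" if "u \<in> ?X" "v \<in> ?X" "h1 u = h1 v" "[h2 u = h2 v] (mod int r)" for u v
  proof -
    have "h2 u = h2 v" using h2(1)[OF that(1)] h2(1)[OF that(2)] that(4) by (simp add: cong_def)
    then have "(u, v) \<in> \<alpha> \<inter> \<beta>" using h1(2) h2(2) that by blast
    then show ?thesis using int by blast
  qed
  have tr: "(t ^^ r) z = z" if z: "z \<in> ?X" for z
    using pow[OF z, of r] by (intro eqI tX z) (auto simp: cong_def)
  have "t z = z" if z: "z \<in> ?X" for z
  proof (rule ccontr)
    assume "t z \<noteq> z"
    then have inj: "inj_on (\<lambda>i. (t ^^ i) z) {..<r}" using r tr[OF z] by (intro inj_on_prime_orbit)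
    have "(\<lambda>i. (t ^^ i) z) ` {..<r} \<subseteq> \<alpha> `` {z}"
    proof (rule image_subsetI)
      fix i
      have "h1 z = h1 ((t ^^ i) z)" using pow[OF z] by simp
      then show "(t ^^ i) z \<in> \<alpha> `` {z}" using h1(2)[OF z tX[OF z]] by blast
    qed
    moreover have "finite (\<alpha> `` {z})"
      using congruence_on_carrier[OF \<alpha>] finite_carrier by (meson Image_singleton_iff finite_subset subsetI)
    ultimately have "r \<le> card (\<alpha> `` {z})" using inj by (metis card_image card_lessThan card_mono)
    then show False using card_congruence_class[OF \<alpha> x0 z] ca s by simp
  qed
  \<comment> \<open>With \<open>t\<close> trivial, \<open>\<delta>\<close> vanishes modulo
    \<open>r\<close>, and \<open>1 - c2\<close> is a unit because \<open>2 \<le> c2 < r\<close>. So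
    \<open>x\<close> and \<open>y\<close> agree in the second coordinate as well.\<close>
  then have "[h2 x = h2 x + \<delta>] (mod int r)" using step[OF x] x by simp
  then have "int r dvd (1 - c2) * (h2 x - h2 y)" by (simp add: cong_iff_dvd_diff \<delta>_def)
  moreover have "\<not> int r dvd 1 - c2"
  proof
    assume "int r dvd 1 - c2"
    then have "int r dvd c2 - 1" using dvd_minus_iff by fastforce
    then show False using zdvd_imp_le[of "int r" "c2 - 1"] h2(4,5) by simp
  qed
  ultimately have "int r dvd h2 x - h2 y" using r by (simp add: prime_dvd_mult_iff)
  then show ?thesis using eqI[OF x y] h1(2)[OF x y] xy by (simp add: cong_iff_dvd_diff)
qed

text \<open>Class sizes p and q give the two coordinates at once, since coprime sizes make the
  intersection trivial. If both sizes were equal, a class of \<open>\<alpha>\<close> would embed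
  into the quotient by \<open>\<beta>\<close>, so the common size would be the smaller prime, and
  \<open>no_two_transversal_congruences\<close> would collapse \<open>\<alpha>\<close>.\<close>

theorem affine_factors_of_reducible:
  assumes p: "prime p" and q: "prime q" and neq: "p \<noteq> q"
    and card: "card (carrier Q) = p * q" and red: "subdirectly_reducible Q"
  obtains h1 h2 :: "'a \<Rightarrow> int" and c1 c2 where
    "\<And>x. x \<in> carrier Q \<Longrightarrow> h1 x \<in> {0..<int p}" "\<And>x. x \<in> carrier Q \<Longrightarrow> h2 x \<in> {0..<int q}"
    "\<And>x y. \<lbrakk>x \<in> carrier Q; y \<in> carrier Q; h1 x = h1 y; h2 x = h2 y\<rbrakk> \<Longrightarrow> x = y"
    "\<And>a b. \<lbrakk>a \<in> carrier Q; b \<in> carrier Q\<rbrakk> \<Longrightarrow> h1 (a \<triangleright> b) = (h1 a + c1 * (h1 b - h1 a)) mod int p"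
    "\<And>a b. \<lbrakk>a \<in> carrier Q; b \<in> carrier Q\<rbrakk> \<Longrightarrow> h2 (a \<triangleright> b) = (h2 a + c2 * (h2 b - h2 a)) mod int q"
    "2 \<le> c1" "c1 < int p" "2 \<le> c2" "c2 < int q"
proof -
  let ?X = "carrier Q" and ?I = "Id_on (carrier Q)"
  have p2: "p \<ge> 2" "q \<ge> 2" using p q prime_ge_2_nat by auto
  then have pq: "p * q > 1" by (metis less_1_mult less_le_trans one_less_numeral_iff semiring_norm(76))
  then obtain x0 where x0: "x0 \<in> ?X" using card by (metis card.empty ex_in_conv not_one_less_zero)
  define s where "s \<theta> = card (\<theta> `` {x0})" for \<theta> :: "('a \<times> 'a) set"
  define C where "C = {\<theta>. congruence_on Q \<theta> \<and> \<theta> \<noteq> ?I}"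
  have meet: "(?X \<times> ?X) \<inter> \<Inter>C = ?I" using red by (simp add: subdirectly_irreducible_def C_def)
  have s_dvd: "s \<theta> dvd p * q" if "congruence_on Q \<theta>" for \<theta>
    using card_congruence_class_dvd_card[OF that x0] card by (simp add: s_def)
  have s_cases: "s \<theta> \<in> {1, p, q, p * q}" if \<theta>: "congruence_on Q \<theta>" for \<theta>
  proof -
    obtain a b where ab: "s \<theta> = a * b" "a dvd p" "b dvd q"
      using division_decomp[OF s_dvd[OF \<theta>]] by blast
    then have "a = 1 \<or> a = p" "b = 1 \<or> b = q" using p q by (auto simp: prime_nat_iff)
    then show ?thesis using ab(1) by auto
  qed
  have full: "\<theta> = ?X \<times> ?X" if "congruence_on Q \<theta>" "s \<theta> = p * q" for \<theta>
  proof -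
    have "\<theta> \<subseteq> ?X \<times> ?X" using congruence_on_carrier[OF that(1)] by auto
    moreover have "(?X \<times> ?X) `` {x0} = ?X" using x0 by auto
    ultimately show ?thesis
      using congruence_eq_of_card_class[OF that(1) full_congruence _ x0] that(2) card by (simp add: s_def)
  qed
  have refl: "?I \<subseteq> \<theta>" if "congruence_on Q \<theta>" for \<theta>
    using congruence_on_equiv[OF that] by (auto simp: equiv_def refl_on_def)
  \<comment> \<open>Used twice: with \<open>\<alpha> = {}\<close> it yields a first congruence with
    classes of prime size, then a second one outside the first. If there were none outside
    \<open>\<alpha>\<close>, equality of class sizes would put \<open>\<alpha>\<close> below every
    nontrivial congruence, against reducibility.\<close>
  have proper: "\<exists>\<theta>\<in>C. s \<theta> \<in> {p, q} \<and> \<not> \<theta> \<subseteq> \<alpha>"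
    if \<alpha>: "\<alpha> = {} \<or> \<alpha> \<in> C \<and> s \<alpha> \<in> {p, q}" for \<alpha>
  proof (rule ccontr)
    assume n: "\<not> ?thesis"
    have sub: "s \<theta> \<in> {p, q} \<and> \<theta> \<subseteq> \<alpha> \<or> \<theta> = ?X \<times> ?X" if \<theta>C: "\<theta> \<in> C" for \<theta>
    proof -
      have \<theta>: "congruence_on Q \<theta>" "\<theta> \<noteq> ?I" using \<theta>C by (auto simp: C_def)
      then have "s \<theta> \<noteq> 1" using congruence_eq_Id[OF _ x0] by (auto simp: s_def)
      then show ?thesis using s_cases[OF \<theta>(1)] n \<theta>C full[OF \<theta>(1)] by blast
    qed
    show False
    proof (cases "\<alpha> = {}")
      case True
      have "\<theta> = ?X \<times> ?X" if "\<theta> \<in> C" for \<theta>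
        using sub[OF that] refl[of \<theta>] that x0 True by (auto simp: C_def)
      then have "?X \<times> ?X \<subseteq> ?I" using meet by blast
      then have "?X \<subseteq> {x0}" using x0 by auto
      then have "card ?X \<le> card {x0}" by (intro card_mono) auto
      then show False using pq card by simp
    next
      case False
      then have a: "congruence_on Q \<alpha>" "\<alpha> \<noteq> ?I" "s \<alpha> \<in> {p, q}" using \<alpha> by (auto simp: C_def)
      have "\<alpha> \<subseteq> \<theta>" if \<theta>C: "\<theta> \<in> C" for \<theta>
      proof (cases "\<theta> = ?X \<times> ?X")
        case True
        then show ?thesis using congruence_on_carrier[OF a(1)] by auto
      next
        case False
        then have \<theta>: "s \<theta> \<in> {p, q}" "\<theta> \<subseteq> \<alpha>" "congruence_on Q \<theta>" using sub[OF \<theta>C] \<theta>C by (auto simp: C_def)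
        have "s \<theta> dvd s \<alpha>"
          unfolding s_def by (rule card_congruence_class_dvd[OF \<theta>(3) a(1) \<theta>(2) x0])
        moreover have "prime (s \<theta>)" "prime (s \<alpha>)" using \<theta>(1) a(3) p q by auto
        ultimately have "s \<theta> = s \<alpha>" by (simp add: primes_dvd_imp_eq)
        then show ?thesis
          using congruence_eq_of_card_class[OF \<theta>(3) a(1) \<theta>(2) x0] by (simp add: s_def)
      qed
      moreover have "\<alpha> \<subseteq> ?X \<times> ?X" using congruence_on_carrier[OF a(1)] by auto
      ultimately have "\<alpha> \<subseteq> ?I" using meet by blast
      then show False using a refl by blast
    qed
  qed
  note factorsI = that
  have split: thesis if \<alpha>: "congruence_on Q \<alpha>" "s \<alpha> = q" and \<beta>: "congruence_on Q \<beta>" "s \<beta> = p" for \<alpha> \<beta>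
  proof -
    have int: "congruence_on Q (\<alpha> \<inter> \<beta>)" by (rule congruence_on_Int[OF \<alpha>(1) \<beta>(1)])
    have "s (\<alpha> \<inter> \<beta>) dvd q" "s (\<alpha> \<inter> \<beta>) dvd p"
      using card_congruence_class_dvd[OF int \<alpha>(1) _ x0] card_congruence_class_dvd[OF int \<beta>(1) _ x0] \<alpha> \<beta>
      by (auto simp: s_def)
    then have "s (\<alpha> \<inter> \<beta>) = 1" using p q neq by (metis prime_nat_iff)
    then have Id: "\<alpha> \<inter> \<beta> = ?I" using congruence_eq_Id[OF int x0] by (simp add: s_def)
    have cA: "card ?X = p * card (\<alpha> `` {x0})" and cB: "card ?X = q * card (\<beta> `` {x0})"
      using \<alpha>(2) \<beta>(2) card by (simp_all add: s_def)
    obtain h1 c1 where h1: "\<And>x. x \<in> ?X \<Longrightarrow> h1 x \<in> {0..<int p}"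
      "\<And>x y. \<lbrakk>x \<in> ?X; y \<in> ?X\<rbrakk> \<Longrightarrow> h1 x = h1 y \<longleftrightarrow> (x, y) \<in> \<alpha>"
      "\<And>a b. \<lbrakk>a \<in> ?X; b \<in> ?X\<rbrakk> \<Longrightarrow> h1 (a \<triangleright> b) = (h1 a + c1 * (h1 b - h1 a)) mod int p"
      "2 \<le> c1" "c1 < int p"
      by (rule affine_quotient[OF \<alpha>(1) x0 p cA]) (rule that; simp)
    obtain h2 c2 where h2: "\<And>x. x \<in> ?X \<Longrightarrow> h2 x \<in> {0..<int q}"
      "\<And>x y. \<lbrakk>x \<in> ?X; y \<in> ?X\<rbrakk> \<Longrightarrow> h2 x = h2 y \<longleftrightarrow> (x, y) \<in> \<beta>"
      "\<And>a b. \<lbrakk>a \<in> ?X; b \<in> ?X\<rbrakk> \<Longrightarrow> h2 (a \<triangleright> b) = (h2 a + c2 * (h2 b - h2 a)) mod int q"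
      "2 \<le> c2" "c2 < int q"
      by (rule affine_quotient[OF \<beta>(1) x0 q cB]) (rule that; simp)
    show thesis
    proof (rule factorsI[of h1 h2 c1 c2])
      fix x y assume "x \<in> ?X" "y \<in> ?X" "h1 x = h1 y" "h2 x = h2 y"
      then have "(x, y) \<in> \<alpha> \<inter> \<beta>" using h1(2) h2(2) by blast
      then show "x = y" using Id by auto
    qed (use h1 h2 in auto)
  qed
  obtain \<alpha> where \<alpha>: "\<alpha> \<in> C" "s \<alpha> \<in> {p, q}" using proper[of "{}"] by blast
  obtain \<beta> where \<beta>: "\<beta> \<in> C" "s \<beta> \<in> {p, q}" "\<not> \<beta> \<subseteq> \<alpha>" using proper[of \<alpha>] \<alpha> by blast
  have ca: "congruence_on Q \<alpha>" and cb: "congruence_on Q \<beta>" using \<alpha> \<beta> by (auto simp: C_def)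
  show thesis
  proof (cases "s \<alpha> = s \<beta>")
    case False
    then show thesis using split[OF ca _ cb] split[OF cb _ ca] \<alpha>(2) \<beta>(2) by auto
  next
    case True
    have int: "congruence_on Q (\<alpha> \<inter> \<beta>)" by (rule congruence_on_Int[OF ca cb])
    have dvd: "s (\<alpha> \<inter> \<beta>) dvd s \<beta>"
      using card_congruence_class_dvd[OF int cb _ x0] by (auto simp: s_def)
    have ps: "prime (s \<beta>)" using \<beta>(2) p q by auto
    have "s (\<alpha> \<inter> \<beta>) \<noteq> s \<beta>"
      using congruence_eq_of_card_class[OF int cb _ x0] \<beta>(3) by (auto simp: s_def)
    then have "s (\<alpha> \<inter> \<beta>) = 1" using dvd ps by (auto simp: prime_nat_iff)
    then have Id: "\<alpha> \<inter> \<beta> = ?I" using congruence_eq_Id[OF int x0] by (simp add: s_def)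
    obtain r where r: "prime r" "p * q = r * s \<alpha>" "r \<noteq> s \<alpha>"
      using \<alpha>(2) p q neq by (metis insertE mult.commute singletonD)
    have cB: "card ?X = r * card (\<beta> `` {x0})" using card r(2) True by (simp add: s_def)
    obtain h :: "'a \<Rightarrow> int" and c where h: "\<And>x. x \<in> ?X \<Longrightarrow> h x \<in> {0..<int r}"
      "\<And>x y. \<lbrakk>x \<in> ?X; y \<in> ?X\<rbrakk> \<Longrightarrow> h x = h y \<longleftrightarrow> (x, y) \<in> \<beta>"
      "\<And>a b. \<lbrakk>a \<in> ?X; b \<in> ?X\<rbrakk> \<Longrightarrow> h (a \<triangleright> b) = (h a + c * (h b - h a)) mod int r"
      "2 \<le> c" "c < int r"
      by (rule affine_quotient[OF cb x0 r(1) cB]) (rule that; simp)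
    have AX: "\<alpha> `` {x0} \<subseteq> ?X" using congruence_on_carrier[OF ca] by blast
    have "inj_on h (\<alpha> `` {x0})"
    proof (rule inj_onI)
      fix x y assume xy: "x \<in> \<alpha> `` {x0}" "y \<in> \<alpha> `` {x0}" "h x = h y"
      then have "(x, y) \<in> \<beta>" using h(2) AX by blast
      moreover have "(x, y) \<in> \<alpha>"
        using xy congruence_on_equiv[OF ca] unfolding equiv_def sym_def trans_def by blast
      ultimately have "(x, y) \<in> ?I" unfolding Id[symmetric] by blast
      then show "x = y" by auto
    qed
    moreover have "h ` (\<alpha> `` {x0}) \<subseteq> {0..<int r}" using h(1) AX by blast
    ultimately have "card (\<alpha> `` {x0}) \<le> card {0..<int r}" by (intro card_inj_on_le) auto
    then have lt: "s \<alpha> < r" using r(3) by (simp add: s_def)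
    have int_Id: "\<alpha> \<inter> \<beta> \<subseteq> Id" unfolding Id by blast
    have sa: "card (\<alpha> `` {x0}) = s \<alpha>" and sb: "card (\<beta> `` {x0}) = s \<alpha>"
      using True by (simp_all add: s_def)
    have "x = y" if xy: "(x, y) \<in> \<alpha>" for x y
      by (rule no_two_transversal_congruences[OF r(1) lt _ ca cb x0 sa sb int_Id xy])
        (simp only: card r(2))
    then have "\<alpha> \<subseteq> ?I" using congruence_on_carrier[OF ca] by auto
    then show thesis using \<alpha>(1) refl[OF ca] by (auto simp: C_def)
  qed
qed

end

section \<open>Affine quandles over cyclic groups\<close>

lemma Aff_left_cancel:
  assumes G: "group G" and f: "f \<in> auto G" and x: "x \<in> carrier G" "y \<in> carrier G" "z \<in> carrier G"
    and eq: "x \<triangleright>\<^bsub>Aff G f\<^esub> y = x \<triangleright>\<^bsub>Aff G f\<^esub> z"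
  shows "y = z"
proof -
  interpret group G by (rule G)
  have fb: "bij_betw f (carrier G) (carrier G)" using f by (simp add: auto_def Bij_def)
  then have fc: "f w \<in> carrier G" if "w \<in> carrier G" for w using that by (metis bij_betwE)
  have "x \<otimes>\<^bsub>G\<^esub> f (y \<otimes>\<^bsub>G\<^esub> inv\<^bsub>G\<^esub> x) = x \<otimes>\<^bsub>G\<^esub> f (z \<otimes>\<^bsub>G\<^esub> inv\<^bsub>G\<^esub> x)" using eq by (simp add: Aff_def)
  then have "f (y \<otimes>\<^bsub>G\<^esub> inv\<^bsub>G\<^esub> x) = f (z \<otimes>\<^bsub>G\<^esub> inv\<^bsub>G\<^esub> x)" using x fc by simp
  then have "y \<otimes>\<^bsub>G\<^esub> inv\<^bsub>G\<^esub> x = z \<otimes>\<^bsub>G\<^esub> inv\<^bsub>G\<^esub> x" by (rule inj_onD[OF bij_betw_imp_inj_on[OF fb]]) (use x in simp_all)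
  then show ?thesis using x by simp
qed

text \<open>Multiplication is restricted to \<open>{0..<int n}\<close> because \<open>auto\<close>
  consists of extensional maps.\<close>

lemma mult_in_auto_integer_mod_group:
  assumes n: "n > 0" and c: "coprime c (int n)"
  shows "(\<lambda>x\<in>{0..<int n}. (c * x) mod int n) \<in> auto (integer_mod_group n)"
proof -
  define f where "f = (\<lambda>x\<in>{0..<int n}. (c * x) mod int n)"
  have car: "carrier (integer_mod_group n) = {0..<int n}" using n by (simp add: carrier_integer_mod_group)
  have "inj_on f {0..<int n}"
  proof (rule inj_onI)
    fix x y assume xy: "x \<in> {0..<int n}" "y \<in> {0..<int n}" "f x = f y"
    then have "[c * x = c * y] (mod int n)" by (simp add: f_def cong_def)
    then have "[x = y] (mod int n)" using c by (simp add: cong_mult_lcancel)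
    then show "x = y" using xy by (simp add: cong_def)
  qed
  moreover have "f ` {0..<int n} \<subseteq> {0..<int n}" using n by (auto simp: f_def)
  ultimately have "bij_betw f {0..<int n} {0..<int n}" by (simp add: bij_betw_def endo_inj_surj)
  moreover have "f \<in> hom (integer_mod_group n) (integer_mod_group n)"
    using n by (auto simp: hom_def car f_def mod_simps algebra_simps)
  ultimately show ?thesis by (simp add: auto_def Bij_def car f_def)
qed

lemma Aff_mult_integer_mod_group:
  assumes n: "n > 0" and "a \<in> {0..<int n}" "b \<in> {0..<int n}"
  shows "a \<triangleright>\<^bsub>Aff (integer_mod_group n) (\<lambda>x\<in>{0..<int n}. (c * x) mod int n)\<^esub> b
    = (a + c * (b - a)) mod int n"
proof -
  have "[a + c * (b + (- a) mod int n) = a + c * (b + - a)] (mod int n)"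
    by (intro cong_add cong_mult cong_refl) (simp add: cong_def)
  then show ?thesis using assms by (simp add: Aff_def carrier_integer_mod_group mod_simps cong_def)
qed

text \<open>\<open>Aff\<close> of the integers modulo \<open>n\<close> with multiplication by
  \<open>k\<close>, placed on natural numbers because the isomorphism classes are counted there. By
  Chinese remainders the affine products over the integers modulo p and q take this form with n =
  pq.\<close>

definition mod_affine :: "nat \<Rightarrow> nat \<Rightarrow> nat binary_struct" where
  "mod_affine n k = \<lparr>carrier = {..<n},
     qop = (\<lambda>a b. nat ((int a + int k * (int b - int a)) mod int n))\<rparr>"

lemma carrier_mod_affine [simp]: "carrier (mod_affine n k) = {..<n}"
  by (simp add: mod_affine_def)

lemma mod_affine_closed: "n > 0 \<Longrightarrow> a \<triangleright>\<^bsub>mod_affine n k\<^esub> b < n"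
  by (simp add: mod_affine_def nat_less_iff)

lemma cong_mod_affine:
  "n > 0 \<Longrightarrow> [int (a \<triangleright>\<^bsub>mod_affine n k\<^esub> b) = int a + int k * (int b - int a)] (mod int n)"
  by (simp add: mod_affine_def cong_def)

lemma eq_of_cong_int: "\<lbrakk>a < n; b < n; [int a = int b] (mod int n)\<rbrakk> \<Longrightarrow> a = b"
  by (simp add: cong_def)

text \<open>An invertible \<open>k\<close> makes left translations bijective. An invertible
  \<open>1 - k\<close> makes right translations bijective, so a single left translation takes any
  \<open>x\<close> to any \<open>y\<close>.\<close>

lemma connected_quandle_mod_affine:
  assumes n: "n > 0" and k: "coprime (int k) (int n)" and k1: "coprime (1 - int k) (int n)"
  shows "connected_quandle (mod_affine n k)"
proof -
  let ?M = "mod_affine n k"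
  note cl = mod_affine_closed[OF n] and cg = cong_mod_affine[OF n]
  have inj: "inj_on (\<lambda>b. a \<triangleright>\<^bsub>?M\<^esub> b) {..<n}" for a
  proof (rule inj_onI)
    fix b c assume bc: "b \<in> {..<n}" "c \<in> {..<n}" "a \<triangleright>\<^bsub>?M\<^esub> b = a \<triangleright>\<^bsub>?M\<^esub> c"
    then have "[int a + int k * (int b - int a) = int a + int k * (int c - int a)] (mod int n)"
      using cg by (metis cong_sym cong_trans)
    then have "[int k * (int b - int a) = int k * (int c - int a)] (mod int n)"
      using cong_add_lcancel by blast
    then have "[int b - int a = int c - int a] (mod int n)" using k by (simp add: cong_mult_lcancel)
    then have "[int b = int c] (mod int n)" by (simp add: cong_iff_dvd_diff)
    then show "b = c" using bc eq_of_cong_int by auto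
  qed
  have rinj: "inj_on (\<lambda>a. a \<triangleright>\<^bsub>?M\<^esub> b) {..<n}" for b
  proof (rule inj_onI)
    fix a c assume ac: "a \<in> {..<n}" "c \<in> {..<n}" "a \<triangleright>\<^bsub>?M\<^esub> b = c \<triangleright>\<^bsub>?M\<^esub> b"
    then have "[int a + int k * (int b - int a) = int c + int k * (int b - int c)] (mod int n)"
      using cg by (metis cong_sym cong_trans)
    then have "int n dvd (1 - int k) * (int a - int c)" by (simp add: cong_iff_dvd_diff algebra_simps)
    then have "int n dvd int a - int c" using k1 by (metis coprime_commute coprime_dvd_mult_right_iff)
    then have "[int a = int c] (mod int n)" by (simp add: cong_iff_dvd_diff)
    then show "a = c" using ac eq_of_cong_int by auto
  qed
  interpret quandle ?M
  proof
    fix a b assume "a \<in> carrier ?M" "b \<in> carrier ?M"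
    then show "a \<triangleright>\<^bsub>?M\<^esub> b \<in> carrier ?M" using cl by simp
  next
    fix a assume "a \<in> carrier ?M"
    have "(\<lambda>b. a \<triangleright>\<^bsub>?M\<^esub> b) ` {..<n} \<subseteq> {..<n}" using cl by auto
    then show "bij_betw (\<lambda>b. a \<triangleright>\<^bsub>?M\<^esub> b) (carrier ?M) (carrier ?M)"
      using inj by (simp add: bij_betw_def endo_inj_surj)
  next
    fix a b c
    have "[int (a \<triangleright>\<^bsub>?M\<^esub> (b \<triangleright>\<^bsub>?M\<^esub> c)) = int a + int k * ((int b + int k * (int c - int b)) - int a)] (mod int n)"
      by (rule cong_trans[OF cg]) (intro cong_add cong_mult cong_diff cong_refl cg)
    also have "int a + int k * ((int b + int k * (int c - int b)) - int a)
      = (int a + int k * (int b - int a)) +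
        int k * ((int a + int k * (int c - int a)) - (int a + int k * (int b - int a)))"
      by (simp add: algebra_simps)
    also have "[\<dots> = int ((a \<triangleright>\<^bsub>?M\<^esub> b) \<triangleright>\<^bsub>?M\<^esub> (a \<triangleright>\<^bsub>?M\<^esub> c))] (mod int n)"
      by (rule cong_sym, rule cong_trans[OF cg]) (intro cong_add cong_mult cong_diff cong_refl cg)
    finally show "a \<triangleright>\<^bsub>?M\<^esub> (b \<triangleright>\<^bsub>?M\<^esub> c) = (a \<triangleright>\<^bsub>?M\<^esub> b) \<triangleright>\<^bsub>?M\<^esub> (a \<triangleright>\<^bsub>?M\<^esub> c)"
      using cl by (intro eq_of_cong_int)
  next
    fix a assume "a \<in> carrier ?M"
    then show "a \<triangleright>\<^bsub>?M\<^esub> a = a" by (simp add: mod_affine_def)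
  qed
  show ?thesis
  proof
    fix x y assume xy: "x \<in> carrier ?M" "y \<in> carrier ?M"
    have "(\<lambda>a. a \<triangleright>\<^bsub>?M\<^esub> x) ` {..<n} = {..<n}" using rinj cl by (intro endo_inj_surj) auto
    then have "y \<in> (\<lambda>a. a \<triangleright>\<^bsub>?M\<^esub> x) ` {..<n}" using xy by simp
    then obtain a where "a < n" "a \<triangleright>\<^bsub>?M\<^esub> x = y" by blast
    then show "\<exists>h\<in>left_mult_group ?M. h x = y"
      using xy by (intro bexI[of _ "left_translation ?M a"])
        (simp_all add: left_mult_group_def left_translation_def generate.incl)
  qed
qed

text \<open>Normalised to \<open>f 0 = 0\<close>, an isomorphism is additive modulo
  \<open>n\<close>: as \<open>k\<close> and \<open>1 - k\<close> are units, any two summands have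
  the form \<open>(1 - k) * a\<close> and \<open>k * b\<close>, and their sum is the product of
  \<open>a\<close> and \<open>b\<close> in the quandle. So \<open>f\<close> is multiplication by
  \<open>f 1\<close>, a unit by surjectivity, and \<open>f k\<close> is both \<open>k * f 1\<close>
  and \<open>k' * f 1\<close>.\<close>

lemma mod_affine_isomorphic_eq:
  assumes n: "n > 0" and k: "coprime (int k) (int n)" "coprime (1 - int k) (int n)"
    and iso: "mod_affine n k \<cong>\<^sub>Q mod_affine n k'" and lt: "k < n" "k' < n"
  shows "k = k'"
proof -
  let ?M = "mod_affine n k" and ?M' = "mod_affine n k'"
  obtain F where F: "bij_betw F {..<n} {..<n}"
    "\<And>a b. \<lbrakk>a < n; b < n\<rbrakk> \<Longrightarrow> F (a \<triangleright>\<^bsub>?M\<^esub> b) = F a \<triangleright>\<^bsub>?M'\<^esub> F b"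
    using iso by (auto simp: quandle_isomorphic_def)
  define f where "f x = int (F (nat (x mod int n))) - int (F 0)" for x
  have f_mod: "f x = f y" if "[x = y] (mod int n)" for x y using that by (simp add: f_def cong_def)
  have f0: "f 0 = 0" by (simp add: f_def)
  have hom: "[f (a + int k * (b - a)) = f a + int k' * (f b - f a)] (mod int n)" for a b
  proof -
    define u v where "u = nat (a mod int n)" and "v = nat (b mod int n)"
    have uv: "u < n" "v < n" "int u = a mod int n" "int v = b mod int n"
      using n by (auto simp: u_def v_def nat_less_iff)
    have "u \<triangleright>\<^bsub>?M\<^esub> v = nat ((a + int k * (b - a)) mod int n)"
    proof -
      have "[int u + int k * (int v - int u) = a + int k * (b - a)] (mod int n)"
        by (intro cong_add cong_mult cong_diff cong_refl) (simp_all add: uv)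
      then show ?thesis by (simp add: mod_affine_def cong_def)
    qed
    then have "f (a + int k * (b - a)) = int (F u \<triangleright>\<^bsub>?M'\<^esub> F v) - int (F 0)"
      using F(2)[OF uv(1,2)] by (simp add: f_def)
    also have "[\<dots> = int (F u) + int k' * (int (F v) - int (F u)) - int (F 0)] (mod int n)"
      by (intro cong_diff cong_refl cong_mod_affine n)
    finally show ?thesis by (simp add: f_def u_def v_def algebra_simps)
  qed
  have h1: "[f (int k * b) = int k' * f b] (mod int n)" for b using hom[of 0 b] by (simp add: f0)
  have h2: "[f ((1 - int k) * a) = f a - int k' * f a] (mod int n)" for a
    using hom[of a 0] by (simp add: f0 algebra_simps)
  have add: "[f (x + y) = f x + f y] (mod int n)" for x y
  proof -
    obtain u where u: "[int k * u = 1] (mod int n)" using k(1) cong_solve_coprime_int by blast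
    obtain v where v: "[(1 - int k) * v = 1] (mod int n)" using k(2) cong_solve_coprime_int by blast
    define a b where "a = v * x" and "b = u * y"
    have a: "[(1 - int k) * a = x] (mod int n)"
      using cong_scalar_right[OF v, of x] by (simp add: a_def ac_simps)
    have b: "[int k * b = y] (mod int n)"
      using cong_scalar_right[OF u, of y] by (simp add: b_def ac_simps)
    have "[x + y = a + int k * (b - a)] (mod int n)"
      using cong_sym[OF cong_add[OF a b]] by (simp add: algebra_simps)
    then have "f (x + y) = f (a + int k * (b - a))" by (rule f_mod)
    also have "[\<dots> = (f a - int k' * f a) + int k' * f b] (mod int n)"
      using hom[of a b] by (simp add: algebra_simps)
    also have "[(f a - int k' * f a) + int k' * f b = f ((1 - int k) * a) + f (int k * b)] (mod int n)"
      by (intro cong_add cong_sym[OF h1] cong_sym[OF h2])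
    also have "f ((1 - int k) * a) + f (int k * b) = f x + f y" using a b f_mod by metis
    finally show ?thesis .
  qed
  have lin: "[f (int m) = int m * f 1] (mod int n)" for m
  proof (induction m)
    case (Suc m)
    have "[f (int m + 1) = f (int m) + f 1] (mod int n)" by (rule add)
    also have "[f (int m) + f 1 = int m * f 1 + f 1] (mod int n)" using Suc by (intro cong_add) auto
    finally show ?case by (simp add: algebra_simps)
  qed (simp add: f0)
  have "\<exists>m. [int m * f 1 = 1] (mod int n)"
  proof -
    define y where "y = nat ((1 + int (F 0)) mod int n)"
    have "y < n" using n by (simp add: y_def nat_less_iff)
    then have "y \<in> F ` {..<n}" using F(1) by (simp add: bij_betw_def)
    then obtain m where m: "m < n" "F m = y" by blast
    have "[int y = 1 + int (F 0)] (mod int n)" using n by (simp add: y_def cong_def)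
    then have "[int y - int (F 0) = 1 + int (F 0) - int (F 0)] (mod int n)" by (intro cong_diff cong_refl)
    then have "[f (int m) = 1] (mod int n)" using m by (simp add: f_def)
    then show ?thesis using lin[of m] by (meson cong_sym cong_trans)
  qed
  then obtain m where m: "[int m * f 1 = 1] (mod int n)" by blast
  have "[int k * f 1 = int k' * f 1] (mod int n)"
    using lin[of k] h1[of 1] by (simp add: cong_def)
  then have "[int k * (int m * f 1) = int k' * (int m * f 1)] (mod int n)"
    using cong_scalar_left[of _ _ _ "int m"] by (metis mult.left_commute)
  moreover have "[int j * (int m * f 1) = int j * 1] (mod int n)" for j using m by (rule cong_scalar_left)
  ultimately have "[int k = int k'] (mod int n)" by (metis cong_sym cong_trans mult.right_neutral)
  then show ?thesis using eq_of_cong_int lt by blast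
qed

lemma quandle_isomorphic_refl: "Q \<cong>\<^sub>Q Q"
  unfolding quandle_isomorphic_def by (rule exI[of _ id]) auto

lemma quandle_isomorphic_sym:
  assumes "quandle Q" "Q \<cong>\<^sub>Q R" shows "R \<cong>\<^sub>Q Q"
proof -
  interpret quandle Q by (rule assms(1))
  obtain h where h: "bij_betw h (carrier Q) (carrier R)"
    "\<And>a b. \<lbrakk>a \<in> carrier Q; b \<in> carrier Q\<rbrakk> \<Longrightarrow> h (a \<triangleright>\<^bsub>Q\<^esub> b) = h a \<triangleright>\<^bsub>R\<^esub> h b"
    using assms(2) by (auto simp: quandle_isomorphic_def)
  define g where "g = the_inv_into (carrier Q) h"
  have g: "bij_betw g (carrier R) (carrier Q)" unfolding g_def by (rule bij_betw_the_inv_into[OF h(1)])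
  have hg: "h (g x) = x" if "x \<in> carrier R" for x
    unfolding g_def using f_the_inv_into_f_bij_betw[OF h(1)] that by blast
  have gh: "g (h x) = x" if "x \<in> carrier Q" for x
    unfolding g_def using h(1) that by (intro the_inv_into_f_f) (auto simp: bij_betw_def)
  have "g (a \<triangleright>\<^bsub>R\<^esub> b) = g a \<triangleright>\<^bsub>Q\<^esub> g b" if "a \<in> carrier R" "b \<in> carrier R" for a b
  proof -
    have gab: "g a \<in> carrier Q" "g b \<in> carrier Q" using g that by (auto simp: bij_betw_def)
    then have "h (g a \<triangleright>\<^bsub>Q\<^esub> g b) = a \<triangleright>\<^bsub>R\<^esub> b" using h(2) hg that by simp
    then show ?thesis using gh closed gab by metis
  qed
  then show ?thesis using g unfolding quandle_isomorphic_def by blast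
qed

lemma quandle_isomorphic_trans:
  assumes "Q \<cong>\<^sub>Q R" "R \<cong>\<^sub>Q S" shows "Q \<cong>\<^sub>Q S"
proof -
  obtain g where g: "bij_betw g (carrier Q) (carrier R)"
    "\<forall>a\<in>carrier Q. \<forall>b\<in>carrier Q. g (a \<triangleright>\<^bsub>Q\<^esub> b) = g a \<triangleright>\<^bsub>R\<^esub> g b"
    using assms(1) by (auto simp: quandle_isomorphic_def)
  obtain h where h: "bij_betw h (carrier R) (carrier S)"
    "\<forall>a\<in>carrier R. \<forall>b\<in>carrier R. h (a \<triangleright>\<^bsub>R\<^esub> b) = h a \<triangleright>\<^bsub>S\<^esub> h b"
    using assms(2) by (auto simp: quandle_isomorphic_def)
  show ?thesis
    unfolding quandle_isomorphic_def
    using bij_betw_trans[OF g(1) h(1)] g(2) h(2) bij_betwE[OF g(1)] by (intro exI[of _ "h \<circ> g"]) simp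
qed

text \<open>The kernels of the two projections meet in equality. Neither is equality itself, because
  p and q are smaller than pq.\<close>

theorem subdirectly_reducible_of_affine_product:
  assumes p: "prime p" and q: "prime q" and Q: "quandle Q" and card: "card (carrier Q) = p * q"
    and f: "f \<in> auto (integer_mod_group p)" and g: "g \<in> auto (integer_mod_group q)"
    and iso: "Q \<cong>\<^sub>Q Aff (integer_mod_group p) f \<times>\<^sub>Q Aff (integer_mod_group q) g"
  shows "subdirectly_reducible Q"
proof -
  let ?X = "carrier Q" and ?P = "Aff (integer_mod_group p) f" and ?R = "Aff (integer_mod_group q) g"
  interpret quandle Q by (rule Q)
  have p2: "p > 1" "q > 1" using p q prime_gt_1_nat by auto
  have car: "carrier ?P = {0..<int p}" "carrier ?R = {0..<int q}"
    using p2 by (simp_all add: Aff_def carrier_integer_mod_group)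
  have "finite ?X" using card p2 by (metis card.infinite mult_is_0 not_one_less_zero)
  obtain H where H: "bij_betw H ?X (carrier ?P \<times> carrier ?R)"
    "\<And>a b. \<lbrakk>a \<in> ?X; b \<in> ?X\<rbrakk> \<Longrightarrow> H (a \<triangleright>\<^bsub>Q\<^esub> b) = H a \<triangleright>\<^bsub>?P \<times>\<^sub>Q ?R\<^esub> H b"
    using iso by (auto simp: quandle_isomorphic_def quandle_prod_def)
  have HX: "fst (H x) \<in> carrier ?P" "snd (H x) \<in> carrier ?R" if "x \<in> ?X" for x
    using bij_betwE[OF H(1)] that by (auto simp: mem_Times_iff)
  define K where "K h = {(x, y) \<in> ?X \<times> ?X. (h (H x) :: int) = h (H y)}" for h
  have c1: "congruence_on Q (K fst)"
    unfolding K_def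
  proof (rule congruence_on_kernel)
    show "fst (H (a \<triangleright>\<^bsub>Q\<^esub> b)) = fst (H a) \<triangleright>\<^bsub>?P\<^esub> fst (H b)" if "a \<in> ?X" "b \<in> ?X" for a b
      using H(2)[OF that] by (simp add: quandle_prod_def split_beta)
    show "fst (H b) = fst (H c)" if "a \<in> ?X" "b \<in> ?X" "c \<in> ?X"
      "fst (H a) \<triangleright>\<^bsub>?P\<^esub> fst (H b) = fst (H a) \<triangleright>\<^bsub>?P\<^esub> fst (H c)" for a b c
      by (rule Aff_left_cancel[OF group_integer_mod_group f _ _ _ that(4)])
        (use HX that in \<open>simp_all add: Aff_def\<close>)
  qed
  have c2: "congruence_on Q (K snd)"
    unfolding K_def
  proof (rule congruence_on_kernel)
    show "snd (H (a \<triangleright>\<^bsub>Q\<^esub> b)) = snd (H a) \<triangleright>\<^bsub>?R\<^esub> snd (H b)" if "a \<in> ?X" "b \<in> ?X" for a b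
      using H(2)[OF that] by (simp add: quandle_prod_def split_beta)
    show "snd (H b) = snd (H c)" if "a \<in> ?X" "b \<in> ?X" "c \<in> ?X"
      "snd (H a) \<triangleright>\<^bsub>?R\<^esub> snd (H b) = snd (H a) \<triangleright>\<^bsub>?R\<^esub> snd (H c)" for a b c
      by (rule Aff_left_cancel[OF group_integer_mod_group g _ _ _ that(4)])
        (use HX that in \<open>simp_all add: Aff_def\<close>)
  qed
  have nontriv: "K h \<noteq> Id_on ?X"
    if h: "\<And>x. x \<in> ?X \<Longrightarrow> h (H x) \<in> {0..<int n}" "n < p * q" for h n
  proof
    assume Id: "K h = Id_on ?X"
    have "inj_on (\<lambda>x. h (H x)) ?X"
    proof (rule inj_onI)
      fix x y assume "x \<in> ?X" "y \<in> ?X" "h (H x) = h (H y)"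
      then have "(x, y) \<in> K h" by (simp add: K_def)
      then show "x = y" unfolding Id by auto
    qed
    then have "card ?X \<le> card {0..<int n}" using h(1) by (intro card_inj_on_le) auto
    then show False using card h(2) by simp
  qed
  show ?thesis
  proof (rule subdirectly_reducible_of_separating_congruences[OF c1 c2])
    show "K fst \<noteq> Id_on ?X" by (rule nontriv[of fst p]) (use HX car p2 in auto)
    show "K snd \<noteq> Id_on ?X" by (rule nontriv[of snd q]) (use HX car p2 in auto)
    show "K fst \<inter> K snd \<subseteq> Id"
    proof (rule subrelI)
      fix x y assume "(x, y) \<in> K fst \<inter> K snd"
      then have "x \<in> ?X" "y \<in> ?X" "H x = H y" by (auto simp: K_def prod_eq_iff)
      then show "(x, y) \<in> Id" using H(1) by (auto simp: bij_betw_def dest: inj_onD)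
    qed
  qed
qed

section \<open>Reducible quandles in coordinates modulo p and q\<close>

lemma bij_betw_pair:
  assumes fin: "finite X" "card X = p * q"
    and h: "\<And>x. x \<in> X \<Longrightarrow> h1 x \<in> {0..<int p}" "\<And>x. x \<in> X \<Longrightarrow> h2 x \<in> {0..<int q}"
    and inj: "\<And>x y. \<lbrakk>x \<in> X; y \<in> X; h1 x = h1 y; h2 x = h2 y\<rbrakk> \<Longrightarrow> x = y"
  shows "bij_betw (\<lambda>x. (h1 x, h2 x)) X ({0..<int p} \<times> {0..<int q})"
proof -
  have i: "inj_on (\<lambda>x. (h1 x, h2 x)) X" using inj by (auto intro: inj_onI)
  have "(\<lambda>x. (h1 x, h2 x)) ` X = {0..<int p} \<times> {0..<int q}"
    by (rule card_subset_eq) (use h fin in \<open>auto simp: card_image[OF i]\<close>)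
  then show ?thesis using i by (simp add: bij_betw_def)
qed

lemma coprime_prime_of_bounds:
  assumes "prime p" "2 \<le> c" "c < int p"
  shows "coprime c (int p)" "coprime (1 - c) (int p)"
proof -
  have "\<not> int p dvd c" "\<not> int p dvd c - 1"
    using assms zdvd_imp_le[of "int p" c] zdvd_imp_le[of "int p" "c - 1"] by auto
  moreover have "int p dvd 1 - c \<longleftrightarrow> int p dvd c - 1" by (metis dvd_minus_iff minus_diff_eq)
  ultimately show "coprime c (int p)" "coprime (1 - c) (int p)"
    using assms(1) by (metis coprime_commute prime_imp_coprime prime_nat_int_transfer)+
qed

text \<open>The coordinates from the two quotients give the product directly. For the count, Chinese
  remainders merge them, and likewise the two multipliers, into one residue and one multiplier
  modulo pq.\<close>

theorem affine_product_of_reducible: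
  assumes p: "prime p" and q: "prime q" and neq: "p \<noteq> q"
    and Q: "connected_quandle Q" and card: "card (carrier Q) = p * q" and red: "subdirectly_reducible Q"
  shows "\<exists>f\<in>auto (integer_mod_group p). \<exists>g\<in>auto (integer_mod_group q).
    Q \<cong>\<^sub>Q Aff (integer_mod_group p) f \<times>\<^sub>Q Aff (integer_mod_group q) g"
    and "\<exists>k<p * q. 2 \<le> k mod p \<and> 2 \<le> k mod q \<and> Q \<cong>\<^sub>Q mod_affine (p * q) k"
proof -
  let ?X = "carrier Q"
  interpret connected_quandle Q by (rule Q)
  have p2: "p > 1" "q > 1" using p q prime_gt_1_nat by auto
  have cop: "coprime p q" using p q neq by (rule primes_coprime)
  have fin: "finite ?X" using card p2 by (metis card.infinite mult_is_0 not_one_less_zero)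
  interpret finite_connected_quandle Q by (rule finite_connected[OF fin])
  obtain h1 h2 :: "'a \<Rightarrow> int" and c1 c2 where
    h: "\<And>x. x \<in> ?X \<Longrightarrow> h1 x \<in> {0..<int p}" "\<And>x. x \<in> ?X \<Longrightarrow> h2 x \<in> {0..<int q}"
    and inj: "\<And>x y. \<lbrakk>x \<in> ?X; y \<in> ?X; h1 x = h1 y; h2 x = h2 y\<rbrakk> \<Longrightarrow> x = y"
    and h1: "\<And>a b. \<lbrakk>a \<in> ?X; b \<in> ?X\<rbrakk> \<Longrightarrow> h1 (a \<triangleright>\<^bsub>Q\<^esub> b) = (h1 a + c1 * (h1 b - h1 a)) mod int p"
    and h2: "\<And>a b. \<lbrakk>a \<in> ?X; b \<in> ?X\<rbrakk> \<Longrightarrow> h2 (a \<triangleright>\<^bsub>Q\<^esub> b) = (h2 a + c2 * (h2 b - h2 a)) mod int q"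
    and c: "2 \<le> c1" "c1 < int p" "2 \<le> c2" "c2 < int q"
    by (rule affine_factors_of_reducible[OF p q neq card red]) (rule that; simp)
  have bij: "bij_betw (\<lambda>x. (h1 x, h2 x)) ?X ({0..<int p} \<times> {0..<int q})"
    by (rule bij_betw_pair[OF fin card h inj])
  define f where "f = (\<lambda>x\<in>{0..<int p}. (c1 * x) mod int p)"
  define g where "g = (\<lambda>x\<in>{0..<int q}. (c2 * x) mod int q)"
  have "f \<in> auto (integer_mod_group p)" "g \<in> auto (integer_mod_group q)"
    unfolding f_def g_def
    using coprime_prime_of_bounds[OF p c(1,2)] coprime_prime_of_bounds[OF q c(3,4)] p2
    by (auto intro: mult_in_auto_integer_mod_group)
  moreover have "Q \<cong>\<^sub>Q Aff (integer_mod_group p) f \<times>\<^sub>Q Aff (integer_mod_group q) g"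
    unfolding quandle_isomorphic_def
  proof (intro exI conjI ballI)
    show "bij_betw (\<lambda>x. (h1 x, h2 x)) ?X
        (carrier (Aff (integer_mod_group p) f \<times>\<^sub>Q Aff (integer_mod_group q) g))"
      using bij p2 by (simp add: quandle_prod_def Aff_def carrier_integer_mod_group)
    fix a b assume ab: "a \<in> ?X" "b \<in> ?X"
    have "h1 a \<triangleright>\<^bsub>Aff (integer_mod_group p) f\<^esub> h1 b = h1 (a \<triangleright>\<^bsub>Q\<^esub> b)"
      unfolding f_def h1[OF ab] by (rule Aff_mult_integer_mod_group) (use h ab p2 in auto)
    moreover have "h2 a \<triangleright>\<^bsub>Aff (integer_mod_group q) g\<^esub> h2 b = h2 (a \<triangleright>\<^bsub>Q\<^esub> b)"
      unfolding g_def h2[OF ab] by (rule Aff_mult_integer_mod_group) (use h ab p2 in auto)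
    ultimately show "(h1 (a \<triangleright>\<^bsub>Q\<^esub> b), h2 (a \<triangleright>\<^bsub>Q\<^esub> b)) =
        (h1 a, h2 a) \<triangleright>\<^bsub>Aff (integer_mod_group p) f \<times>\<^sub>Q Aff (integer_mod_group q) g\<^esub> (h1 b, h2 b)"
      by (simp add: quandle_prod_def)
  qed
  ultimately show "\<exists>f\<in>auto (integer_mod_group p). \<exists>g\<in>auto (integer_mod_group q).
    Q \<cong>\<^sub>Q Aff (integer_mod_group p) f \<times>\<^sub>Q Aff (integer_mod_group q) g" by blast
  have crt: "\<exists>z<p * q. [int z = a] (mod int p) \<and> [int z = b] (mod int q)" for a b
  proof -
    obtain z where z: "z < p * q" "[z = nat (a mod int p)] (mod p)" "[z = nat (b mod int q)] (mod q)"
      using binary_chinese_remainder_unique_nat[OF cop] p2 by (metis less_nat_zero_code not_gr_zero)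
    have "[int z = a mod int p] (mod int p)" "[int z = b mod int q] (mod int q)"
      using z(2,3) p2 by (metis cong_int_iff nat_0_le pos_mod_sign of_nat_0_less_iff less_trans zero_less_one)+
    then show ?thesis using z(1) by (auto simp: cong_def)
  qed
  have eqI: "a = b" if "a < p * q" "b < p * q" "[int a = int b] (mod int p)" "[int a = int b] (mod int q)" for a b
    using coprime_cong_mult_nat[OF _ _ cop, of a b] that by (intro eq_of_cong_int) (auto simp: cong_int_iff simp flip: of_nat_mult)
  obtain k where k: "k < p * q" "[int k = c1] (mod int p)" "[int k = c2] (mod int q)" using crt by blast
  have "int (k mod p) = c1" "int (k mod q) = c2"
    using k(2,3) c by (auto simp: cong_def zmod_int)
  then have k2: "2 \<le> k mod p" "2 \<le> k mod q" using c by auto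
  have "\<forall>x. \<exists>z. z < p * q \<and> [int z = h1 x] (mod int p) \<and> [int z = h2 x] (mod int q)"
    using crt by blast
  from choice[OF this] obtain F where F: "\<And>x. F x < p * q" "\<And>x. [int (F x) = h1 x] (mod int p)" "\<And>x. [int (F x) = h2 x] (mod int q)"
    by blast
  have pq0: "p * q > 0" using p2 by simp
  let ?M = "mod_affine (p * q) k"
  have "Q \<cong>\<^sub>Q ?M"
    unfolding quandle_isomorphic_def
  proof (intro exI conjI ballI)
    have Finj: "inj_on F ?X"
    proof (rule inj_onI)
      fix x y assume xy: "x \<in> ?X" "y \<in> ?X" "F x = F y"
      then have "[h1 x = h1 y] (mod int p)" "[h2 x = h2 y] (mod int q)"
        using F by (metis cong_sym cong_trans)+
      then show "x = y" using inj h xy by (auto simp: cong_def)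
    qed
    have "F ` ?X = {..<p * q}"
      by (rule card_subset_eq) (use F(1) in \<open>auto simp: card_image[OF Finj] card\<close>)
    then show "bij_betw F ?X (carrier ?M)" using Finj by (simp add: bij_betw_def)
    fix a b assume ab: "a \<in> ?X" "b \<in> ?X"
    have M: "[int (F a \<triangleright>\<^bsub>?M\<^esub> F b) = int (F a) + int k * (int (F b) - int (F a))] (mod int (p * q))"
      by (rule cong_mod_affine[OF pq0])
    show "F (a \<triangleright>\<^bsub>Q\<^esub> b) = F a \<triangleright>\<^bsub>?M\<^esub> F b"
    proof (rule eqI)
      have "[int (F a \<triangleright>\<^bsub>?M\<^esub> F b) = int (F a) + int k * (int (F b) - int (F a))] (mod int p)"
        by (rule cong_dvd_modulus[OF M]) simp
      also have "[int (F a) + int k * (int (F b) - int (F a)) = h1 a + c1 * (h1 b - h1 a)] (mod int p)"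
        by (intro cong_add cong_mult cong_diff F k)
      also have "[h1 a + c1 * (h1 b - h1 a) = h1 (a \<triangleright>\<^bsub>Q\<^esub> b)] (mod int p)"
        using h1[OF ab] by (simp add: cong_def)
      also have "[h1 (a \<triangleright>\<^bsub>Q\<^esub> b) = int (F (a \<triangleright>\<^bsub>Q\<^esub> b))] (mod int p)" by (rule cong_sym[OF F(2)])
      finally show "[int (F (a \<triangleright>\<^bsub>Q\<^esub> b)) = int (F a \<triangleright>\<^bsub>?M\<^esub> F b)] (mod int p)" by (rule cong_sym)
      have "[int (F a \<triangleright>\<^bsub>?M\<^esub> F b) = int (F a) + int k * (int (F b) - int (F a))] (mod int q)"
        by (rule cong_dvd_modulus[OF M]) simp
      also have "[int (F a) + int k * (int (F b) - int (F a)) = h2 a + c2 * (h2 b - h2 a)] (mod int q)"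
        by (intro cong_add cong_mult cong_diff F k)
      also have "[h2 a + c2 * (h2 b - h2 a) = h2 (a \<triangleright>\<^bsub>Q\<^esub> b)] (mod int q)"
        using h2[OF ab] by (simp add: cong_def)
      also have "[h2 (a \<triangleright>\<^bsub>Q\<^esub> b) = int (F (a \<triangleright>\<^bsub>Q\<^esub> b))] (mod int q)" by (rule cong_sym[OF F(3)])
      finally show "[int (F (a \<triangleright>\<^bsub>Q\<^esub> b)) = int (F a \<triangleright>\<^bsub>?M\<^esub> F b)] (mod int q)" by (rule cong_sym)
    qed (simp_all add: F(1) mod_affine_closed[OF pq0])
  qed
  then show "\<exists>k<p * q. 2 \<le> k mod p \<and> 2 \<le> k mod q \<and> Q \<cong>\<^sub>Q mod_affine (p * q) k"
    using k(1) k2 by blast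
qed

section \<open>Counting the isomorphism classes\<close>

lemma mod_affine_reducible:
  assumes p: "prime p" and q: "prime q" and neq: "p \<noteq> q"
    and k: "2 \<le> k mod p" "2 \<le> k mod q"
  shows "mod_affine (p * q) k \<in> reducible_connected_quandles (p * q)"
    and "coprime (int k) (int (p * q))" "coprime (1 - int k) (int (p * q))"
proof -
  let ?M = "mod_affine (p * q) k"
  have p2: "p > 1" "q > 1" using p q prime_gt_1_nat by auto
  have pq0: "p * q > 0" using p2 by simp
  \<comment> \<open>A residue of at least 2 is neither 0 nor 1, so \<open>k\<close> and
    \<open>1 - k\<close> are units modulo each prime and hence modulo the product.\<close>
  have cop: "coprime (int k) (int r)" "coprime (1 - int k) (int r)" if "prime r" "2 \<le> k mod r" for r
  proof -
    have "coprime (int (k mod r)) (int r)" "coprime (1 - int (k mod r)) (int r)"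
      using coprime_prime_of_bounds[OF that(1), of "int (k mod r)"] that prime_gt_0_nat[OF that(1)] by simp_all
    moreover have "[int (k mod r) = int k] (mod int r)" by (simp add: cong_def zmod_int)
    moreover from this have "[1 - int (k mod r) = 1 - int k] (mod int r)" by (intro cong_diff cong_refl)
    ultimately show "coprime (int k) (int r)" "coprime (1 - int k) (int r)"
      by (metis cong_imp_coprime)+
  qed
  show cop1: "coprime (int k) (int (p * q))" and cop2: "coprime (1 - int k) (int (p * q))"
    using cop[OF p k(1)] cop[OF q k(2)] by simp_all
  have conn: "connected_quandle ?M" by (rule connected_quandle_mod_affine[OF pq0 cop1 cop2])
  then interpret connected_quandle ?M .
  \<comment> \<open>For \<open>r\<close> equal to p and to q these are the separating congruences,
    the kernels of reduction modulo \<open>r\<close> to \<open>mod_affine r k\<close>.\<close>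
  define K where "K r = {(x, y) \<in> carrier ?M \<times> carrier ?M. x mod r = y mod r}" for r
  have congr: "congruence_on ?M (K r)" if r: "r dvd p * q" "coprime (int k) (int r)" "r > 0" for r
    unfolding K_def
  proof (rule congruence_on_kernel)
    have cg: "[int (a \<triangleright>\<^bsub>?M\<^esub> b) = int a + int k * (int b - int a)] (mod int r)" for a b
      by (rule cong_dvd_modulus[OF cong_mod_affine[OF pq0]]) (simp only: of_nat_dvd_iff r(1))
    show "(a \<triangleright>\<^bsub>?M\<^esub> b) mod r = (a mod r) \<triangleright>\<^bsub>mod_affine r k\<^esub> (b mod r)" for a b
    proof -
      have "[int a + int k * (int b - int a) = int (a mod r) + int k * (int (b mod r) - int (a mod r))] (mod int r)"
        by (intro cong_add cong_mult cong_diff cong_refl) (simp_all add: cong_def zmod_int)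
      also have "[int (a mod r) + int k * (int (b mod r) - int (a mod r))
          = int ((a mod r) \<triangleright>\<^bsub>mod_affine r k\<^esub> (b mod r))] (mod int r)"
        by (rule cong_sym[OF cong_mod_affine[OF r(3)]])
      finally have "[int (a \<triangleright>\<^bsub>?M\<^esub> b) = int ((a mod r) \<triangleright>\<^bsub>mod_affine r k\<^esub> (b mod r))] (mod int r)"
        using cg cong_trans by blast
      then have "[a \<triangleright>\<^bsub>?M\<^esub> b = (a mod r) \<triangleright>\<^bsub>mod_affine r k\<^esub> (b mod r)] (mod r)"
        by (simp only: cong_int_iff)
      then show ?thesis using mod_affine_closed[OF r(3)] by (simp add: cong_def)
    qed
    show "b mod r = c mod r" if "(a mod r) \<triangleright>\<^bsub>mod_affine r k\<^esub> (b mod r) = (a mod r) \<triangleright>\<^bsub>mod_affine r k\<^esub> (c mod r)" for a b c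
    proof -
      have "[int (a mod r) + int k * (int (b mod r) - int (a mod r))
          = int (a mod r) + int k * (int (c mod r) - int (a mod r))] (mod int r)"
        using cong_mod_affine[OF r(3)] that by (metis cong_sym cong_trans)
      then have "[int k * (int (b mod r) - int (a mod r)) = int k * (int (c mod r) - int (a mod r))] (mod int r)"
        using cong_add_lcancel by blast
      then have "[int (b mod r) - int (a mod r) = int (c mod r) - int (a mod r)] (mod int r)"
        using r(2) by (simp add: cong_mult_lcancel)
      then have "[int (b mod r) = int (c mod r)] (mod int r)" by (simp add: cong_iff_dvd_diff)
      then show ?thesis using r(3) by (intro eq_of_cong_int) simp_all
    qed
  qed
  have nontriv: "K r \<noteq> Id_on (carrier ?M)" if "r < p * q" "r > 0" for r
  proof
    assume "K r = Id_on (carrier ?M)"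
    moreover have "(0, r) \<in> K r" using that pq0 by (simp add: K_def)
    ultimately show False using that by auto
  qed
  have "subdirectly_reducible ?M"
  proof (rule subdirectly_reducible_of_separating_congruences)
    show "congruence_on ?M (K p)" "congruence_on ?M (K q)"
      using congr cop[OF p k(1)] cop[OF q k(2)] p2 by auto
    show "K p \<noteq> Id_on (carrier ?M)" "K q \<noteq> Id_on (carrier ?M)" using nontriv p2 by auto
    show "K p \<inter> K q \<subseteq> Id"
    proof (rule subrelI)
      fix x y assume "(x, y) \<in> K p \<inter> K q"
      then have xy: "x < p * q" "y < p * q" "[x = y] (mod p)" "[x = y] (mod q)" by (auto simp: K_def cong_def)
      then have "[x = y] (mod p * q)" using p q neq by (intro coprime_cong_mult_nat primes_coprime)
      then show "(x, y) \<in> Id" using xy by (simp add: cong_def)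
    qed
  qed
  then show "?M \<in> reducible_connected_quandles (p * q)"
    using conn by (simp add: reducible_connected_quandles_def)
qed

text \<open>Chinese remainders, with the residues 0 and 1 lost in each factor. A modulus of at most
  2 has no residue left, in agreement with the truncated subtraction.\<close>

lemma card_two_residues_ge_2:
  fixes p q :: nat
  assumes cop: "coprime p q" and pq: "p > 0" "q > 0"
  shows "card {k. k < p * q \<and> 2 \<le> k mod p \<and> 2 \<le> k mod q} = (p - 2) * (q - 2)"
proof -
  have "bij_betw (\<lambda>k. (k mod p, k mod q)) {k. k < p * q \<and> 2 \<le> k mod p \<and> 2 \<le> k mod q} ({2..<p} \<times> {2..<q})"
    unfolding bij_betw_def
  proof (intro conjI equalityI subsetI)
    show "inj_on (\<lambda>k. (k mod p, k mod q)) {k. k < p * q \<and> 2 \<le> k mod p \<and> 2 \<le> k mod q}"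
    proof (rule inj_onI)
      fix x y assume "x \<in> {k. k < p * q \<and> 2 \<le> k mod p \<and> 2 \<le> k mod q}"
        "y \<in> {k. k < p * q \<and> 2 \<le> k mod p \<and> 2 \<le> k mod q}" "(x mod p, x mod q) = (y mod p, y mod q)"
      then have "x < p * q" "y < p * q" "[x = y] (mod p)" "[x = y] (mod q)" by (auto simp: cong_def)
      then show "x = y" using coprime_cong_mult_nat[of x y p q] cop by (simp add: cong_def)
    qed
    fix z assume "z \<in> {2..<p} \<times> {2..<q}"
    then obtain a b where ab: "z = (a, b)" "2 \<le> a" "a < p" "2 \<le> b" "b < q" by auto
    obtain k where "k < p * q" "[k = a] (mod p)" "[k = b] (mod q)"
      using binary_chinese_remainder_unique_nat[OF cop] pq by (metis not_gr_zero)
    then show "z \<in> (\<lambda>k. (k mod p, k mod q)) ` {k. k < p * q \<and> 2 \<le> k mod p \<and> 2 \<le> k mod q}"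
      using ab by (intro image_eqI[of _ _ k]) (auto simp: cong_def)
  qed (use pq in auto)
  then show ?thesis by (simp add: bij_betw_same_card)
qed

text \<open>The multipliers \<open>k\<close> whose residues modulo p and q are both at least 2 form
  a system of representatives: every class contains such a \<open>mod_affine\<close> quandle, and
  \<open>mod_affine_isomorphic_eq\<close> tells them apart.\<close>

theorem card_reducible_connected_quandles:
  assumes p: "prime p" and q: "prime q" and neq: "p \<noteq> q"
  shows "finite (isomorphism_classes (reducible_connected_quandles (p * q)))"
    and "card (isomorphism_classes (reducible_connected_quandles (p * q))) = (p - 2) * (q - 2)"
proof -
  define S where "S = reducible_connected_quandles (p * q)"
  define E where "E = {(Q, R) \<in> S \<times> S. Q \<cong>\<^sub>Q R}"
  define K where "K = {k. k < p * q \<and> 2 \<le> k mod p \<and> 2 \<le> k mod q}"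
  let ?M = "mod_affine (p * q)"
  have p2: "p > 0" "q > 0" using p q prime_gt_0_nat by auto
  have pq0: "p * q > 0" using p2 by simp
  have Sq: "quandle Q" if "Q \<in> S" for Q
    using that connected_quandle.axioms(1) by (auto simp: S_def reducible_connected_quandles_def)
  have E: "equiv S E"
  proof (rule equivI)
    show "E \<subseteq> S \<times> S" by (auto simp: E_def)
    show "refl_on S E" by (auto simp: E_def refl_on_def quandle_isomorphic_refl)
    show "sym E" using quandle_isomorphic_sym Sq by (auto simp: E_def sym_def)
    show "trans E" using quandle_isomorphic_trans by (auto simp: E_def trans_def)
  qed
  have MS: "?M k \<in> S" if "k \<in> K" for k
    using mod_affine_reducible(1)[OF p q neq] that by (simp add: K_def S_def)
  have img: "S // E = (\<lambda>k. E `` {?M k}) ` K"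
  proof (intro equalityI subsetI)
    fix Z assume "Z \<in> S // E"
    then obtain Q where Q: "Q \<in> S" "Z = E `` {Q}" by (elim quotientE)
    then obtain k where k: "k < p * q" "2 \<le> k mod p" "2 \<le> k mod q" "Q \<cong>\<^sub>Q ?M k"
      using affine_product_of_reducible(2)[OF p q neq, of Q] by (auto simp: S_def reducible_connected_quandles_def)
    then have kK: "k \<in> K" by (simp add: K_def)
    then have "(Q, ?M k) \<in> E" using k(4) Q MS by (simp add: E_def)
    then have "Z = E `` {?M k}" using equiv_class_eq[OF E] Q by blast
    then show "Z \<in> (\<lambda>k. E `` {?M k}) ` K" using kK by blast
  qed (use MS in \<open>auto intro: quotientI\<close>)
  have inj: "inj_on (\<lambda>k. E `` {?M k}) K"
  proof (rule inj_onI)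
    fix k k' assume k: "k \<in> K" "k' \<in> K" "E `` {?M k} = E `` {?M k'}"
    then have "(?M k, ?M k') \<in> E" using eq_equiv_class[OF _ E] MS by blast
    then have "?M k \<cong>\<^sub>Q ?M k'" by (simp add: E_def)
    then show "k = k'"
      using mod_affine_isomorphic_eq[OF pq0 _ _ _, of k k'] mod_affine_reducible(2,3)[OF p q neq] k
      by (simp add: K_def)
  qed
  have fK: "finite K" by (rule finite_subset[of _ "{..<p * q}"]) (auto simp: K_def)
  have iso: "isomorphism_classes S = (\<lambda>k. E `` {?M k}) ` K"
    unfolding isomorphism_classes_def E_def[symmetric] by (rule img)
  show "finite (isomorphism_classes (reducible_connected_quandles (p * q)))"
    using fK iso unfolding S_def by simp
  have "card K = (p - 2) * (q - 2)"
    unfolding K_def using p q neq p2 by (intro card_two_residues_ge_2 primes_coprime)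
  then show "card (isomorphism_classes (reducible_connected_quandles (p * q))) = (p - 2) * (q - 2)"
    using iso card_image[OF inj] unfolding S_def by simp
qed

theorem proposition4p2:
  fixes p q :: nat
  assumes "prime p" and "prime q" and "p \<noteq> q"
  shows "(\<forall>Q :: 'a binary_struct.
            connected_quandle Q \<and> card (carrier Q) = p * q \<longrightarrow>
              ((\<exists>f \<in> auto (integer_mod_group p). \<exists>g \<in> auto (integer_mod_group q).
                  Q \<cong>\<^sub>Q Aff (integer_mod_group p) f \<times>\<^sub>Q Aff (integer_mod_group q) g)
               \<longleftrightarrow> subdirectly_reducible Q)) \<and>
         finite (isomorphism_classes (reducible_connected_quandles (p * q))) \<and>
         card (isomorphism_classes (reducible_connected_quandles (p * q))) = (p - 2) * (q - 2)"
proof (intro conjI allI impI)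
  fix Q :: "'a binary_struct"
  assume Q: "connected_quandle Q \<and> card (carrier Q) = p * q"
  then have conn: "connected_quandle Q" and card: "card (carrier Q) = p * q" by auto
  show "(\<exists>f \<in> auto (integer_mod_group p). \<exists>g \<in> auto (integer_mod_group q).
      Q \<cong>\<^sub>Q Aff (integer_mod_group p) f \<times>\<^sub>Q Aff (integer_mod_group q) g)
    \<longleftrightarrow> subdirectly_reducible Q"
    using affine_product_of_reducible(1)[OF assms conn card]
      subdirectly_reducible_of_affine_product[OF assms(1,2) connected_quandle.axioms(1)[OF conn] card]
    by blast
qed (use card_reducible_connected_quandles[OF assms] in auto)

end
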